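(* Let $G=(V,E,s)$ be a reducible flow graph with $n$ vertices and initially $m$ edges. The dominator tree of $G$ can be maintained through any sequence of edge deletions in $O(mn)$ total time.
   Context: A flow graph $G=(V,E,s)$ is a directed graph with a distinguished start vertex $s$. A vertex $w$ dominates $v$ if every path from $s$ to $v$ contains $w$; the dominator tree is the tree rooted at $s$ on the vertices reachable from $s$ in which the parent of each $v\neq s$ is its immediate dominator (the dominator of $v$ other than $v$ that is dominated by all other dominators of $v$ other than $v$). A flow graph is reducible if every strongly connected subgraph $S$ has a single entry vertex $v$ such that every path from $s$ to a vertex of $S$ contains $v$. *)

theory Defs
  imports "Graph_Theory.Graph_Theory"
begin

section \<open>Flow graphs and dominators\<close>

locale flow_graph = pair_fin_digraph G for G :: "'a pair_pre_digraph" +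
  fixes s :: 'a
  assumes start_in_verts: "s \<in> pverts G"

definition dominates :: "'a pair_pre_digraph \<Rightarrow> 'a \<Rightarrow> 'a \<Rightarrow> 'a \<Rightarrow> bool" where
  "dominates G s w v \<longleftrightarrow>
     (\<forall>p. pre_digraph.awalk (with_proj G) s p v \<longrightarrow>
          w \<in> set (pre_digraph.awalk_verts (with_proj G) s p))"

definition immediate_dominator :: "'a pair_pre_digraph \<Rightarrow> 'a \<Rightarrow> 'a \<Rightarrow> 'a \<Rightarrow> bool" where
  "immediate_dominator G s d v \<longleftrightarrow>
     dominates G s d v \<and> d \<noteq> v \<and>
     (\<forall>w. dominates G s w v \<and> w \<noteq> v \<and> w \<noteq> d \<longrightarrow> dominates G s w d)"

text \<open>Arcs of the dominator tree point from the parent to the child.\<close>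

definition dominator_tree :: "'a pair_pre_digraph \<Rightarrow> 'a \<Rightarrow> 'a pair_pre_digraph" where
  "dominator_tree G s =
     \<lparr> pverts = {v. s \<rightarrow>\<^sup>*\<^bsub>with_proj G\<^esub> v},
       parcs = {(d, v). s \<rightarrow>\<^sup>*\<^bsub>with_proj G\<^esub> v \<and> v \<noteq> s \<and> immediate_dominator G s d v} \<rparr>"

text \<open>The entry vertex has to belong to \<open>S\<close>; otherwise \<open>s\<close> would always qualify.\<close>

definition reducible :: "'a pair_pre_digraph \<Rightarrow> 'a \<Rightarrow> bool" where
  "reducible G s \<longleftrightarrow>
     (\<forall>S. subgraph S (with_proj G) \<and> strongly_connected S \<longrightarrow>
       (\<exists>v \<in> verts S. \<forall>u \<in> verts S. \<forall>p. pre_digraph.awalk (with_proj G) s p u \<longrightarrow>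
          v \<in> set (pre_digraph.awalk_verts (with_proj G) s p)))"

definition delete_edge :: "'a pair_pre_digraph \<Rightarrow> 'a \<times> 'a \<Rightarrow> 'a pair_pre_digraph" where
  "delete_edge G e = G\<lparr> parcs := parcs G - {e} \<rparr>"


section \<open>Random access machine\<close>

text \<open>
  A structured presentation of the word RAM. The memory consists of named, unbounded arrays of
  natural numbers, of which a program mentions only finitely many; a scalar variable is
  cell \<open>0\<close> of an array. Subtraction is truncated at \<open>0\<close>, and \<open>x div 0 = 0\<close>, \<open>x mod 0 = x\<close>.
\<close>

type_synonym vname = string
type_synonym state = "vname \<Rightarrow> nat \<Rightarrow> nat"

datatype binop = Plus | Minus | Times | Quot | Rem

datatype expr = Const nat | Cell vname expr | Bin binop expr expr

datatype cond = Less expr expr | Equal expr expr | Neg cond | Conj cond cond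

datatype com =
    Skip
  | Assign vname expr expr  \<comment> \<open>array, index, new value\<close>
  | Seq com com
  | If cond com com
  | While cond com

fun binop_val :: "binop \<Rightarrow> nat \<Rightarrow> nat \<Rightarrow> nat" where
  "binop_val Plus a b = a + b"
| "binop_val Minus a b = a - b"
| "binop_val Times a b = a * b"
| "binop_val Quot a b = a div b"
| "binop_val Rem a b = a mod b"

fun expr_val :: "expr \<Rightarrow> state \<Rightarrow> nat" where
  "expr_val (Const k) \<sigma> = k"
| "expr_val (Cell x e) \<sigma> = \<sigma> x (expr_val e \<sigma>)"
| "expr_val (Bin f a b) \<sigma> = binop_val f (expr_val a \<sigma>) (expr_val b \<sigma>)"

fun cond_val :: "cond \<Rightarrow> state \<Rightarrow> bool" where
  "cond_val (Less a b) \<sigma> \<longleftrightarrow> expr_val a \<sigma> < expr_val b \<sigma>"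
| "cond_val (Equal a b) \<sigma> \<longleftrightarrow> expr_val a \<sigma> = expr_val b \<sigma>"
| "cond_val (Neg b) \<sigma> \<longleftrightarrow> \<not> cond_val b \<sigma>"
| "cond_val (Conj b c) \<sigma> \<longleftrightarrow> cond_val b \<sigma> \<and> cond_val c \<sigma>"

text \<open>
  Every value that occurs during an evaluation, addresses included, has to fit into a machine
  word, that is, has to be smaller than \<open>W\<close>. An overflowing computation is stuck.
\<close>

fun expr_fits :: "nat \<Rightarrow> expr \<Rightarrow> state \<Rightarrow> bool" where
  "expr_fits W (Const k) \<sigma> \<longleftrightarrow> k < W"
| "expr_fits W (Cell x e) \<sigma> \<longleftrightarrow> expr_fits W e \<sigma> \<and> \<sigma> x (expr_val e \<sigma>) < W"
| "expr_fits W (Bin f a b) \<sigma> \<longleftrightarrow>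
     expr_fits W a \<sigma> \<and> expr_fits W b \<sigma> \<and> expr_val (Bin f a b) \<sigma> < W"

fun cond_fits :: "nat \<Rightarrow> cond \<Rightarrow> state \<Rightarrow> bool" where
  "cond_fits W (Less a b) \<sigma> \<longleftrightarrow> expr_fits W a \<sigma> \<and> expr_fits W b \<sigma>"
| "cond_fits W (Equal a b) \<sigma> \<longleftrightarrow> expr_fits W a \<sigma> \<and> expr_fits W b \<sigma>"
| "cond_fits W (Neg b) \<sigma> \<longleftrightarrow> cond_fits W b \<sigma>"
| "cond_fits W (Conj b c) \<sigma> \<longleftrightarrow> cond_fits W b \<sigma> \<and> cond_fits W c \<sigma>"

fun expr_cost :: "expr \<Rightarrow> nat" where
  "expr_cost (Const k) = 1"
| "expr_cost (Cell x e) = 1 + expr_cost e"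
| "expr_cost (Bin f a b) = 1 + expr_cost a + expr_cost b"

fun cond_cost :: "cond \<Rightarrow> nat" where
  "cond_cost (Less a b) = 1 + expr_cost a + expr_cost b"
| "cond_cost (Equal a b) = 1 + expr_cost a + expr_cost b"
| "cond_cost (Neg b) = 1 + cond_cost b"
| "cond_cost (Conj b c) = 1 + cond_cost b + cond_cost c"

definition store :: "state \<Rightarrow> vname \<Rightarrow> nat \<Rightarrow> nat \<Rightarrow> state" where
  "store \<sigma> x i k = \<sigma>(x := (\<sigma> x)(i := k))"

text \<open>\<open>exec W c \<sigma> t \<sigma>'\<close>: with word bound \<open>W\<close>, started in \<open>\<sigma>\<close>, \<open>c\<close> halts after \<open>t\<close> steps in \<open>\<sigma>'\<close>.\<close>

inductive exec :: "nat \<Rightarrow> com \<Rightarrow> state \<Rightarrow> nat \<Rightarrow> state \<Rightarrow> bool" for W :: nat where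
  Skip: "exec W Skip \<sigma> 1 \<sigma>"
| Assign: "\<lbrakk> expr_fits W i \<sigma>; expr_fits W e \<sigma> \<rbrakk> \<Longrightarrow>
    exec W (Assign x i e) \<sigma> (1 + expr_cost i + expr_cost e)
      (store \<sigma> x (expr_val i \<sigma>) (expr_val e \<sigma>))"
| Seq: "\<lbrakk> exec W c1 \<sigma> t1 \<sigma>1; exec W c2 \<sigma>1 t2 \<sigma>2 \<rbrakk> \<Longrightarrow> exec W (Seq c1 c2) \<sigma> (t1 + t2) \<sigma>2"
| IfTrue: "\<lbrakk> cond_fits W b \<sigma>; cond_val b \<sigma>; exec W c1 \<sigma> t \<sigma>' \<rbrakk> \<Longrightarrow>
    exec W (If b c1 c2) \<sigma> (1 + cond_cost b + t) \<sigma>'"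
| IfFalse: "\<lbrakk> cond_fits W b \<sigma>; \<not> cond_val b \<sigma>; exec W c2 \<sigma> t \<sigma>' \<rbrakk> \<Longrightarrow>
    exec W (If b c1 c2) \<sigma> (1 + cond_cost b + t) \<sigma>'"
| WhileFalse: "\<lbrakk> cond_fits W b \<sigma>; \<not> cond_val b \<sigma> \<rbrakk> \<Longrightarrow>
    exec W (While b c) \<sigma> (1 + cond_cost b) \<sigma>"
| WhileTrue: "\<lbrakk> cond_fits W b \<sigma>; cond_val b \<sigma>; exec W c \<sigma> t1 \<sigma>1; exec W (While b c) \<sigma>1 t2 \<sigma>2 \<rbrakk> \<Longrightarrow>
    exec W (While b c) \<sigma> (1 + cond_cost b + t1 + t2) \<sigma>2"

inductive_cases exec_elims:
  "exec W Skip \<sigma> t \<sigma>'"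
  "exec W (Assign x i e) \<sigma> t \<sigma>'"
  "exec W (Seq c1 c2) \<sigma> t \<sigma>'"
  "exec W (If b c1 c2) \<sigma> t \<sigma>'"

inductive_cases exec_WhileE: "exec W (While b c) \<sigma> t \<sigma>'"

lemma exec_deterministic:
  assumes "exec W c \<sigma> t \<sigma>'" and "exec W c \<sigma> u \<tau>"
  shows "u = t \<and> \<tau> = \<sigma>'"
  using assms
proof (induction arbitrary: u \<tau> rule: exec.induct)
  case (Seq c1 \<sigma> t1 \<sigma>1 c2 t2 \<sigma>2)
  then show ?case by (blast elim: exec_elims)
next
  case (WhileFalse b \<sigma> c)
  from WhileFalse.prems show ?case
    by (rule exec_WhileE) (use WhileFalse.hyps in auto)
next
  case (WhileTrue b \<sigma> c t1 \<sigma>1 t2 \<sigma>2)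
  from WhileTrue.prems obtain v1 \<tau>1 v2 where *: "u = 1 + cond_cost b + v1 + v2"
    "exec W c \<sigma> v1 \<tau>1" "exec W (While b c) \<tau>1 v2 \<tau>"
    by (rule exec_WhileE) (use WhileTrue.hyps in auto)
  with WhileTrue.IH(1) have "v1 = t1" "\<tau>1 = \<sigma>1" by blast+
  with * WhileTrue.IH(2) show ?case by blast
next
  case (IfTrue b \<sigma> c1 t \<sigma>' c2)
  from IfTrue.prems show ?case
    by (rule exec_elims(4)) (use IfTrue.hyps IfTrue.IH in \<open>metis plus_1_eq_Suc add_Suc\<close>)+
next
  case (IfFalse b \<sigma> c2 t \<sigma>' c1)
  from IfFalse.prems show ?case
    by (rule exec_elims(4)) (use IfFalse.hyps IfFalse.IH in \<open>metis plus_1_eq_Suc add_Suc\<close>)+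
next
  case (Skip \<sigma>)
  then show ?case by (rule exec_elims(1)) simp
next
  case (Assign i \<sigma> e x)
  from Assign.prems show ?case by (rule exec_elims(2)) simp
qed


section \<open>Maintaining a dominator tree under edge deletions\<close>

text \<open>
  The input graph is given on the vertices \<open>0, \<dots>, n - 1\<close> as a list of its edges. All cells that
  do not hold input are initially \<open>0\<close>.
\<close>

definition input_state :: "nat \<Rightarrow> nat \<Rightarrow> (nat \<times> nat) list \<Rightarrow> state" where
  "input_state n s as = (\<lambda>_ _. 0)
     (''n'' := (\<lambda>_. 0)(0 := n),
      ''m'' := (\<lambda>_. 0)(0 := length as),
      ''s'' := (\<lambda>_. 0)(0 := s),
      ''tail'' := (\<lambda>i. if i < length as then fst (as ! i) else 0),
      ''head'' := (\<lambda>i. if i < length as then snd (as ! i) else 0))"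

definition request :: "nat \<times> nat \<Rightarrow> state \<Rightarrow> state" where
  "request e \<sigma> = store (store \<sigma> ''del_tail'' 0 (fst e)) ''del_head'' 0 (snd e)"

definition stored_tree :: "nat \<Rightarrow> nat \<Rightarrow> state \<Rightarrow> nat pair_pre_digraph" where
  "stored_tree n s \<sigma> =
     \<lparr> pverts = {v. v < n \<and> \<sigma> ''in_tree'' v \<noteq> 0},
       parcs = {(\<sigma> ''parent'' v, v) |v. v < n \<and> \<sigma> ''in_tree'' v \<noteq> 0 \<and> v \<noteq> s} \<rparr>"

text \<open>
  \<open>maintains W upd n G s \<sigma> es t\<close>: in state \<open>\<sigma>\<close> the dominator tree of \<open>G\<close> is stored, and serving the
  deletions \<open>es\<close> one by one with \<open>upd\<close> takes \<open>t\<close> steps in total, the dominator tree of the current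
  graph being stored after each of them. The program sees a deletion only when its turn comes.
\<close>

fun maintains ::
  "nat \<Rightarrow> com \<Rightarrow> nat \<Rightarrow> nat pair_pre_digraph \<Rightarrow> nat \<Rightarrow> state \<Rightarrow> (nat \<times> nat) list \<Rightarrow> nat \<Rightarrow> bool"
where
  "maintains W upd n G s \<sigma> [] t \<longleftrightarrow> stored_tree n s \<sigma> = dominator_tree G s \<and> t = 0"
| "maintains W upd n G s \<sigma> (e # es) t \<longleftrightarrow>
     stored_tree n s \<sigma> = dominator_tree G s \<and>
     (\<exists>t1 \<sigma>' t2. exec W upd (request e \<sigma>) t1 \<sigma>' \<and>
        maintains W upd n (delete_edge G e) s \<sigma>' es t2 \<and> t = t1 + t2)"

end

theory Submission
  imports Defs "HOL-Library.Sublist"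
begin

text \<open>
  A vertex \<open>w\<close> dominates \<open>v\<close> iff \<open>v\<close> cannot be reached from \<open>s\<close> once \<open>w\<close> is removed, so it suffices
  to maintain, for each of the \<open>n\<close> vertices \<open>w\<close>, the set of vertices reachable in \<open>G - w\<close>, each
  within \<open>O(m)\<close> total time.

  Call an edge \<open>(u, v)\<close> forward if \<open>v\<close> does not dominate \<open>u\<close> in the initial graph. The other edges
  never matter for reachability in any \<open>G - w\<close>, now or after deletions, because a simple path from
  \<open>s\<close> cannot use them; and in a reducible graph the forward edges are acyclic. On an acyclic graph
  decremental reachability is easy: a vertex stays reachable as long as the number of its reachable
  predecessors, kept in a counter, is positive, and a vertex whose counter drops to \<open>0\<close> decrements
  the counters of its successors. Every vertex dies at most once per \<open>w\<close>, which pays for scanning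
  its outgoing edges. Initially, a search in each \<open>G - w\<close> counts the reachable predecessors along
  all edges; this already tells which edges are forward, and the others are then taken off the
  counters, which makes no vertex die.

  Deletions only enlarge the sets of dominators. The new parent of \<open>v\<close> is the deepest among the old
  parent and the vertices \<open>w\<close> such that \<open>v\<close> has just died in \<open>G - w\<close>; depths are compared by asking
  whether the current candidate dominates \<open>w\<close>.
\<close>


section \<open>Timed total correctness\<close>

definition wp :: "nat \<Rightarrow> com \<Rightarrow> (nat \<Rightarrow> state \<Rightarrow> bool) \<Rightarrow> state \<Rightarrow> bool" where
  "wp W c Q \<sigma> \<longleftrightarrow> (\<exists>t \<tau>. exec W c \<sigma> t \<tau> \<and> Q t \<tau>)"

lemma wp_Skip: "wp W Skip Q \<sigma> \<longleftrightarrow> Q 1 \<sigma>"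
  unfolding wp_def by (auto intro: exec.Skip[simplified] elim!: exec_elims)

lemma wp_Assign:
  "wp W (Assign x i e) Q \<sigma> \<longleftrightarrow> expr_fits W i \<sigma> \<and> expr_fits W e \<sigma> \<and>
     Q (1 + expr_cost i + expr_cost e) (store \<sigma> x (expr_val i \<sigma>) (expr_val e \<sigma>))"
  unfolding wp_def by (auto intro: exec.Assign[simplified] elim!: exec_elims)

lemma wp_Seq: "wp W (Seq c1 c2) Q \<sigma> \<longleftrightarrow> wp W c1 (\<lambda>t1. wp W c2 (\<lambda>t2. Q (t1 + t2))) \<sigma>"
  unfolding wp_def by (blast intro: exec.Seq elim: exec_elims)

lemma wp_If:
  "wp W (If b c1 c2) Q \<sigma> \<longleftrightarrow> cond_fits W b \<sigma> \<and>
     wp W (if cond_val b \<sigma> then c1 else c2) (\<lambda>t. Q (1 + cond_cost b + t)) \<sigma>"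
  unfolding wp_def
  by (auto intro: exec.IfTrue[simplified] exec.IfFalse[simplified] elim!: exec_elims)

lemmas wp_simps = wp_Skip wp_Assign wp_Seq wp_If

lemma wp_mono: "wp W c Q \<sigma> \<Longrightarrow> (\<And>t \<tau>. Q t \<tau> \<Longrightarrow> R t \<tau>) \<Longrightarrow> wp W c R \<sigma>"
  unfolding wp_def by blast

lemma store_apply [simp]: "store \<sigma> x i k y = (if y = x then (\<sigma> x)(i := k) else \<sigma> y)"
  by (simp add: store_def)

definition bounded_state :: "nat \<Rightarrow> state \<Rightarrow> bool" where
  "bounded_state W \<sigma> \<longleftrightarrow> (\<forall>x i. \<sigma> x i < W)"

lemma bounded_stateD [simp]: "bounded_state W \<sigma> \<Longrightarrow> \<sigma> x i < W"
  by (simp add: bounded_state_def)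

lemma bounded_state_store [simp]: "bounded_state W \<sigma> \<Longrightarrow> k < W \<Longrightarrow> bounded_state W (store \<sigma> x i k)"
  by (simp add: bounded_state_def)

lemma expr_val_less: "expr_fits W e \<sigma> \<Longrightarrow> expr_val e \<sigma> < W"
  by (cases e) auto

lemma exec_bounded_state: "exec W c \<sigma> t \<tau> \<Longrightarrow> bounded_state W \<sigma> \<Longrightarrow> bounded_state W \<tau>"
  by (induction rule: exec.induct) (auto intro: bounded_state_store expr_val_less)

fun writes :: "com \<Rightarrow> vname set" where
  "writes Skip = {}"
| "writes (Assign x i e) = {x}"
| "writes (Seq c1 c2) = writes c1 \<union> writes c2"
| "writes (If b c1 c2) = writes c1 \<union> writes c2"
| "writes (While b c) = writes c"

fun reads :: "expr \<Rightarrow> vname set" where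
  "reads (Const k) = {}"
| "reads (Cell x e) = insert x (reads e)"
| "reads (Bin f a b) = reads a \<union> reads b"

definition agree_off :: "vname set \<Rightarrow> state \<Rightarrow> state \<Rightarrow> bool" where
  "agree_off X \<sigma> \<tau> \<longleftrightarrow> (\<forall>x. x \<notin> X \<longrightarrow> \<tau> x = \<sigma> x)"

lemma agree_offD: "agree_off X \<sigma> \<tau> \<Longrightarrow> x \<notin> X \<Longrightarrow> \<tau> x = \<sigma> x"
  by (simp add: agree_off_def)

lemma agree_off_trans: "agree_off X \<rho> \<sigma> \<Longrightarrow> agree_off X \<sigma> \<tau> \<Longrightarrow> agree_off X \<rho> \<tau>"
  by (simp add: agree_off_def)

lemma exec_agree_off: "exec W c \<sigma> t \<tau> \<Longrightarrow> agree_off (writes c) \<sigma> \<tau>"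
  by (induction rule: exec.induct) (auto simp: agree_off_def)

lemma expr_val_agree_off:
  "agree_off X \<sigma> \<tau> \<Longrightarrow> reads e \<inter> X = {} \<Longrightarrow> expr_val e \<tau> = expr_val e \<sigma>"
  by (induction e) (auto simp: agree_offD Int_Un_distrib2)

lemma expr_fits_agree_off:
  "agree_off X \<sigma> \<tau> \<Longrightarrow> reads e \<inter> X = {} \<Longrightarrow> expr_fits W e \<tau> \<longleftrightarrow> expr_fits W e \<sigma>"
  by (induction e) (auto simp: agree_offD expr_val_agree_off Int_Un_distrib2)

lemma wp_frame:
  assumes "wp W c Q \<sigma>" "bounded_state W \<sigma>"
    and "\<And>t \<tau>. Q t \<tau> \<Longrightarrow> bounded_state W \<tau> \<Longrightarrow> agree_off (writes c) \<sigma> \<tau> \<Longrightarrow> R t \<tau>"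
  shows "wp W c R \<sigma>"
  using assms unfolding wp_def by (blast dest: exec_bounded_state exec_agree_off)

lemma wp_obtain:
  assumes "wp W c Q \<sigma>" "bounded_state W \<sigma>"
  obtains t \<tau> where "exec W c \<sigma> t \<tau>" "Q t \<tau>" "bounded_state W \<tau>" "agree_off (writes c) \<sigma> \<tau>"
  using assms unfolding wp_def by (blast dest: exec_bounded_state exec_agree_off)

lemma wp_While:
  fixes \<Phi> :: "state \<Rightarrow> nat"
  assumes "I \<sigma>" and fits: "\<And>\<sigma>. I \<sigma> \<Longrightarrow> cond_fits W b \<sigma>"
    and step: "\<And>\<sigma>. I \<sigma> \<Longrightarrow> cond_val b \<sigma> \<Longrightarrow>
      wp W c (\<lambda>t \<tau>. I \<tau> \<and> 1 + cond_cost b + t + \<Phi> \<tau> \<le> \<Phi> \<sigma>) \<sigma>"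
    and final: "\<And>t \<tau>. \<lbrakk>I \<tau>; \<not> cond_val b \<tau>; t + \<Phi> \<tau> \<le> 1 + cond_cost b + \<Phi> \<sigma>\<rbrakk> \<Longrightarrow> Q t \<tau>"
  shows "wp W (While b c) Q \<sigma>"
proof -
  have "wp W (While b c) (\<lambda>t \<tau>. I \<tau> \<and> \<not> cond_val b \<tau> \<and> t + \<Phi> \<tau> \<le> 1 + cond_cost b + \<Phi> \<sigma>) \<sigma>"
    using assms(1)
  proof (induction "\<Phi> \<sigma>" arbitrary: \<sigma> rule: less_induct)
    case less
    show ?case
    proof (cases "cond_val b \<sigma>")
      case False
      with less.prems show ?thesis
        unfolding wp_def using exec.WhileFalse[OF fits] by blast
    next
      case True
      from step[OF less.prems this] obtain t1 \<sigma>1 where body: "exec W c \<sigma> t1 \<sigma>1" "I \<sigma>1"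
        and time: "1 + cond_cost b + t1 + \<Phi> \<sigma>1 \<le> \<Phi> \<sigma>"
        unfolding wp_def by blast
      from time have "\<Phi> \<sigma>1 < \<Phi> \<sigma>"
        by linarith
      from less.hyps[OF this body(2)] obtain t2 \<tau> where rest: "exec W (While b c) \<sigma>1 t2 \<tau>"
        "I \<tau>" "\<not> cond_val b \<tau>" "t2 + \<Phi> \<tau> \<le> 1 + cond_cost b + \<Phi> \<sigma>1"
        unfolding wp_def by blast
      have "exec W (While b c) \<sigma> (1 + cond_cost b + t1 + t2) \<tau>"
        using exec.WhileTrue[OF fits[OF less.prems] True body(1) rest(1)] .
      moreover have "1 + cond_cost b + t1 + t2 + \<Phi> \<tau> \<le> 1 + cond_cost b + \<Phi> \<sigma>"
        using time rest(4) by linarith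
      ultimately show ?thesis
        unfolding wp_def using rest(2,3) by blast
    qed
  qed
  then show ?thesis
    by (rule wp_mono) (use final in blast)
qed

abbreviation Var :: "vname \<Rightarrow> expr" where
  "Var x \<equiv> Cell x (Const 0)"

abbreviation Set :: "vname \<Rightarrow> expr \<Rightarrow> com" where
  "Set x e \<equiv> Assign x (Const 0) e"

abbreviation Incr :: "vname \<Rightarrow> com" where
  "Incr x \<equiv> Set x (Bin Plus (Var x) (Const 1))"

definition For :: "vname \<Rightarrow> expr \<Rightarrow> com \<Rightarrow> com" where
  "For i e c = Seq (Set i (Const 0)) (While (Less (Var i) e) (Seq c (Incr i)))"

lemma writes_For [simp]: "writes (For i e c) = insert i (writes c)"
  by (simp add: For_def)

lemma wp_Seq_Incr:
  assumes body: "wp W c (\<lambda>t \<tau>. R (store \<tau> i 0 (Suc k)) \<and> t \<le> B) \<sigma>"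
    and \<sigma>: "bounded_state W \<sigma>" "\<sigma> i 0 = k" "Suc k < W" and "i \<notin> writes c"
  shows "wp W (Seq c (Incr i)) (\<lambda>t \<tau>. R \<tau> \<and> t \<le> B + 6 \<and> \<tau> i 0 = Suc k \<and>
    bounded_state W \<tau> \<and> agree_off (insert i (writes c)) \<sigma> \<tau>) \<sigma>"
  unfolding wp_Seq
proof (rule wp_frame[OF body \<sigma>(1)])
  fix t \<tau>
  assume "R (store \<tau> i 0 (Suc k)) \<and> t \<le> B"
    and frame: "bounded_state W \<tau>" "agree_off (writes c) \<sigma> \<tau>"
  moreover have "\<tau> i 0 = k"
    using frame(2) assms(5) \<sigma>(2) by (simp add: agree_off_def)
  ultimately show "wp W (Incr i) (\<lambda>t' \<tau>. R \<tau> \<and> t + t' \<le> B + 6 \<and> \<tau> i 0 = Suc k \<and>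
      bounded_state W \<tau> \<and> agree_off (insert i (writes c)) \<sigma> \<tau>) \<tau>"
    using \<sigma>(3) by (simp add: wp_Assign agree_off_def eval_nat_numeral)
qed

lemma wp_For:
  assumes bounded: "bounded_state W \<sigma>" and "1 < W"
    and e: "expr_fits W e \<sigma>" "expr_val e \<sigma> = N"
    and indep: "i \<notin> writes c" "reads e \<inter> insert i (writes c) = {}"
    and init: "I 0 (store \<sigma> i 0 0)"
    and step: "\<And>k \<tau>. \<lbrakk>k < N; I k \<tau>; \<tau> i 0 = k; bounded_state W \<tau>;
        agree_off (insert i (writes c)) \<sigma> \<tau>\<rbrakk> \<Longrightarrow>
      wp W c (\<lambda>t \<tau>'. I (Suc k) (store \<tau>' i 0 (Suc k)) \<and> t \<le> B k) \<tau>"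
    and final: "\<And>t \<tau>. \<lbrakk>I N \<tau>; t \<le> (\<Sum>k<N. B k + (expr_cost e + 10)) + (expr_cost e + 10);
        agree_off (insert i (writes c)) \<sigma> \<tau>\<rbrakk> \<Longrightarrow> Q t \<tau>"
  shows "wp W (For i e c) Q \<sigma>"
proof -
  define b where "b = Less (Var i) e"
  define \<Phi> where "\<Phi> \<tau> = (\<Sum>k\<in>{\<tau> i 0..<N}. B k + (expr_cost e + 10))" for \<tau> :: state
  define J where "J \<tau> \<longleftrightarrow> bounded_state W \<tau> \<and> agree_off (insert i (writes c)) \<sigma> \<tau> \<and>
    \<tau> i 0 \<le> N \<and> I (\<tau> i 0) \<tau>" for \<tau>
  have limit: "expr_fits W e \<tau>" "expr_val e \<tau> = N" if "J \<tau>" for \<tau>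
    using that e indep(2) expr_val_agree_off expr_fits_agree_off by (auto simp: J_def)
  have "N < W"
    using expr_val_less[OF e(1)] by (simp add: e(2))
  have "wp W (While b (Seq c (Incr i))) (\<lambda>t. Q (3 + t)) (store \<sigma> i 0 0)"
  proof (rule wp_While[where I = J and \<Phi> = \<Phi>])
    show "J (store \<sigma> i 0 0)"
      using init bounded \<open>1 < W\<close> by (simp add: J_def agree_off_def)
    show "cond_fits W b \<tau>" if "J \<tau>" for \<tau>
      using that limit \<open>1 < W\<close> by (auto simp: b_def J_def)
  next
    fix \<tau> assume "J \<tau>" "cond_val b \<tau>"
    define k where "k = \<tau> i 0"
    have "k < N"
      using \<open>cond_val b \<tau>\<close> limit[OF \<open>J \<tau>\<close>] by (simp add: b_def k_def)
    have "wp W c (\<lambda>t \<tau>'. I (Suc k) (store \<tau>' i 0 (Suc k)) \<and> t \<le> B k) \<tau>"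
      using step \<open>J \<tau>\<close> \<open>k < N\<close> by (simp add: J_def k_def)
    then have "wp W (Seq c (Incr i)) (\<lambda>t \<tau>'. I (Suc k) \<tau>' \<and> t \<le> B k + 6 \<and> \<tau>' i 0 = Suc k \<and>
        bounded_state W \<tau>' \<and> agree_off (insert i (writes c)) \<tau> \<tau>') \<tau>"
      using \<open>J \<tau>\<close> \<open>k < N\<close> \<open>N < W\<close> indep(1) by (intro wp_Seq_Incr) (simp_all add: J_def k_def)
    moreover have "{k..<N} = insert k {Suc k..<N}"
      using \<open>k < N\<close> by auto
    then have "\<Phi> \<tau> = B k + (expr_cost e + 10) + (\<Sum>k\<in>{Suc k..<N}. B k + (expr_cost e + 10))"
      by (simp add: \<Phi>_def k_def[symmetric])
    ultimately show "wp W (Seq c (Incr i)) (\<lambda>t \<tau>'. J \<tau>' \<and> 1 + cond_cost b + t + \<Phi> \<tau>' \<le> \<Phi> \<tau>) \<tau>"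
      using \<open>J \<tau>\<close> \<open>k < N\<close> by (elim wp_mono) (auto simp: J_def b_def \<Phi>_def intro: agree_off_trans)
  next
    fix t \<tau>
    assume "J \<tau>" "\<not> cond_val b \<tau>" and time: "t + \<Phi> \<tau> \<le> 1 + cond_cost b + \<Phi> (store \<sigma> i 0 0)"
    then have "\<tau> i 0 = N"
      using limit[OF \<open>J \<tau>\<close>] by (simp add: J_def b_def)
    then show "Q (3 + t) \<tau>"
      using \<open>J \<tau>\<close> time by (intro final) (simp_all add: J_def \<Phi>_def b_def atLeast0LessThan)
  qed
  then show ?thesis
    using \<open>1 < W\<close> by (simp add: For_def wp_Seq wp_Assign b_def eval_nat_numeral)
qed

lemma wp_For_const:
  assumes "bounded_state W \<sigma>" "1 < W" "expr_fits W e \<sigma>" "expr_val e \<sigma> = N"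
    and "i \<notin> writes c" "reads e \<inter> insert i (writes c) = {}"
    and "I 0 (store \<sigma> i 0 0)"
    and "\<And>k \<tau>. \<lbrakk>k < N; I k \<tau>; \<tau> i 0 = k; bounded_state W \<tau>;
        agree_off (insert i (writes c)) \<sigma> \<tau>\<rbrakk> \<Longrightarrow>
      wp W c (\<lambda>t \<tau>'. I (Suc k) (store \<tau>' i 0 (Suc k)) \<and> t \<le> B) \<tau>"
    and final: "\<And>t \<tau>. \<lbrakk>I N \<tau>; t \<le> (B + expr_cost e + 10) * (N + 1);
        agree_off (insert i (writes c)) \<sigma> \<tau>\<rbrakk> \<Longrightarrow> Q t \<tau>"
  shows "wp W (For i e c) Q \<sigma>"
  using assms(1-8) by (rule wp_For) (auto simp: algebra_simps intro: final)


section \<open>Matrices\<close>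

definition row_major :: "nat \<Rightarrow> nat \<Rightarrow> (nat \<Rightarrow> nat \<Rightarrow> nat) \<Rightarrow> (nat \<Rightarrow> nat) \<Rightarrow> bool" where
  "row_major r n f a \<longleftrightarrow> (\<forall>u<r. \<forall>v<n. a (u * n + v) = f u v)"

lemma row_majorD: "row_major r n f a \<Longrightarrow> u < r \<Longrightarrow> v < n \<Longrightarrow> a (u * n + v) = f u v"
  by (simp add: row_major_def)

lemma row_major_cong:
  "(\<And>u v. u < r \<Longrightarrow> v < n \<Longrightarrow> f u v = g u v) \<Longrightarrow> row_major r n f a \<longleftrightarrow> row_major r n g a"
  by (simp add: row_major_def)

lemma row_major_index_inj:
  fixes u v u' v' n :: nat
  assumes "u * n + v = u' * n + v'" "v < n" "v' < n"
  shows "u = u' \<and> v = v'"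
proof -
  have "(u * n + v) div n = u" "(u' * n + v') div n = u'"
    using assms(2,3) by simp_all
  with assms(1) show ?thesis
    by simp
qed

lemma row_major_update:
  assumes "row_major r n f a" "v < n"
  shows "row_major r n (f(u := (f u)(v := k))) (a(u * n + v := k))"
  using assms row_major_index_inj[of _ n _ u v] by (auto simp: row_major_def)


section \<open>Dominators\<close>

definition avoids :: "'a \<Rightarrow> 'a rel \<Rightarrow> 'a \<Rightarrow> 'a \<Rightarrow> bool" where
  "avoids s E w v \<longleftrightarrow> w \<noteq> s \<and> (s, v) \<in> {e \<in> E. snd e \<noteq> w}\<^sup>*"

lemma avoids_start [simp]: "avoids s E w s \<longleftrightarrow> w \<noteq> s"
  by (simp add: avoids_def)

lemma avoids_step: "avoids s E w x \<Longrightarrow> (x, y) \<in> E \<Longrightarrow> y \<noteq> w \<Longrightarrow> avoids s E w y"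
  unfolding avoids_def by (auto intro: rtrancl_into_rtrancl)

lemma avoids_induct [consumes 1, case_names start step]:
  assumes "avoids s E w v"
    and "w \<noteq> s \<Longrightarrow> P s"
    and "\<And>x y. avoids s E w x \<Longrightarrow> P x \<Longrightarrow> (x, y) \<in> E \<Longrightarrow> y \<noteq> w \<Longrightarrow> P y"
  shows "P v"
proof -
  from assms(1) have "w \<noteq> s" "(s, v) \<in> {e \<in> E. snd e \<noteq> w}\<^sup>*"
    by (auto simp: avoids_def)
  from this(2) show ?thesis
    by (induction rule: rtrancl_induct) (use assms(2,3) \<open>w \<noteq> s\<close> in \<open>auto simp: avoids_def\<close>)
qed

lemma avoids_last:
  assumes "avoids s E w v" "v \<noteq> s"
  obtains x where "avoids s E w x" "(x, v) \<in> E"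
  using assms by (induction rule: avoids_induct) auto

lemma avoids_imp_neq: "avoids s E w v \<Longrightarrow> v \<noteq> w"
  by (induction rule: avoids_induct) auto

lemma not_avoids_self [simp]: "\<not> avoids s E w w"
  using avoids_imp_neq by metis

lemma avoids_mono: "avoids s E w v \<Longrightarrow> E \<subseteq> E' \<Longrightarrow> avoids s E' w v"
  by (induction rule: avoids_induct) (auto intro: avoids_step)

lemma avoids_iff_reachable:
  assumes "w \<noteq> s" "w \<notin> Range E"
  shows "avoids s E w v \<longleftrightarrow> (s, v) \<in> E\<^sup>*"
proof -
  have "{e \<in> E. snd e \<noteq> w} = E"
    using assms(2) by (auto simp: Range_iff)
  then show ?thesis
    using assms(1) by (simp add: avoids_def)
qed

lemma avoids_cases: "avoids s E a c \<Longrightarrow> avoids s E a b \<or> avoids s E b c"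
  by (induction rule: avoids_induct) (auto intro: avoids_step)

definition dominators :: "'a \<Rightarrow> 'a rel \<Rightarrow> 'a \<Rightarrow> 'a set" where
  "dominators s E v = {w. \<not> avoids s E w v}"

lemma self_in_dominators: "v \<in> dominators s E v"
  by (simp add: dominators_def)

lemma dominators_antimono: "E \<subseteq> E' \<Longrightarrow> dominators s E' v \<subseteq> dominators s E v"
  by (auto simp: dominators_def intro: avoids_mono)

lemma dominators_trans:
  "a \<in> dominators s E b \<Longrightarrow> b \<in> dominators s E c \<Longrightarrow> a \<in> dominators s E c"
  using avoids_cases by (fastforce simp: dominators_def)

lemma dominator_reachable:
  assumes "(s, v) \<in> E\<^sup>*" "w \<in> dominators s E v"
  shows "(s, w) \<in> E\<^sup>*"
  using assms
proof (induction rule: rtrancl_induct)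
  case (step x y)
  show ?case
  proof (cases "w = y")
    case True
    with step.hyps show ?thesis
      by (simp add: rtrancl_into_rtrancl)
  next
    case False
    with step show ?thesis
      by (auto simp: dominators_def dest: avoids_step)
  qed
qed (simp add: dominators_def)

text \<open>On a path to \<open>v\<close> that meets both \<open>a\<close> and \<open>b\<close>, look at the first of the two.\<close>

lemma avoids_either:
  assumes "(s, v) \<in> E\<^sup>*" "a \<noteq> b"
    and "\<And>x. avoids s E a x \<Longrightarrow> (x, a) \<in> E \<Longrightarrow> avoids s E b a"
    and "\<And>x. avoids s E b x \<Longrightarrow> (x, b) \<in> E \<Longrightarrow> avoids s E a b"
  shows "avoids s E a v \<or> avoids s E b v"
  using assms(1)
proof (induction rule: rtrancl_induct)
  case base
  show ?case
    using assms(2) by auto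
next
  case (step x y)
  then show ?case
    using assms(3,4) by (metis avoids_step)
qed

lemma dominators_antisym:
  assumes "(s, b) \<in> E\<^sup>*" "a \<in> dominators s E b" "b \<in> dominators s E a"
  shows "a = b"
proof (rule ccontr)
  assume "a \<noteq> b"
  have "avoids s E b a" if "avoids s E a x" "(x, a) \<in> E" for x
    using that \<open>a \<noteq> b\<close> assms(2) avoids_cases[of s E a x b] avoids_step[of s E b x a]
    by (auto simp: dominators_def)
  moreover have "avoids s E a b" if "avoids s E b x" "(x, b) \<in> E" for x
    using that \<open>a \<noteq> b\<close> assms(3) avoids_cases[of s E b x a] avoids_step[of s E a x b]
    by (auto simp: dominators_def)
  ultimately have "avoids s E a b \<or> avoids s E b b"
    by (rule avoids_either[OF assms(1) \<open>a \<noteq> b\<close>])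
  with assms(2) show False
    by (simp add: dominators_def)
qed

lemma dominators_linear:
  assumes "(s, v) \<in> E\<^sup>*" "a \<in> dominators s E v" "b \<in> dominators s E v"
  shows "a \<in> dominators s E b \<or> b \<in> dominators s E a"
proof (rule ccontr)
  assume "\<not> ?thesis"
  then have "avoids s E a b" "avoids s E b a"
    by (auto simp: dominators_def)
  moreover from this have "a \<noteq> b"
    by auto
  ultimately have "avoids s E a v \<or> avoids s E b v"
    using avoids_either[OF assms(1)] by blast
  with assms(2,3) show False
    by (simp add: dominators_def)
qed

text \<open>With \<open>S = dominators s E v\<close>, this says that \<open>p\<close> is the immediate dominator of \<open>v\<close>.\<close>

definition deepest_dominator :: "'a \<Rightarrow> 'a rel \<Rightarrow> 'a set \<Rightarrow> 'a \<Rightarrow> 'a \<Rightarrow> bool" where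
  "deepest_dominator s E S p v \<longleftrightarrow>
     p \<noteq> v \<and> p \<in> dominators s E v \<and> S - {v} \<subseteq> dominators s E p"

lemma deepest_dominator_start: "v \<noteq> s \<Longrightarrow> deepest_dominator s E {} s v"
  by (simp add: deepest_dominator_def dominators_def avoids_def)

lemma deepest_dominator_subgraph:
  assumes "deepest_dominator s E S p v" "E' \<subseteq> E"
  shows "deepest_dominator s E' S p v"
  using assms(1) dominators_antimono[OF assms(2), of s] by (auto simp: deepest_dominator_def)

lemma deepest_dominator_insert:
  assumes p: "deepest_dominator s E S p v" and v: "(s, v) \<in> E\<^sup>*"
    and w: "w \<in> dominators s E v" "w \<noteq> v"
  shows "deepest_dominator s E (insert w S) (if p \<in> dominators s E w then w else p) v"
proof (cases "p \<in> dominators s E w")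
  case True
  then have "S - {v} \<subseteq> dominators s E w"
    using p dominators_trans[of _ s E p w] by (auto simp: deepest_dominator_def)
  with True w show ?thesis
    by (auto simp: deepest_dominator_def dominators_def)
next
  case False
  then have "w \<in> dominators s E p"
    using dominators_linear[OF v w(1), of p] p by (simp add: deepest_dominator_def)
  with p False show ?thesis
    by (auto simp: deepest_dominator_def)
qed

lemma immediate_dominator_unique:
  assumes p: "deepest_dominator s E (dominators s E v) p v" and v: "(s, v) \<in> E\<^sup>*"
  shows "deepest_dominator s E (dominators s E v) d v \<longleftrightarrow> d = p"
proof
  assume d: "deepest_dominator s E (dominators s E v) d v"
  have "(s, d) \<in> E\<^sup>*"
    using d by (intro dominator_reachable[OF v]) (simp add: deepest_dominator_def)
  moreover have "d \<in> dominators s E p" "p \<in> dominators s E d"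
    using p d by (auto simp: deepest_dominator_def)
  ultimately show "d = p"
    by (metis dominators_antisym)
qed (use p in simp)


section \<open>Forward edges\<close>

definition forward_edges :: "'a \<Rightarrow> 'a rel \<Rightarrow> 'a rel" where
  "forward_edges s E = {(u, v) \<in> E. avoids s E v u}"

lemma forward_edges_subset: "forward_edges s E \<subseteq> E"
  by (auto simp: forward_edges_def)

text \<open>A path without repeated vertices uses only forward edges.\<close>

lemma avoids_Int_forward_edges:
  assumes "E \<subseteq> E0"
  shows "avoids s (E \<inter> forward_edges s E0) w v \<longleftrightarrow> avoids s E w v"
proof
  assume "avoids s E w v"
  then show "avoids s (E \<inter> forward_edges s E0) w v"
  proof (induction rule: avoids_induct)
    case (step x y)
    show ?case
    proof (cases "avoids s E0 y x")
      case True
      with step assms show ?thesis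
        by (auto simp: forward_edges_def intro: avoids_step)
    next
      case False
      then have "\<not> avoids s (E \<inter> forward_edges s E0) y x"
        using assms avoids_mono[of s "E \<inter> forward_edges s E0" y x E0] by blast
      with step.IH show ?thesis
        using avoids_cases by metis
    qed
  qed simp
qed (blast intro: avoids_mono)

lemma avoids_between_forward_edges:
  assumes "forward_edges s E0 \<subseteq> E" "E \<subseteq> E0"
  shows "avoids s E = avoids s E0"
proof -
  have "E \<inter> forward_edges s E0 = E0 \<inter> forward_edges s E0"
    using assms forward_edges_subset[of s E0] by blast
  then show ?thesis
    using avoids_Int_forward_edges[OF assms(2), of s] avoids_Int_forward_edges[of E0 E0 s]
    by (intro ext) simp
qed

lemma (in wf_digraph) scc_of_cycle_pred:
  assumes "x \<rightarrow>\<^sup>+ x" "v \<in> scc_of x"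
  obtains u where "u \<in> scc_of x" "u \<rightarrow> v"
proof -
  have v: "v \<rightarrow>\<^sup>* x" "x \<rightarrow>\<^sup>* v"
    using assms(2) by (auto simp: scc_of_def)
  with assms(1) have "v \<rightarrow>\<^sup>+ v"
    using reachable1_reachable_trans reachable_reachable1_trans by blast
  then obtain u where u: "v \<rightarrow>\<^sup>* u" "u \<rightarrow> v"
    using reachable1_in_verts(1) by (metis tranclD2 reachable_conv')
  with v have "u \<in> scc_of x"
    unfolding scc_of_def by (blast intro: reachable_trans adj_reachable_trans)
  with u(2) that show thesis
    by blast
qed

context flow_graph
begin

lemma flow_graph_delete_edge: "flow_graph (delete_edge G e) s"
  using start_in_verts pair_finite_verts pair_finite_arcs in_arcsD1 in_arcsD2
  by unfold_locales (auto simp: delete_edge_def)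

lemma arcs_ends_with_proj: "arcs_ends (with_proj G) = parcs G"
  by (simp add: arcs_ends_def arc_to_ends_def)

lemma reachable_iff_rtrancl: "s \<rightarrow>\<^sup>*\<^bsub>with_proj G\<^esub> v \<longleftrightarrow> (s, v) \<in> (parcs G)\<^sup>*"
  using reachable_conv'[of s v] start_in_verts by (simp add: arcs_ends_with_proj)

lemma avoids_if_awalk:
  assumes "awalk s p v" "w \<notin> set (awalk_verts s p)"
  shows "avoids s (parcs G) w v"
  using assms
proof (induction p arbitrary: v rule: rev_induct)
  case Nil
  then show ?case
    by (auto simp: awalk_Nil_iff)
next
  case (snoc e p)
  then obtain x where "awalk s p x" "e = (x, v)" "e \<in> parcs G"
    by (cases e) (auto simp: awalk_append_iff awalk_Cons_iff awalk_Nil_iff)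
  moreover have "w \<notin> set (awalk_verts s p)" "v \<noteq> w"
    using snoc.prems \<open>e = (x, v)\<close> by (auto simp: awalk_verts_append awalk_Cons_iff)
  ultimately show ?case
    using snoc.IH by (auto intro: avoids_step)
qed

lemma awalk_if_avoids:
  assumes "avoids s (parcs G) w v"
  shows "\<exists>p. awalk s p v \<and> w \<notin> set (awalk_verts s p)"
  using assms
proof (induction rule: avoids_induct)
  case start
  then show ?case
    using start_in_verts by (intro exI[of _ "[]"]) (auto simp: awalk_Nil_iff)
next
  case (step x y)
  then obtain p where p: "awalk s p x" "w \<notin> set (awalk_verts s p)"
    by blast
  have edge: "awalk x [(x, y)] y"
    using step.hyps by (simp add: awalk_Cons_iff awalk_Nil_iff in_arcsD2)
  have walk: "awalk s (p @ [(x, y)]) y"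
    using awalk_appendI[OF p(1) edge] .
  moreover have "w \<notin> set (awalk_verts s (p @ [(x, y)]))"
    using p step.hyps awalk_verts_append[OF walk] edge by auto
  ultimately show ?case
    by blast
qed

lemma dominates_iff: "dominates G s w v \<longleftrightarrow> w \<in> dominators s (parcs G) v"
  using avoids_if_awalk awalk_if_avoids
  unfolding dominates_def awalk_verts_with_proj_eq dominators_def by blast

lemma immediate_dominator_iff:
  "immediate_dominator G s d v \<longleftrightarrow>
     deepest_dominator s (parcs G) (dominators s (parcs G) v) d v"
  unfolding immediate_dominator_def deepest_dominator_def dominates_iff
  using self_in_dominators[of d s] by blast

lemma acyclic_forward_edges:
  assumes "reducible G s"
  shows "acyclic (forward_edges s (parcs G))"
proof (rule acyclicI, rule allI, rule notI)
  define F where "F = forward_edges s (parcs G)"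
  define H where "H = with_proj (G\<lparr>parcs := F\<rparr>)"
  fix x assume "(x, x) \<in> (forward_edges s (parcs G))\<^sup>+"
  have F: "F \<subseteq> parcs G"
    by (simp add: F_def forward_edges_subset)
  interpret H: fin_digraph H
    using F pair_finite_verts finite_subset[OF F] wellformed'
    by unfold_locales (auto simp: H_def)
  have arcs: "arcs_ends H = F"
    by (simp add: H_def arcs_ends_def arc_to_ends_def)
  have cycle: "x \<rightarrow>\<^sup>+\<^bsub>H\<^esub> x"
    using \<open>(x, x) \<in> _\<close> by (simp add: arcs F_def)
  define C where "C = H.scc_of x"
  have "H \<restriction> C \<in> H.sccs"
    using cycle unfolding C_def
    by (intro H.in_verts_sccsD_sccs H.scc_of_in_sccs_verts H.reachable1_in_verts)
  then have scc: "subgraph (H \<restriction> C) H" "strongly_connected (H \<restriction> C)"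
    by (auto elim: H.in_sccsE dest: induced_imp_subgraph)
  have "subgraph H (with_proj G)"
    using F H.wf_digraph_axioms wf_digraph_axioms
    by (intro subgraphI) (auto simp: H_def compatible_def)
  with scc(1) have "subgraph (H \<restriction> C) (with_proj G)"
    by (rule subgraph_trans)
  then obtain v where v: "v \<in> C" "\<forall>u\<in>C. dominates G s v u"
    using assms scc(2) unfolding reducible_def dominates_def by force
  then obtain u where u: "u \<in> C" "u \<rightarrow>\<^bsub>H\<^esub> v"
    using H.scc_of_cycle_pred[OF cycle] unfolding C_def by blast
  with v(2) have "v \<in> dominators s (parcs G) u"
    by (simp add: dominates_iff)
  with u(2) show False
    by (simp add: arcs F_def forward_edges_def dominators_def)
qed

end


section \<open>Copies of the graph\<close>

text \<open>The triple \<open>(w, x, y)\<close> is the edge \<open>(x, y)\<close> in the copy \<open>w\<close>, which stands for \<open>G - w\<close>.\<close>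

definition copy_edges :: "'a rel \<Rightarrow> 'a rel \<Rightarrow> ('a \<times> 'a \<times> 'a) set" where
  "copy_edges E A = {(w, x, y). (w, x) \<in> A \<and> (x, y) \<in> E}"

definition alive :: "'a \<Rightarrow> 'a set \<Rightarrow> 'a rel \<Rightarrow> 'a rel" where
  "alive s N E = {(w, v). w \<in> N \<and> avoids s E w v}"

definition supported :: "'a \<Rightarrow> 'a set \<Rightarrow> ('a \<times> 'a \<times> 'a) set \<Rightarrow> 'a rel" where
  "supported s N P = {(w, y). w \<in> N \<and> y \<noteq> w \<and> (y = s \<or> (\<exists>x. (w, x, y) \<in> P))}"

lemma copy_edges_empty [simp]: "copy_edges E {} = {}"
  by (simp add: copy_edges_def)

lemma finite_copy_edges: "finite E \<Longrightarrow> finite A \<Longrightarrow> finite (copy_edges E A)"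
  by (rule finite_subset[of _ "fst ` A \<times> E"]) (force simp: copy_edges_def)+

lemma alive_mono: "E \<subseteq> E' \<Longrightarrow> alive s N E \<subseteq> alive s N E'"
  by (auto simp: alive_def intro: avoids_mono)

lemma supported_copy_edges_alive: "supported s N (copy_edges E (alive s N E)) = alive s N E"
  by (auto simp: supported_def copy_edges_def alive_def intro: avoids_step elim: avoids_last)

lemma alive_subset_supported:
  assumes "copy_edges E (supported s N P) \<subseteq> P"
  shows "alive s N E \<subseteq> supported s N P"
proof -
  have "(w, v) \<in> supported s N P" if "avoids s E w v" "w \<in> N" for w v
    using that
  proof (induction rule: avoids_induct)
    case (step x y)
    then have "(w, x, y) \<in> P"
      using assms by (auto simp: copy_edges_def)
    with step show ?case
      by (auto simp: supported_def)
  qed (simp add: supported_def)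
  then show ?thesis
    by (auto simp: alive_def)
qed

text \<open>In an acyclic graph, vertices cannot support each other in a circle.\<close>

lemma supported_subset_alive:
  assumes "wf F" "P \<subseteq> copy_edges F (supported s N P)"
  shows "supported s N P \<subseteq> alive s N F"
proof -
  have "avoids s F w y" if "(w, y) \<in> supported s N P" for w y
    using \<open>wf F\<close> that
  proof (induction y rule: wf_induct_rule)
    case (less y)
    then consider (start) "y = s" "y \<noteq> w" | (edge) x where "(w, x, y) \<in> P" "y \<noteq> w"
      by (auto simp: supported_def)
    then show ?case
    proof cases
      case edge
      then have "(w, x) \<in> supported s N P" "(x, y) \<in> F"
        using assms(2) by (auto simp: copy_edges_def)
      with less.IH edge(2) show ?thesis
        by (auto intro: avoids_step)
    qed simp
  qed
  then show ?thesis
    by (auto simp: alive_def supported_def)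
qed

text \<open>
  The additional predecessor of \<open>s\<close> makes the positive counters exactly those of the supported
  vertices.
\<close>

definition pred_count :: "'a \<Rightarrow> ('a \<times> 'a \<times> 'a) set \<Rightarrow> 'a \<Rightarrow> 'a \<Rightarrow> nat" where
  "pred_count s P w y = (if y = w then 0 else of_bool (y = s) + card {x. (w, x, y) \<in> P})"

lemma finite_preds: "finite P \<Longrightarrow> finite {x. (w, x, y) \<in> P}"
  by (rule finite_subset[of _ "(fst \<circ> snd) ` P"]) (force intro: image_eqI)+

lemma pred_count_pos_iff:
  "finite P \<Longrightarrow> w \<in> N \<Longrightarrow> 0 < pred_count s P w y \<longleftrightarrow> (w, y) \<in> supported s N P"
  by (auto simp: pred_count_def supported_def card_gt_0_iff finite_preds)

lemma pred_count_insert: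
  assumes "finite P" "(w, x, y) \<notin> P" "y \<noteq> w"
  shows "pred_count s (insert (w, x, y) P) =
    (pred_count s P)(w := (pred_count s P w)(y := Suc (pred_count s P w y)))"
proof -
  have "{x'. (w, x', y) \<in> insert (w, x, y) P} = insert x {x'. (w, x', y) \<in> P}"
    by auto
  then have "card {x'. (w, x', y) \<in> insert (w, x, y) P} = Suc (card {x'. (w, x', y) \<in> P})"
    using assms by (simp add: finite_preds)
  moreover have "{x'. (w', x', y') \<in> insert (w, x, y) P} = {x'. (w', x', y') \<in> P}"
    if "(w', y') \<noteq> (w, y)" for w' y'
    using that by auto
  ultimately show ?thesis
    using assms(3) by (auto simp: pred_count_def fun_eq_iff)
qed

lemma pred_count_insert_self: "pred_count s (insert (w, x, w) P) = pred_count s P"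
  by (auto simp: pred_count_def fun_eq_iff intro: arg_cong[where f = card])

lemma pred_count_delete:
  assumes "finite P" "(w, x, y) \<in> P"
  shows "pred_count s (P - {(w, x, y)}) =
    (pred_count s P)(w := (pred_count s P w)(y := pred_count s P w y - 1))"
proof -
  define P' where "P' = P - {(w, x, y)}"
  have P: "P = insert (w, x, y) P'" "(w, x, y) \<notin> P'"
    using assms(2) by (auto simp: P'_def)
  have "pred_count s P' = (pred_count s P)(w := (pred_count s P w)(y := pred_count s P w y - 1))"
  proof (cases "y = w")
    case True
    then have "pred_count s P = pred_count s P'" "pred_count s P w y = 0"
      by (simp_all add: P(1) pred_count_insert_self) (simp add: pred_count_def)
    then show ?thesis
      by (simp add: fun_upd_idem)
  next
    case False
    then have "pred_count s P =
      (pred_count s P')(w := (pred_count s P' w)(y := Suc (pred_count s P' w y)))"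
      unfolding P(1) using assms(1) P(2) by (intro pred_count_insert) (simp_all add: P'_def)
    then show ?thesis
      by (simp add: fun_eq_iff)
  qed
  then show ?thesis
    by (simp only: P'_def)
qed

lemma supported_delete:
  assumes "finite P" "(w, x, y) \<in> P"
  shows "supported s N (P - {(w, x, y)}) =
    supported s N P - (if pred_count s P w y = 1 then {(w, y)} else {})"
proof -
  define P' where "P' = P - {(w, x, y)}"
  have "finite P'"
    using assms(1) by (simp add: P'_def)
  have "(w', y') \<in> supported s N P' \<longleftrightarrow>
      (w', y') \<in> supported s N P \<and> \<not> (pred_count s P w y = 1 \<and> w' = w \<and> y' = y)" for w' y'
  proof (cases "w' \<in> N")
    case True
    have "pred_count s P' = (pred_count s P)(w := (pred_count s P w)(y := pred_count s P w y - 1))"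
      unfolding P'_def using assms by (rule pred_count_delete)
    then show ?thesis
      using pred_count_pos_iff[OF assms(1) True, of s y']
        pred_count_pos_iff[OF \<open>finite P'\<close> True, of s y']
      by (auto split: if_splits)
  qed (simp add: supported_def)
  then show ?thesis
    by (auto simp: P'_def)
qed

lemma sum_card_Image_le:
  assumes "finite E"
  shows "(\<Sum>x\<in>X. card (E `` {x})) \<le> card E"
proof (cases "finite X")
  case True
  have "(\<Sum>x\<in>X. card (E `` {x})) = card (SIGMA x:X. E `` {x})"
    using True assms by (intro card_SigmaI[symmetric]) auto
  also have "\<dots> \<le> card E"
    using assms by (intro card_mono) auto
  finally show ?thesis .
qed simp

lemma card_avoids_le:
  assumes "finite E"
  shows "card {v. avoids s E w v} \<le> card E + 1"
proof -
  have "{v. avoids s E w v} \<subseteq> insert s (Range E)"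
    by (auto elim: avoids_last)
  then have "card {v. avoids s E w v} \<le> card (insert s (Range E))"
    using assms by (intro card_mono) (simp_all add: finite_Range)
  also have "\<dots> \<le> Suc (card (Range E))"
    by (rule card_insert_le_m1) simp_all
  also have "card (Range E) \<le> card E"
    using card_image_le[OF assms, of snd] by (simp add: Range_snd)
  finally show ?thesis
    by simp
qed


section \<open>A work list of pairs of vertices\<close>

definition queue :: "state \<Rightarrow> (nat \<times> nat) list" where
  "queue \<sigma> = map (\<lambda>i. (\<sigma> ''qw'' i, \<sigma> ''qx'' i)) [0..<\<sigma> ''qlen'' 0]"

abbreviation index :: "expr \<Rightarrow> expr \<Rightarrow> expr" where
  "index a b \<equiv> Bin Plus (Bin Times a (Var ''n'')) b"

definition push :: com where
  "push =
     Seq (Assign ''qw'' (Var ''qlen'') (Var ''w''))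
    (Seq (Assign ''qx'' (Var ''qlen'') (Var ''y''))
         (Incr ''qlen''))"

definition pop :: com where
  "pop =
     Seq (Set ''w'' (Cell ''qw'' (Var ''qpos'')))
    (Seq (Set ''x'' (Cell ''qx'' (Var ''qpos'')))
         (Incr ''qpos''))"

definition scan_step :: "com \<Rightarrow> com" where
  "scan_step body =
     Seq (Set ''y'' (Cell ''adj'' (Bin Plus (Bin Times (Var ''x'') (Var ''m'')) (Var ''j'')))) body"

definition scan :: "com \<Rightarrow> com" where
  "scan body = For ''j'' (Cell ''deg'' (Var ''x'')) (scan_step body)"

definition worklist :: "com \<Rightarrow> com" where
  "worklist body =
     Seq (Set ''qpos'' (Const 0))
         (While (Less (Var ''qpos'') (Var ''qlen'')) (Seq pop (scan body)))"

lemma writes_push [simp]: "writes push = {''qw'', ''qx'', ''qlen''}"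
  by (simp add: push_def insert_commute)

lemma writes_worklist [simp]:
  "writes (worklist c) = {''qpos'', ''w'', ''x'', ''j'', ''y''} \<union> writes c"
  by (auto simp: worklist_def pop_def scan_def scan_step_def)

lemma length_queue [simp]: "length (queue \<sigma>) = \<sigma> ''qlen'' 0"
  by (simp add: queue_def)

lemma nth_queue: "i < \<sigma> ''qlen'' 0 \<Longrightarrow> queue \<sigma> ! i = (\<sigma> ''qw'' i, \<sigma> ''qx'' i)"
  by (simp add: queue_def)

lemma queue_empty_iff: "queue \<sigma> = [] \<longleftrightarrow> \<sigma> ''qlen'' 0 = 0"
  by (simp add: queue_def)

lemma queue_store [simp]: "x \<notin> {''qw'', ''qx'', ''qlen''} \<Longrightarrow> queue (store \<sigma> x i k) = queue \<sigma>"
  by (auto simp: queue_def)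

lemma queue_agree_off:
  "agree_off X \<sigma> \<tau> \<Longrightarrow> X \<inter> {''qw'', ''qx'', ''qlen''} = {} \<Longrightarrow> queue \<tau> = queue \<sigma>"
  by (auto simp: agree_off_def queue_def)

lemma wp_push:
  assumes "bounded_state W \<sigma>" "\<sigma> ''qlen'' 0 + 1 < W"
  shows "wp W push (\<lambda>t \<tau>. t \<le> 16 \<and> queue \<tau> = queue \<sigma> @ [(\<sigma> ''w'' 0, \<sigma> ''y'' 0)] \<and>
    agree_off {''qw'', ''qx'', ''qlen''} \<sigma> \<tau>) \<sigma>"
  using assms by (simp add: push_def wp_simps queue_def agree_off_def)

lemma wp_pop:
  assumes "bounded_state W \<sigma>" "\<sigma> ''qpos'' 0 < \<sigma> ''qlen'' 0" "queue \<sigma> ! \<sigma> ''qpos'' 0 = (w, x)"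
  shows "wp W pop (\<lambda>t \<tau>. t = 16 \<and>
    \<tau> = store (store (store \<sigma> ''w'' 0 w) ''x'' 0 x) ''qpos'' 0 (Suc (\<sigma> ''qpos'' 0))) \<sigma>"
proof -
  have "Suc (\<sigma> ''qpos'' 0) < W"
    using assms(2) bounded_stateD[OF assms(1), of "''qlen''" 0] by linarith
  moreover have "\<sigma> ''qw'' (\<sigma> ''qpos'' 0) = w" "\<sigma> ''qx'' (\<sigma> ''qpos'' 0) = x"
    using assms(2,3) by (simp_all add: nth_queue)
  ultimately show ?thesis
    using assms(1) by (auto simp: pop_def wp_simps)
qed

definition successors :: "('a \<times> 'b) list \<Rightarrow> 'a \<Rightarrow> 'b list" where
  "successors es u = map snd (filter (\<lambda>e. fst e = u) es)"

lemma set_successors: "set (successors es u) = set es `` {u}"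
  by (force simp: successors_def)

lemma distinct_successors: "distinct es \<Longrightarrow> distinct (successors es u)"
  by (auto simp: successors_def distinct_map inj_on_def)

lemma length_successors: "distinct es \<Longrightarrow> length (successors es u) = card (set es `` {u})"
  using distinct_card[OF distinct_successors] by (metis set_successors)

lemma length_successors_le: "length (successors es u) \<le> length es"
  by (simp add: successors_def)

lemma nth_notin_set_take: "distinct xs \<Longrightarrow> i < length xs \<Longrightarrow> xs ! i \<notin> set (take i xs)"
  using distinct_take[of xs "Suc i"] by (simp add: take_Suc_conv_app_nth)

lemma successors_snoc:
  "successors (es @ [(u, v)]) u' = successors es u' @ (if u = u' then [v] else [])"
  by (simp add: successors_def)

locale edge_list =
  fixes n m s W :: nat and as :: "(nat \<times> nat) list"
  assumes start_less: "s < n" and length_edges: "length as = m"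
    and edges_bounded: "set as \<subseteq> {..<n} \<times> {..<n}" and distinct_edges: "distinct as"
    and word_size: "(n + 2) * (n + m + 2) < W"
begin

lemma word_size_expanded: "n * n + n * m + 4 * n + 2 * m + 4 < W"
  using word_size by (simp add: algebra_simps)

lemma constants_fit [simp]: "0 < W" "Suc 0 < W" "Suc n < W" "Suc (Suc n) < W"
  using word_size_expanded by simp_all

lemma vertex_fits [simp]: "v \<le> n \<Longrightarrow> v < W"
  using word_size_expanded by simp

lemma edge_fits [simp]: "i \<le> m \<Longrightarrow> i < W"
  using word_size_expanded by simp

lemma index_fits [simp]:
  assumes "u \<le> n"
  shows "u * n < W" "u * m < W" "v \<le> n \<Longrightarrow> u * n + v < W" "j \<le> m \<Longrightarrow> u * m + j < W"
proof -
  have "u * n \<le> n * n" "u * m \<le> n * m"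
    using assms by simp_all
  then show "u * n < W" "u * m < W" "v \<le> n \<Longrightarrow> u * n + v < W" "j \<le> m \<Longrightarrow> u * m + j < W"
    using word_size_expanded by linarith+
qed

lemma edge_bounded: "(x, y) \<in> set as \<Longrightarrow> x < n \<and> y < n"
  using edges_bounded by auto

lemma card_edges: "card (set as) = m"
  using distinct_card[OF distinct_edges] length_edges by simp

definition inputs :: "state \<Rightarrow> bool" where
  "inputs \<sigma> \<longleftrightarrow> \<sigma> ''n'' 0 = n \<and> \<sigma> ''m'' 0 = m \<and> \<sigma> ''s'' 0 = s \<and>
     (\<forall>i<m. (\<sigma> ''tail'' i, \<sigma> ''head'' i) = as ! i)"

definition adj_table :: "(nat \<times> nat) list \<Rightarrow> (nat \<Rightarrow> nat) \<Rightarrow> (nat \<Rightarrow> nat) \<Rightarrow> bool" where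
  "adj_table es deg adj \<longleftrightarrow> (\<forall>u<n. deg u = length (successors es u) \<and>
     (\<forall>j<length (successors es u). adj (u * m + j) = successors es u ! j))"

definition layout :: "state \<Rightarrow> bool" where
  "layout \<sigma> \<longleftrightarrow> inputs \<sigma> \<and> adj_table as (\<sigma> ''deg'') (\<sigma> ''adj'')"

lemma adj_table_snoc:
  assumes table: "adj_table es deg adj" and edge: "length es < m" "u < n"
  shows "adj_table (es @ [(u, v)]) (deg(u := Suc (deg u))) (adj(u * m + deg u := v))"
proof -
  have "(adj(u * m + deg u := v)) (u' * m + j) = successors (es @ [(u, v)]) u' ! j"
    if "u' < n" "j < length (successors (es @ [(u, v)]) u')" for u' j
  proof -
    have "j < m" "deg u < m"
      using that(2) table edge length_successors_le[of "es @ [(u, v)]" u']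
        length_successors_le[of es u]
      by (simp_all add: adj_table_def)
    then show ?thesis
      using that table edge(2) row_major_index_inj[of u' m j u "deg u"]
      by (auto simp: adj_table_def successors_snoc nth_append split: if_splits)
  qed
  then show ?thesis
    using table by (simp add: adj_table_def successors_snoc)
qed

lemma layout_simps [simp]:
  "layout \<sigma> \<Longrightarrow> \<sigma> ''n'' 0 = n"
  "layout \<sigma> \<Longrightarrow> \<sigma> ''m'' 0 = m"
  "layout \<sigma> \<Longrightarrow> \<sigma> ''s'' 0 = s"
  by (simp_all add: layout_def inputs_def)

lemma layout_edge:
  assumes "layout \<sigma>" "i < m" "as ! i = (u, v)"
  shows "\<sigma> ''tail'' i = u" "\<sigma> ''head'' i = v"
proof -
  have "(\<sigma> ''tail'' i, \<sigma> ''head'' i) = as ! i"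
    using assms(1,2) unfolding layout_def inputs_def by blast
  with assms(3) show "\<sigma> ''tail'' i = u" "\<sigma> ''head'' i = v"
    by simp_all
qed

lemma inputs_agree_off:
  "inputs \<sigma> \<Longrightarrow> agree_off X \<sigma> \<tau> \<Longrightarrow> X \<inter> {''n'', ''m'', ''s'', ''tail'', ''head''} = {} \<Longrightarrow>
     inputs \<tau>"
  by (auto simp: agree_off_def inputs_def)

lemma layout_agree_off:
  "layout \<sigma> \<Longrightarrow> agree_off X \<sigma> \<tau> \<Longrightarrow>
     X \<inter> {''n'', ''m'', ''s'', ''tail'', ''head'', ''deg'', ''adj''} = {} \<Longrightarrow> layout \<tau>"
  using inputs_agree_off[of \<sigma> X \<tau>] by (auto simp: agree_off_def layout_def)

lemma layout_store [simp]:
  assumes "layout \<sigma>" "x \<notin> {''n'', ''m'', ''s'', ''tail'', ''head'', ''deg'', ''adj''}"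
  shows "layout (store \<sigma> x i k)"
  by (rule layout_agree_off[of \<sigma> "{x}"]) (use assms in \<open>auto simp: agree_off_def\<close>)

lemma queue_push_fits:
  assumes "distinct (queue \<sigma>)" "set (queue \<sigma>) \<subseteq> {..n} \<times> {..<n}"
  shows "\<sigma> ''qlen'' 0 + 1 < W"
proof -
  have "\<sigma> ''qlen'' 0 = card (set (queue \<sigma>))"
    using distinct_card[OF assms(1)] by simp
  also have "\<dots> \<le> card ({..n} \<times> {..<n})"
    using assms(2) by (intro card_mono) auto
  also have "\<dots> = (n + 1) * n"
    by (simp add: card_cartesian_product)
  finally show ?thesis
    using word_size_expanded by simp
qed

definition weight :: "nat \<Rightarrow> nat \<times> nat \<Rightarrow> nat" where
  "weight B p = (B + 50) * (card (set as `` {snd p}) + 1)"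

end

text \<open>\<open>Inv D\<close> holds during a traversal once it has processed exactly the edges \<open>D\<close> of the copies.\<close>

locale worklist_body = edge_list +
  fixes body :: com and Inv :: "(nat \<times> nat \<times> nat) set \<Rightarrow> state \<Rightarrow> bool"
    and U :: "(nat \<times> nat) set" and B :: nat
  assumes writes_body: "writes body \<inter> {''n'', ''m'', ''s'', ''tail'', ''head'', ''deg'', ''adj'',
      ''qpos'', ''j'', ''w'', ''x'', ''y''} = {}"
    and U_bounded: "U \<subseteq> {..n} \<times> {..<n}"
    and Inv_queue: "Inv D \<sigma> \<Longrightarrow> distinct (queue \<sigma>) \<and> set (queue \<sigma>) \<subseteq> U"
    and Inv_agree_off: "Inv D \<sigma> \<Longrightarrow> agree_off {''qpos'', ''j'', ''w'', ''x'', ''y''} \<sigma> \<tau> \<Longrightarrow> Inv D \<tau>"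
    and wp_body: "\<lbrakk>Inv D \<sigma>; bounded_state W \<sigma>; layout \<sigma>;
        \<sigma> ''w'' 0 = w; \<sigma> ''x'' 0 = x; \<sigma> ''y'' 0 = y;
        (w, x) \<in> set (queue \<sigma>); (x, y) \<in> set as; (w, x, y) \<notin> D\<rbrakk> \<Longrightarrow>
      wp W body (\<lambda>t \<tau>. Inv (insert (w, x, y) D) \<tau> \<and> prefix (queue \<sigma>) (queue \<tau>) \<and> t \<le> B) \<sigma>"
begin

lemma Inv_store:
  "Inv D \<sigma> \<Longrightarrow> z \<in> {''qpos'', ''j'', ''w'', ''x'', ''y''} \<Longrightarrow> Inv D (store \<sigma> z i k)"
  by (rule Inv_agree_off) (auto simp: agree_off_def)

lemma layout_after_body:
  assumes "layout \<sigma>" "agree_off X \<sigma> \<tau>" "X \<subseteq> {''qpos'', ''j'', ''w'', ''x'', ''y''} \<union> writes body"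
  shows "layout \<tau>"
  by (rule layout_agree_off[OF assms(1,2)]) (use assms(3) writes_body in auto)

definition scanned :: "nat \<Rightarrow> nat \<Rightarrow> nat \<Rightarrow> (nat \<times> nat \<times> nat) set" where
  "scanned w x j = {(w, x, y) |y. y \<in> set (take j (successors as x))}"

lemma scanned_Suc:
  "j < length (successors as x) \<Longrightarrow>
     scanned w x (Suc j) = insert (w, x, successors as x ! j) (scanned w x j)"
  by (auto simp: scanned_def take_Suc_conv_app_nth)

lemma next_not_scanned:
  "j < length (successors as x) \<Longrightarrow> (w, x, successors as x ! j) \<notin> scanned w x j"
  using nth_notin_set_take[OF distinct_successors[OF distinct_edges]] by (simp add: scanned_def)

lemma scanned_all: "scanned w x (length (successors as x)) = copy_edges (set as) {(w, x)}"
  by (auto simp: scanned_def copy_edges_def set_successors)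

lemma wp_scan_step:
  assumes inv: "Inv (D \<union> scanned w x j) \<sigma>" and \<sigma>: "bounded_state W \<sigma>" "layout \<sigma>"
    and vars: "\<sigma> ''w'' 0 = w" "\<sigma> ''x'' 0 = x" "\<sigma> ''j'' 0 = j"
    and j: "x < n" "j < length (successors as x)"
    and pair: "(w, x) \<in> set (queue \<sigma>)" "\<And>y. (w, x, y) \<notin> D"
  shows "wp W (scan_step body) (\<lambda>t \<tau>. Inv (D \<union> scanned w x (Suc j)) \<tau> \<and>
    prefix (queue \<sigma>) (queue \<tau>) \<and> t \<le> B + 11) \<sigma>"
proof -
  define y where "y = successors as x ! j"
  have xy: "(x, y) \<in> set as"
    using j set_successors[of as x] nth_mem[of j "successors as x"] by (auto simp: y_def)
  then have "y < n"
    using edge_bounded by blast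
  have "(w, x, y) \<notin> D \<union> scanned w x j"
    using pair(2) next_not_scanned[OF j(2)] by (simp add: y_def)
  then have "wp W body (\<lambda>t \<tau>. Inv (insert (w, x, y) (D \<union> scanned w x j)) \<tau> \<and>
      prefix (queue (store \<sigma> ''y'' 0 y)) (queue \<tau>) \<and> t \<le> B) (store \<sigma> ''y'' 0 y)"
    using inv \<sigma> vars pair(1) xy \<open>y < n\<close> by (intro wp_body) (simp_all add: Inv_store)
  then have "wp W body (\<lambda>t \<tau>. Inv (D \<union> scanned w x (Suc j)) \<tau> \<and>
      prefix (queue \<sigma>) (queue \<tau>) \<and> 11 + t \<le> B + 11) (store \<sigma> ''y'' 0 y)"
    by (rule wp_mono) (simp add: scanned_Suc[OF j(2)] y_def)
  moreover have "\<sigma> ''adj'' (x * m + j) = y" "j < m"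
    using \<sigma>(2) j length_successors_le[of as x]
    by (auto simp: layout_def adj_table_def length_edges y_def)
  ultimately show ?thesis
    using \<sigma> vars j(1) \<open>y < n\<close> by (simp add: scan_step_def wp_Seq wp_Assign)
qed

lemma wp_scan:
  assumes inv: "Inv D \<sigma>" and \<sigma>: "bounded_state W \<sigma>" "layout \<sigma>"
    and vars: "\<sigma> ''w'' 0 = w" "\<sigma> ''x'' 0 = x"
    and pair: "(w, x) \<in> set (queue \<sigma>)" "\<And>y. (w, x, y) \<notin> D"
  shows "wp W (scan body) (\<lambda>t \<tau>. Inv (D \<union> copy_edges (set as) {(w, x)}) \<tau> \<and>
    prefix (queue \<sigma>) (queue \<tau>) \<and> t \<le> (B + 24) * (card (set as `` {x}) + 1)) \<sigma>"
proof -
  define d where "d = length (successors as x)"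
  define I where "I j \<tau> \<longleftrightarrow> Inv (D \<union> scanned w x j) \<tau> \<and> prefix (queue \<sigma>) (queue \<tau>)" for j \<tau>
  have "x < n"
    using Inv_queue[OF inv] U_bounded pair(1) by auto
  then have deg: "\<sigma> ''deg'' x = d"
    using \<sigma>(2) by (simp add: layout_def adj_table_def d_def)
  have "d < W"
    using length_successors_le[of as x] by (simp add: length_edges d_def)
  show ?thesis
    unfolding scan_def
  proof (rule wp_For_const[where I = I and N = d and B = "B + 11"])
    show "I 0 (store \<sigma> ''j'' 0 0)"
      using inv by (simp add: I_def scanned_def Inv_store)
  next
    fix j \<tau>
    assume j: "j < d" "\<tau> ''j'' 0 = j" and I: "I j \<tau>"
      and \<tau>: "bounded_state W \<tau>" "agree_off (insert ''j'' (writes (scan_step body))) \<sigma> \<tau>"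
    have "layout \<tau>" "\<tau> ''w'' 0 = w" "\<tau> ''x'' 0 = x"
      using layout_after_body[OF \<sigma>(2) \<tau>(2)] agree_offD[OF \<tau>(2)] vars writes_body
      by (auto simp: scan_step_def)
    then have "wp W (scan_step body) (\<lambda>t \<tau>'. Inv (D \<union> scanned w x (Suc j)) \<tau>' \<and>
        prefix (queue \<tau>) (queue \<tau>') \<and> t \<le> B + 11) \<tau>"
      using I j \<tau>(1) pair \<open>x < n\<close>
      by (intro wp_scan_step) (auto simp: I_def d_def dest: set_mono_prefix)
    then show "wp W (scan_step body)
        (\<lambda>t \<tau>'. I (Suc j) (store \<tau>' ''j'' 0 (Suc j)) \<and> t \<le> B + 11) \<tau>"
      using I by (elim wp_mono) (auto simp: I_def Inv_store)
  next
    fix t \<tau>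
    assume "I d \<tau>" "t \<le> (B + 11 + expr_cost (Cell ''deg'' (Var ''x'')) + 10) * (d + 1)"
    then show "Inv (D \<union> copy_edges (set as) {(w, x)}) \<tau> \<and> prefix (queue \<sigma>) (queue \<tau>) \<and>
        t \<le> (B + 24) * (card (set as `` {x}) + 1)"
      using scanned_all[of w x]
      by (simp add: I_def d_def length_successors[OF distinct_edges] add.commute)
  qed (use \<sigma> vars deg writes_body \<open>d < W\<close> in \<open>auto simp: scan_step_def\<close>)
qed

definition finished :: "state \<Rightarrow> (nat \<times> nat) set" where
  "finished \<sigma> = set (take (\<sigma> ''qpos'' 0) (queue \<sigma>))"

definition loop_inv :: "state \<Rightarrow> bool" where
  "loop_inv \<sigma> \<longleftrightarrow> bounded_state W \<sigma> \<and> layout \<sigma> \<and> \<sigma> ''qpos'' 0 \<le> \<sigma> ''qlen'' 0 \<and>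
     Inv (copy_edges (set as) (finished \<sigma>)) \<sigma>"

definition remaining :: "state \<Rightarrow> nat" where
  "remaining \<sigma> = (\<Sum>p\<in>U - finished \<sigma>. weight B p)"

lemma finite_U: "finite U"
  using U_bounded by (rule finite_subset) simp

lemma next_not_finished:
  assumes "loop_inv \<sigma>" "\<sigma> ''qpos'' 0 < \<sigma> ''qlen'' 0"
  shows "queue \<sigma> ! \<sigma> ''qpos'' 0 \<in> U - finished \<sigma>"
proof -
  have "distinct (queue \<sigma>)" "set (queue \<sigma>) \<subseteq> U"
    using assms(1) Inv_queue by (auto simp: loop_inv_def)
  moreover have "queue \<sigma> ! \<sigma> ''qpos'' 0 \<in> set (queue \<sigma>)"
    using assms(2) by (intro nth_mem) simp
  ultimately show ?thesis
    using nth_notin_set_take[of "queue \<sigma>" "\<sigma> ''qpos'' 0"] assms(2) by (auto simp: finished_def)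
qed

lemma loop_inv_advance:
  assumes \<sigma>: "loop_inv \<sigma>" "\<sigma> ''qpos'' 0 < \<sigma> ''qlen'' 0" and p: "p = queue \<sigma> ! \<sigma> ''qpos'' 0"
    and \<tau>: "bounded_state W \<tau>" "layout \<tau>" "Inv (copy_edges (set as) (insert p (finished \<sigma>))) \<tau>"
    and queue: "prefix (queue \<sigma>) (queue \<tau>)" "\<tau> ''qpos'' 0 = Suc (\<sigma> ''qpos'' 0)"
  shows "loop_inv \<tau>" "remaining \<sigma> = weight B p + remaining \<tau>"
proof -
  obtain r where r: "queue \<tau> = queue \<sigma> @ r"
    using queue(1) by (auto simp: prefix_def)
  have finished: "finished \<tau> = insert p (finished \<sigma>)"
    using \<sigma>(2) by (simp add: finished_def p queue(2) r take_Suc_conv_app_nth)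
  have "\<tau> ''qpos'' 0 \<le> \<tau> ''qlen'' 0"
    using prefix_length_le[OF queue(1)] \<sigma>(2) queue(2) by simp
  then show "loop_inv \<tau>"
    using \<tau> by (simp add: loop_inv_def finished)
  show "remaining \<sigma> = weight B p + remaining \<tau>"
    using next_not_finished[OF \<sigma>] finite_U sum.remove[of "U - finished \<sigma>" p]
    by (simp add: remaining_def finished p Diff_insert[symmetric])
qed

lemma wp_scan_next:
  assumes \<sigma>: "loop_inv \<sigma>" "\<sigma> ''qpos'' 0 < \<sigma> ''qlen'' 0" and wx: "queue \<sigma> ! \<sigma> ''qpos'' 0 = (w, x)"
  defines "\<rho> \<equiv> store (store (store \<sigma> ''w'' 0 w) ''x'' 0 x) ''qpos'' 0 (Suc (\<sigma> ''qpos'' 0))"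
  assumes bounded: "bounded_state W \<rho>"
  shows "wp W (scan body) (\<lambda>t \<tau>. loop_inv \<tau> \<and> 22 + t + remaining \<tau> \<le> remaining \<sigma>) \<rho>"
proof -
  define D where "D = copy_edges (set as) (finished \<sigma>) \<union> copy_edges (set as) {(w, x)}"
  have inv: "Inv (copy_edges (set as) (finished \<sigma>)) \<sigma>" "layout \<sigma>"
    using \<sigma>(1) by (simp_all add: loop_inv_def)
  have pair: "(w, x) \<in> set (queue \<sigma>)" "(w, x) \<notin> finished \<sigma>"
    using next_not_finished[OF \<sigma>] nth_mem[of "\<sigma> ''qpos'' 0" "queue \<sigma>", unfolded wx] \<sigma>(2) wx
    by simp_all
  have \<rho>: "layout \<rho>" "queue \<rho> = queue \<sigma>"
    using inv(2) by (simp_all add: \<rho>_def)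
  have "wp W (scan body) (\<lambda>t \<tau>. Inv D \<tau> \<and> prefix (queue \<rho>) (queue \<tau>) \<and>
      t \<le> (B + 24) * (card (set as `` {x}) + 1)) \<rho>"
    unfolding D_def using inv(1) bounded \<rho> pair
    by (intro wp_scan) (simp_all add: \<rho>_def Inv_store copy_edges_def)
  then show ?thesis
  proof (rule wp_frame[OF _ bounded])
    fix t \<tau>
    assume scanned: "Inv D \<tau> \<and> prefix (queue \<rho>) (queue \<tau>) \<and>
        t \<le> (B + 24) * (card (set as `` {x}) + 1)"
      and \<tau>: "bounded_state W \<tau>" "agree_off (writes (scan body)) \<rho> \<tau>"
    have "layout \<tau>" "\<tau> ''qpos'' 0 = Suc (\<sigma> ''qpos'' 0)"
      using layout_after_body[OF \<rho>(1) \<tau>(2)] agree_offD[OF \<tau>(2)] writes_body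
      by (auto simp: scan_def scan_step_def \<rho>_def)
    moreover have "D = copy_edges (set as) (insert (w, x) (finished \<sigma>))"
      by (auto simp: D_def copy_edges_def)
    ultimately have "loop_inv \<tau>" "remaining \<sigma> = weight B (w, x) + remaining \<tau>"
      using loop_inv_advance[of \<sigma> "(w, x)" \<tau>] \<sigma> \<rho>(2) \<tau>(1) scanned wx by simp_all
    then show "loop_inv \<tau> \<and> 22 + t + remaining \<tau> \<le> remaining \<sigma>"
      using scanned by (simp add: weight_def algebra_simps)
  qed
qed

lemma wp_visit:
  assumes \<sigma>: "loop_inv \<sigma>" "\<sigma> ''qpos'' 0 < \<sigma> ''qlen'' 0"
  shows "wp W (Seq pop (scan body)) (\<lambda>t \<tau>. loop_inv \<tau> \<and> 6 + t + remaining \<tau> \<le> remaining \<sigma>) \<sigma>"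
proof -
  obtain w x where wx: "queue \<sigma> ! \<sigma> ''qpos'' 0 = (w, x)"
    by force
  have "bounded_state W \<sigma>"
    using \<sigma>(1) by (simp add: loop_inv_def)
  then show ?thesis
    unfolding wp_Seq
    by (rule wp_frame[OF wp_pop[OF _ \<sigma>(2) wx]])
      (use wp_scan_next[OF \<sigma> wx] \<open>bounded_state W \<sigma>\<close> in auto)
qed

lemma loop_inv_done:
  assumes "loop_inv \<sigma>" "\<not> \<sigma> ''qpos'' 0 < \<sigma> ''qlen'' 0"
  shows "Inv (copy_edges (set as) (set (queue \<sigma>))) \<sigma>"
    and "sum (weight B) U = remaining \<sigma> + (\<Sum>p\<in>set (queue \<sigma>). weight B p)"
proof -
  have "finished \<sigma> = set (queue \<sigma>)"
    using assms by (simp add: loop_inv_def finished_def)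
  then show inv: "Inv (copy_edges (set as) (set (queue \<sigma>))) \<sigma>"
    using assms(1) by (simp add: loop_inv_def)
  show "sum (weight B) U = remaining \<sigma> + (\<Sum>p\<in>set (queue \<sigma>). weight B p)"
    unfolding remaining_def \<open>finished \<sigma> = set (queue \<sigma>)\<close>
    using Inv_queue[OF inv] finite_U by (intro sum.subset_diff) simp_all
qed

lemma wp_worklist:
  assumes \<sigma>: "Inv {} \<sigma>" "bounded_state W \<sigma>" "layout \<sigma>"
  shows "wp W (worklist body) (\<lambda>t \<tau>. Inv (copy_edges (set as) (set (queue \<tau>))) \<tau> \<and>
    t \<le> 9 + (\<Sum>p\<in>set (queue \<tau>). weight B p)) \<sigma>"
proof -
  define \<sigma>1 where "\<sigma>1 = store \<sigma> ''qpos'' 0 0"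
  have "finished \<sigma>1 = {}" "Inv {} \<sigma>1"
    using \<sigma>(1) by (simp_all add: finished_def \<sigma>1_def Inv_store)
  have "wp W (While (Less (Var ''qpos'') (Var ''qlen'')) (Seq pop (scan body))) (\<lambda>t \<tau>.
      Inv (copy_edges (set as) (set (queue \<tau>))) \<tau> \<and>
      3 + t \<le> 9 + (\<Sum>p\<in>set (queue \<tau>). weight B p)) \<sigma>1"
  proof (rule wp_While[where I = loop_inv and \<Phi> = remaining])
    show "loop_inv \<sigma>1"
      using \<sigma> \<open>finished \<sigma>1 = {}\<close> \<open>Inv {} \<sigma>1\<close> by (simp add: loop_inv_def) (simp add: \<sigma>1_def)
  next
    fix \<tau> assume \<tau>: "loop_inv \<tau>"
    then show "cond_fits W (Less (Var ''qpos'') (Var ''qlen'')) \<tau>"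
      by (simp add: loop_inv_def)
    assume "cond_val (Less (Var ''qpos'') (Var ''qlen'')) \<tau>"
    then have "\<tau> ''qpos'' 0 < \<tau> ''qlen'' 0"
      by simp
    from wp_visit[OF \<tau> this] show "wp W (Seq pop (scan body)) (\<lambda>t \<tau>'. loop_inv \<tau>' \<and>
        1 + cond_cost (Less (Var ''qpos'') (Var ''qlen'')) + t + remaining \<tau>' \<le> remaining \<tau>) \<tau>"
      by (rule wp_mono) simp
  next
    fix t \<tau>
    assume "loop_inv \<tau>" "\<not> cond_val (Less (Var ''qpos'') (Var ''qlen'')) \<tau>"
      and "t + remaining \<tau> \<le> 1 + cond_cost (Less (Var ''qpos'') (Var ''qlen'')) + remaining \<sigma>1"
    then show "Inv (copy_edges (set as) (set (queue \<tau>))) \<tau> \<and>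
        3 + t \<le> 9 + (\<Sum>p\<in>set (queue \<tau>). weight B p)"
      using loop_inv_done[of \<tau>] by (simp add: remaining_def[of \<sigma>1] \<open>finished \<sigma>1 = {}\<close>)
  qed
  then show ?thesis
    by (simp add: worklist_def \<sigma>1_def wp_Seq wp_Assign eval_nat_numeral)
qed

end


section \<open>Deleting an edge from the counters\<close>

definition decrement :: com where
  "decrement =
     If (Neg (Equal (Cell ''count'' (index (Var ''w'') (Var ''y''))) (Const 0)))
       (Seq (Assign ''count'' (index (Var ''w'') (Var ''y''))
              (Bin Minus (Cell ''count'' (index (Var ''w'') (Var ''y''))) (Const 1)))
            (If (Equal (Cell ''count'' (index (Var ''w'') (Var ''y''))) (Const 0)) push Skip))
       Skip"

definition seed_step :: com where
  "seed_step =
     If (Neg (Equal (Cell ''count'' (index (Var ''w'') (Var ''del_tail''))) (Const 0)))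
       decrement Skip"

definition seed :: com where
  "seed = For ''w'' (Bin Plus (Var ''n'') (Const 1)) seed_step"

definition cascade_step :: com where
  "cascade_step =
     If (Equal (Cell ''fwd'' (index (Var ''x'') (Var ''y''))) (Const 1)) decrement Skip"

definition delete_from_counts :: com where
  "delete_from_counts =
     Seq (Assign ''fwd'' (index (Var ''del_tail'') (Var ''del_head'')) (Const 0))
    (Seq (Set ''y'' (Var ''del_head''))
    (Seq seed
         (worklist cascade_step)))"

lemma writes_decrement [simp]: "writes decrement = {''count'', ''qw'', ''qx'', ''qlen''}"
  by (simp add: decrement_def insert_commute)

lemma writes_seed [simp]: "writes seed = {''w'', ''count'', ''qw'', ''qx'', ''qlen''}"
  by (simp add: seed_def seed_step_def)

lemma writes_cascade_step [simp]: "writes cascade_step = {''count'', ''qw'', ''qx'', ''qlen''}"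
  by (simp add: cascade_step_def)

lemma writes_delete_from_counts [simp]:
  "writes delete_from_counts =
     {''fwd'', ''y'', ''w'', ''count'', ''qw'', ''qx'', ''qlen'', ''qpos'', ''x'', ''j''}"
  by (auto simp: delete_from_counts_def)

context edge_list
begin

text \<open>The copies are numbered \<open>0, \<dots>, n\<close>; since \<open>n\<close> is not a vertex, copy \<open>n\<close> is the graph itself.\<close>

abbreviation alive_pairs :: "nat rel \<Rightarrow> nat rel" where
  "alive_pairs \<equiv> alive s {..n}"

abbreviation supported_pairs :: "(nat \<times> nat \<times> nat) set \<Rightarrow> nat rel" where
  "supported_pairs \<equiv> supported s {..n}"

definition count_table :: "(nat \<times> nat \<times> nat) set \<Rightarrow> (nat \<Rightarrow> nat) \<Rightarrow> bool" where
  "count_table P \<equiv> row_major (n + 1) n (pred_count s P)"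

abbreviation alive_counts :: "nat rel \<Rightarrow> nat rel \<Rightarrow> (nat \<Rightarrow> nat) \<Rightarrow> bool" where
  "alive_counts F E \<equiv> count_table (copy_edges F (alive_pairs E))"

definition edge_table :: "nat rel \<Rightarrow> (nat \<Rightarrow> nat) \<Rightarrow> bool" where
  "edge_table F \<equiv> row_major n n (\<lambda>u v. of_bool ((u, v) \<in> F))"

lemma edge_table_entry:
  "edge_table F a \<Longrightarrow> u < n \<Longrightarrow> v < n \<Longrightarrow> a (u * n + v) = of_bool ((u, v) \<in> F)"
  unfolding edge_table_def by (rule row_majorD)

lemma edge_table_delete:
  "edge_table F a \<Longrightarrow> v < n \<Longrightarrow> edge_table (F - {(u, v)}) (a(u * n + v := 0))"
  using row_major_update[of n n "\<lambda>u v. of_bool ((u, v) \<in> F)" a v u 0]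
  by (auto simp: edge_table_def elim!: row_major_cong[THEN iffD1, rotated])

lemma edge_table_insert:
  "edge_table F a \<Longrightarrow> v < n \<Longrightarrow> edge_table (insert (u, v) F) (a(u * n + v := 1))"
  using row_major_update[of n n "\<lambda>u v. of_bool ((u, v) \<in> F)" a v u 1]
  by (auto simp: edge_table_def elim!: row_major_cong[THEN iffD1, rotated])

lemma avoids_bounded:
  assumes "E \<subseteq> set as" "avoids s E w v"
  shows "v < n"
proof (cases "v = s")
  case False
  with assms show ?thesis
    using edge_bounded by (blast elim: avoids_last)
qed (use start_less in simp)

lemma alive_pairs_bounded: "E \<subseteq> set as \<Longrightarrow> alive_pairs E \<subseteq> {..n} \<times> {..<n}"
  using avoids_bounded by (auto simp: alive_def)

lemma finite_alive_pairs: "E \<subseteq> set as \<Longrightarrow> finite (alive_pairs E)"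
  by (rule finite_subset[OF alive_pairs_bounded]) auto

lemma count_table_pos_iff:
  assumes "count_table P c" "finite P" "w \<le> n" "y < n"
  shows "0 < c (w * n + y) \<longleftrightarrow> (w, y) \<in> supported_pairs P"
  using assms row_majorD[of "n + 1" n "pred_count s P" c w y] pred_count_pos_iff[of P w "{..n}"]
  by (simp add: count_table_def)

text \<open>
  \<open>A\<close> are the pairs that were alive before the deletion, \<open>P\<close> are the edges of the copies that have
  not been deleted yet, and the queue \<open>q\<close> lists the pairs that have died so far.
\<close>

definition cascade_inv ::
  "nat rel \<Rightarrow> (nat \<times> nat \<times> nat) set \<Rightarrow> (nat \<Rightarrow> nat) \<Rightarrow> (nat \<times> nat) list \<Rightarrow> bool" where
  "cascade_inv A P c q \<longleftrightarrow> count_table P c \<and> finite P \<and> A \<subseteq> {..n} \<times> {..<n} \<and>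
     supported_pairs P \<subseteq> A \<and> distinct q \<and> set q = A - supported_pairs P"

lemma cascade_inv_start:
  assumes "alive_counts F F c" "F \<subseteq> set as"
  shows "cascade_inv (alive_pairs F) (copy_edges F (alive_pairs F)) c []"
  using assms alive_pairs_bounded finite_alive_pairs finite_subset[OF assms(2)]
  by (auto simp: cascade_inv_def supported_copy_edges_alive intro: finite_copy_edges)

lemma cascade_inv_delete:
  assumes inv: "cascade_inv A P c q" and edge: "(w, x, y) \<in> P" "w \<le> n" "y < n"
  defines "k \<equiv> c (w * n + y)"
  shows "cascade_inv A (P - {(w, x, y)}) (c(w * n + y := k - 1))
    (if k = 1 then q @ [(w, y)] else q)"
proof -
  define P' where "P' = P - {(w, x, y)}"
  have P: "finite P" "count_table P c"
    using inv by (simp_all add: cascade_inv_def)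
  have k: "k = pred_count s P w y"
    using P(2) edge(2,3) by (simp add: k_def count_table_def row_majorD)
  have "pred_count s P' = (pred_count s P)(w := (pred_count s P w)(y := k - 1))"
    using P(1) edge(1) by (simp add: P'_def k pred_count_delete)
  then have "count_table P' (c(w * n + y := k - 1))"
    using row_major_update[OF P(2)[unfolded count_table_def] edge(3)] by (simp add: count_table_def)
  moreover have "supported_pairs P' = supported_pairs P - (if k = 1 then {(w, y)} else {})"
    unfolding P'_def k using P(1) edge(1) by (rule supported_delete)
  moreover have "(w, y) \<in> supported_pairs P" if "k = 1"
    using that P(1) edge(2) pred_count_pos_iff[of P w "{..n}" s y] by (simp add: k)
  moreover have "finite P'"
    using P(1) by (simp add: P'_def)
  ultimately show ?thesis
    using inv by (auto simp: cascade_inv_def P'_def[symmetric])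
qed

lemma cascade_inv_push_fits:
  "cascade_inv A P c (queue \<sigma>) \<Longrightarrow> \<sigma> ''qlen'' 0 + 1 < W"
  by (rule queue_push_fits) (auto simp: cascade_inv_def)

lemma wp_decrement:
  assumes inv: "cascade_inv A P (\<sigma> ''count'') (queue \<sigma>)"
    and \<sigma>: "bounded_state W \<sigma>" "layout \<sigma>" "\<sigma> ''w'' 0 = w" "\<sigma> ''y'' 0 = y"
    and edge: "(w, x, y) \<in> P" "w \<le> n" "y < n"
  shows "wp W decrement (\<lambda>t \<tau>. cascade_inv A (P - {(w, x, y)}) (\<tau> ''count'') (queue \<tau>) \<and>
    prefix (queue \<sigma>) (queue \<tau>) \<and> t \<le> 70) \<sigma>"
proof -
  define k where "k = \<sigma> ''count'' (w * n + y)"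
  define \<sigma>1 where "\<sigma>1 = store \<sigma> ''count'' (w * n + y) (k - 1)"
  have inv': "cascade_inv A (P - {(w, x, y)}) (\<sigma>1 ''count'')
      (if k = 1 then queue \<sigma> @ [(w, y)] else queue \<sigma>)"
    using cascade_inv_delete[OF inv edge] by (simp add: k_def \<sigma>1_def)
  have "k < W"
    using \<sigma>(1) by (simp add: k_def)
  consider (already_dead) "k = 0" | (dies) "k = 1" | (survives) "k > 1"
    by linarith
  then show ?thesis
  proof cases
    case already_dead
    then have "\<sigma>1 ''count'' = \<sigma> ''count''"
      by (auto simp: \<sigma>1_def k_def)
    with already_dead inv' show ?thesis
      using \<sigma> edge(2,3) by (simp add: decrement_def wp_simps k_def)
  next
    case dies
    have "wp W push (\<lambda>t \<tau>. t \<le> 16 \<and> queue \<tau> = queue \<sigma>1 @ [(\<sigma>1 ''w'' 0, \<sigma>1 ''y'' 0)] \<and>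
        agree_off {''qw'', ''qx'', ''qlen''} \<sigma>1 \<tau>) \<sigma>1"
      using \<sigma>(1) \<open>k < W\<close> cascade_inv_push_fits[OF inv] by (intro wp_push) (simp_all add: \<sigma>1_def)
    then have "wp W push (\<lambda>t \<tau>. cascade_inv A (P - {(w, x, y)}) (\<tau> ''count'') (queue \<tau>) \<and>
        prefix (queue \<sigma>) (queue \<tau>) \<and> 45 + t \<le> 70) \<sigma>1"
      by (rule wp_mono) (use inv' dies \<sigma> in \<open>auto simp: \<sigma>1_def agree_off_def\<close>)
    then show ?thesis
      using dies \<sigma> edge(2,3) by (simp add: decrement_def wp_simps \<sigma>1_def flip: k_def)
  next
    case survives
    then show ?thesis
      using inv' \<sigma> edge(2,3) \<open>k < W\<close> by (simp add: decrement_def wp_simps \<sigma>1_def flip: k_def)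
  qed
qed

lemma wp_seed_step:
  assumes inv: "cascade_inv A P (\<sigma> ''count'') (queue \<sigma>)"
    and \<sigma>: "bounded_state W \<sigma>" "layout \<sigma>" "\<sigma> ''w'' 0 = w" "\<sigma> ''del_tail'' 0 = u" "\<sigma> ''y'' 0 = v"
    and edge: "w \<le> n" "u < n" "v < n" "(w, u) \<in> supported_pairs P \<longleftrightarrow> (w, u, v) \<in> P"
  shows "wp W seed_step (\<lambda>t \<tau>.
    cascade_inv A (P - {(w, u, v)}) (\<tau> ''count'') (queue \<tau>) \<and> t \<le> 90) \<sigma>"
proof -
  have alive: "0 < \<sigma> ''count'' (w * n + u) \<longleftrightarrow> (w, u, v) \<in> P"
    using inv edge count_table_pos_iff[of P "\<sigma> ''count''" w u] by (simp add: cascade_inv_def)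
  show ?thesis
  proof (cases "(w, u, v) \<in> P")
    case True
    have "wp W decrement (\<lambda>t \<tau>.
        cascade_inv A (P - {(w, u, v)}) (\<tau> ''count'') (queue \<tau>) \<and> 13 + t \<le> 90) \<sigma>"
      by (rule wp_mono[OF wp_decrement[OF inv \<sigma>(1-3,5) True edge(1,3)]]) simp
    with True alive show ?thesis
      using \<sigma> edge by (simp add: seed_step_def wp_simps)
  next
    case False
    with alive inv show ?thesis
      using \<sigma> edge by (simp add: seed_step_def wp_simps)
  qed
qed

lemma wp_seed:
  assumes inv: "cascade_inv A (copy_edges F A) (\<sigma> ''count'') []" and queue: "queue \<sigma> = []"
    and \<sigma>: "bounded_state W \<sigma>" "layout \<sigma>" "\<sigma> ''del_tail'' 0 = u" "\<sigma> ''y'' 0 = v"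
    and F: "F \<subseteq> set as" "(u, v) \<in> F"
  shows "wp W seed (\<lambda>t \<tau>. cascade_inv A (copy_edges (F - {(u, v)}) A) (\<tau> ''count'') (queue \<tau>) \<and>
    t \<le> 104 * (n + 2)) \<sigma>"
proof -
  define P where "P k = copy_edges F A - {..<k} \<times> {(u, v)}" for k
  define I where "I k \<tau> \<longleftrightarrow> cascade_inv A (P k) (\<tau> ''count'') (queue \<tau>)" for k \<tau>
  have A: "A = supported_pairs (copy_edges F A)" "A \<subseteq> {..n} \<times> {..<n}"
    using inv by (auto simp: cascade_inv_def)
  show ?thesis
    unfolding seed_def
  proof (rule wp_For_const[where I = I and N = "n + 1" and B = 90])
    show "I 0 (store \<sigma> ''w'' 0 0)"
      using inv queue by (simp add: I_def P_def)
  next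
    fix k \<tau>
    assume k: "k < n + 1" "\<tau> ''w'' 0 = k" and I: "I k \<tau>"
      and \<tau>: "bounded_state W \<tau>" "agree_off (insert ''w'' (writes seed_step)) \<sigma> \<tau>"
    have "(k, u) \<in> supported_pairs (P k) \<longleftrightarrow> (k, u) \<in> supported_pairs (copy_edges F A)"
      by (auto simp: supported_def P_def)
    then have "(k, u) \<in> supported_pairs (P k) \<longleftrightarrow> (k, u, v) \<in> P k"
      using A(1) F(2) by (simp add: P_def copy_edges_def)
    moreover have "layout \<tau>"
      by (rule layout_agree_off[OF \<sigma>(2) \<tau>(2)]) (simp add: seed_step_def)
    ultimately have "wp W seed_step (\<lambda>t \<tau>'.
        cascade_inv A (P k - {(k, u, v)}) (\<tau>' ''count'') (queue \<tau>') \<and> t \<le> 90) \<tau>"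
      using I k \<tau> \<sigma>(3,4) edge_bounded[of u v] F
      by (intro wp_seed_step) (auto simp: I_def agree_off_def seed_step_def)
    moreover have "P k - {(k, u, v)} = P (Suc k)"
      by (auto simp: P_def)
    ultimately show "wp W seed_step (\<lambda>t \<tau>'. I (Suc k) (store \<tau>' ''w'' 0 (Suc k)) \<and> t \<le> 90) \<tau>"
      by (simp add: I_def)
  next
    fix t \<tau>
    assume "I (n + 1) \<tau>" "t \<le> (90 + expr_cost (Bin Plus (Var ''n'') (Const 1)) + 10) * (n + 1 + 1)"
    moreover have "P (n + 1) = copy_edges (F - {(u, v)}) A"
      using A(2) by (auto simp: P_def copy_edges_def)
    ultimately show "cascade_inv A (copy_edges (F - {(u, v)}) A) (\<tau> ''count'') (queue \<tau>) \<and>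
        t \<le> 104 * (n + 2)"
      by (simp add: I_def)
  qed (use \<sigma> in \<open>simp_all add: seed_step_def\<close>)
qed

definition cascade_body_inv ::
  "nat rel \<Rightarrow> nat rel \<Rightarrow> (nat \<times> nat \<times> nat) set \<Rightarrow> state \<Rightarrow> bool" where
  "cascade_body_inv F A D \<sigma> \<longleftrightarrow>
     edge_table F (\<sigma> ''fwd'') \<and> cascade_inv A (copy_edges F A - D) (\<sigma> ''count'') (queue \<sigma>)"

lemma wp_cascade_step:
  assumes inv: "cascade_body_inv F A D \<sigma>"
    and \<sigma>: "bounded_state W \<sigma>" "layout \<sigma>" "\<sigma> ''w'' 0 = w" "\<sigma> ''x'' 0 = x" "\<sigma> ''y'' 0 = y"
    and edge: "(w, x) \<in> set (queue \<sigma>)" "(x, y) \<in> set as" "(w, x, y) \<notin> D"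
  shows "wp W cascade_step (\<lambda>t \<tau>. cascade_body_inv F A (insert (w, x, y) D) \<tau> \<and>
    prefix (queue \<sigma>) (queue \<tau>) \<and> t \<le> 90) \<sigma>"
proof -
  have "(w, x) \<in> A" "A \<subseteq> {..n} \<times> {..<n}"
    using inv edge(1) by (auto simp: cascade_body_inv_def cascade_inv_def)
  then have range: "w \<le> n" "x < n" "y < n"
    using edge_bounded[OF edge(2)] by auto
  have fwd: "\<sigma> ''fwd'' (x * n + y) = of_bool ((x, y) \<in> F)"
    using inv range(2,3) by (simp add: cascade_body_inv_def edge_table_entry)
  show ?thesis
  proof (cases "(x, y) \<in> F")
    case True
    then have "(w, x, y) \<in> copy_edges F A - D"
      using \<open>(w, x) \<in> A\<close> edge(3) by (simp add: copy_edges_def)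
    then have "wp W decrement (\<lambda>t \<tau>.
        cascade_inv A (copy_edges F A - D - {(w, x, y)}) (\<tau> ''count'') (queue \<tau>) \<and>
        prefix (queue \<sigma>) (queue \<tau>) \<and> t \<le> 70) \<sigma>"
      using inv \<sigma> range by (intro wp_decrement) (auto simp: cascade_body_inv_def)
    then have "wp W decrement (\<lambda>t \<tau>. cascade_body_inv F A (insert (w, x, y) D) \<tau> \<and>
        prefix (queue \<sigma>) (queue \<tau>) \<and> 12 + t \<le> 90) \<sigma>"
      by (rule wp_frame[OF _ \<sigma>(1)])
        (use inv in \<open>auto simp: cascade_body_inv_def agree_off_def simp flip: Diff_insert\<close>)
    then show ?thesis
      using True \<sigma> fwd range by (simp add: cascade_step_def wp_simps)
  next
    case False
    then have "copy_edges F A - insert (w, x, y) D = copy_edges F A - D"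
      by (auto simp: copy_edges_def)
    with False show ?thesis
      using inv \<sigma> fwd range by (simp add: cascade_step_def cascade_body_inv_def wp_simps)
  qed
qed

lemma worklist_body_cascade_step:
  assumes "A \<subseteq> {..n} \<times> {..<n}"
  shows "worklist_body n m s W as cascade_step (cascade_body_inv F A) A 90"
proof unfold_locales
  fix D \<sigma> \<tau>
  assume "cascade_body_inv F A D \<sigma>"
    and agree: "agree_off {''qpos'', ''j'', ''w'', ''x'', ''y''} \<sigma> \<tau>"
  then show "cascade_body_inv F A D \<tau>"
    using queue_agree_off[OF agree] by (simp add: cascade_body_inv_def agree_off_def)
qed (use assms wp_cascade_step in \<open>auto simp: cascade_body_inv_def cascade_inv_def\<close>)

lemma wp_cascade:
  assumes F: "F \<subseteq> set as" "acyclic F" and A: "A \<subseteq> {..n} \<times> {..<n}"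
    and inv: "cascade_body_inv F A {} \<sigma>" and \<sigma>: "bounded_state W \<sigma>" "layout \<sigma>"
  shows "wp W (worklist cascade_step) (\<lambda>t \<tau>.
    alive_counts F F (\<tau> ''count'') \<and>
    distinct (queue \<tau>) \<and> set (queue \<tau>) = A - alive_pairs F \<and>
    t \<le> 9 + (\<Sum>p\<in>A - alive_pairs F. weight 90 p)) \<sigma>"
proof -
  interpret worklist_body n m s W as cascade_step "cascade_body_inv F A" A 90
    using A by (rule worklist_body_cascade_step)
  have "wf F"
    using F by (intro finite_acyclic_wf finite_subset[OF F(1)]) simp
  show ?thesis
  proof (rule wp_mono[OF wp_worklist[OF inv \<sigma>]])
    fix t \<tau>
    define P where "P = copy_edges F A - copy_edges (set as) (set (queue \<tau>))"
    assume final: "cascade_body_inv F A (copy_edges (set as) (set (queue \<tau>))) \<tau> \<and>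
      t \<le> 9 + (\<Sum>p\<in>set (queue \<tau>). weight 90 p)"
    then have cascade: "cascade_inv A P (\<tau> ''count'') (queue \<tau>)"
      by (simp add: P_def cascade_body_inv_def)
    then have P: "P = copy_edges F (supported_pairs P)"
      using F(1) by (auto simp: P_def copy_edges_def cascade_inv_def)
    then have "supported_pairs P = alive_pairs F"
      using alive_subset_supported[of F s "{..n}" P]
        supported_subset_alive[OF \<open>wf F\<close>, of P s "{..n}"]
      by blast
    with cascade P show "alive_counts F F (\<tau> ''count'') \<and>
        distinct (queue \<tau>) \<and> set (queue \<tau>) = A - alive_pairs F \<and>
        t \<le> 9 + (\<Sum>p\<in>A - alive_pairs F. weight 90 p)"
      using final by (simp add: cascade_inv_def)
  qed
qed

lemma wp_seed_cascade:
  assumes F: "F \<subseteq> set as" "acyclic F" "(u, v) \<in> F"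
    and count: "alive_counts F F (\<sigma> ''count'')"
    and fwd: "edge_table (F - {(u, v)}) (\<sigma> ''fwd'')" and queue: "queue \<sigma> = []"
    and \<sigma>: "bounded_state W \<sigma>" "layout \<sigma>" "\<sigma> ''del_tail'' 0 = u" "\<sigma> ''y'' 0 = v"
  defines "F' \<equiv> F - {(u, v)}"
  shows "wp W (Seq seed (worklist cascade_step)) (\<lambda>t \<tau>.
    alive_counts F' F' (\<tau> ''count'') \<and>
    distinct (queue \<tau>) \<and> set (queue \<tau>) = alive_pairs F - alive_pairs F' \<and>
    t \<le> 104 * n + 217 + (\<Sum>p\<in>alive_pairs F - alive_pairs F'. weight 90 p)) \<sigma>"
proof -
  have F': "F' \<subseteq> set as" "acyclic F'"
    using F(1) acyclic_subset[OF F(2)] by (auto simp: F'_def)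
  have "wp W seed (\<lambda>t \<tau>. cascade_inv (alive_pairs F) (copy_edges F' (alive_pairs F))
      (\<tau> ''count'') (queue \<tau>) \<and> t \<le> 104 * (n + 2)) \<sigma>"
    unfolding F'_def using cascade_inv_start[OF count F(1)] queue \<sigma> F by (intro wp_seed)
  then show ?thesis
    unfolding wp_Seq
  proof (rule wp_frame[OF _ \<sigma>(1)])
    fix t1 \<sigma>1
    assume seeded: "cascade_inv (alive_pairs F) (copy_edges F' (alive_pairs F))
        (\<sigma>1 ''count'') (queue \<sigma>1) \<and> t1 \<le> 104 * (n + 2)"
      and \<sigma>1: "bounded_state W \<sigma>1" "agree_off (writes seed) \<sigma> \<sigma>1"
    have "cascade_body_inv F' (alive_pairs F) {} \<sigma>1"
      using seeded fwd \<sigma>1(2) by (simp add: cascade_body_inv_def F'_def agree_off_def)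
    moreover have "layout \<sigma>1"
      by (rule layout_agree_off[OF \<sigma>(2) \<sigma>1(2)]) simp
    ultimately show "wp W (worklist cascade_step) (\<lambda>t2 \<tau>.
        alive_counts F' F' (\<tau> ''count'') \<and>
        distinct (queue \<tau>) \<and> set (queue \<tau>) = alive_pairs F - alive_pairs F' \<and>
        t1 + t2 \<le> 104 * n + 217 + (\<Sum>p\<in>alive_pairs F - alive_pairs F'. weight 90 p)) \<sigma>1"
      using wp_mono[OF wp_cascade[OF F' alive_pairs_bounded[OF F(1)]]] seeded \<sigma>1(1) by simp
  qed
qed

lemma wp_delete_from_counts:
  assumes F: "F \<subseteq> set as" "acyclic F" "(u, v) \<in> F"
    and tables: "alive_counts F F (\<sigma> ''count'')" "edge_table F (\<sigma> ''fwd'')"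
    and queue: "queue \<sigma> = []"
    and \<sigma>: "bounded_state W \<sigma>" "layout \<sigma>" "\<sigma> ''del_tail'' 0 = u" "\<sigma> ''del_head'' 0 = v"
  defines "F' \<equiv> F - {(u, v)}"
  shows "wp W delete_from_counts (\<lambda>t \<tau>.
    edge_table F' (\<tau> ''fwd'') \<and> alive_counts F' F' (\<tau> ''count'') \<and>
    distinct (queue \<tau>) \<and> set (queue \<tau>) = alive_pairs F - alive_pairs F' \<and>
    t \<le> 104 * n + 231 + (\<Sum>p\<in>alive_pairs F - alive_pairs F'. weight 90 p)) \<sigma>"
proof -
  define \<sigma>1 where "\<sigma>1 = store (store \<sigma> ''fwd'' (u * n + v) 0) ''y'' 0 v"
  have uv: "u < n" "v < n"
    using edge_bounded[of u v] F by auto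
  then have fwd: "edge_table F' (\<sigma>1 ''fwd'')"
    using edge_table_delete[OF tables(2)] by (simp add: \<sigma>1_def F'_def)
  have \<sigma>1: "bounded_state W \<sigma>1" "layout \<sigma>1"
    using \<sigma>(1,2) uv by (simp_all add: \<sigma>1_def)
  then have "wp W (Seq seed (worklist cascade_step)) (\<lambda>t \<tau>.
      alive_counts F' F' (\<tau> ''count'') \<and>
      distinct (queue \<tau>) \<and> set (queue \<tau>) = alive_pairs F - alive_pairs F' \<and>
      t \<le> 104 * n + 217 + (\<Sum>p\<in>alive_pairs F - alive_pairs F'. weight 90 p)) \<sigma>1"
    unfolding F'_def using F tables(1) fwd queue \<sigma>(3)
    by (intro wp_seed_cascade) (simp_all add: \<sigma>1_def F'_def)
  then have "wp W (Seq seed (worklist cascade_step)) (\<lambda>t \<tau>.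
      edge_table F' (\<tau> ''fwd'') \<and> alive_counts F' F' (\<tau> ''count'') \<and>
      distinct (queue \<tau>) \<and> set (queue \<tau>) = alive_pairs F - alive_pairs F' \<and>
      14 + t \<le> 104 * n + 231 + (\<Sum>p\<in>alive_pairs F - alive_pairs F'. weight 90 p)) \<sigma>1"
    by (rule wp_frame[OF _ \<sigma>1(1)]) (use fwd in \<open>simp add: agree_off_def\<close>)
  then show ?thesis
    using \<sigma> uv by (simp add: delete_from_counts_def wp_Seq wp_Assign \<sigma>1_def)
qed

end


section \<open>Maintaining the tree\<close>

definition adopt :: com where
  "adopt =
     If (Equal (Cell ''count'' (index (Cell ''parent'' (Var ''x'')) (Var ''w''))) (Const 0))
       (Assign ''parent'' (Var ''x'') (Var ''w''))
       Skip"

definition event_step :: com where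
  "event_step =
     Seq (Set ''w'' (Cell ''qw'' (Var ''i'')))
    (Seq (Set ''x'' (Cell ''qx'' (Var ''i'')))
         (If (Equal (Var ''w'') (Var ''n''))
           (Assign ''in_tree'' (Var ''x'') (Const 0))
           adopt))"

definition process_events :: com where
  "process_events = For ''i'' (Var ''qlen'') event_step"

lemma writes_adopt [simp]: "writes adopt = {''parent''}"
  by (simp add: adopt_def)

lemma writes_process_events [simp]:
  "writes process_events = {''i'', ''w'', ''x'', ''in_tree'', ''parent''}"
  by (simp add: process_events_def event_step_def insert_commute)

context edge_list
begin

definition dead_copies :: "nat rel \<Rightarrow> nat \<Rightarrow> nat set" where
  "dead_copies E v = {..n} \<inter> dominators s E v"

lemma avoids_n_iff: "E \<subseteq> set as \<Longrightarrow> avoids s E n v \<longleftrightarrow> (s, v) \<in> E\<^sup>*"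
  using start_less edge_bounded by (intro avoids_iff_reachable) (auto simp: Range_iff)

lemma n_in_dead_copies_iff: "E \<subseteq> set as \<Longrightarrow> n \<in> dead_copies E v \<longleftrightarrow> (s, v) \<notin> E\<^sup>*"
  by (simp add: dead_copies_def dominators_def avoids_n_iff)

lemma dead_copies_eq_dominators:
  assumes "E \<subseteq> set as" "(s, v) \<in> E\<^sup>*"
  shows "dead_copies E v = dominators s E v"
proof -
  have "(s, w) \<in> E\<^sup>*" if "w \<in> dominators s E v" for w
    using assms(2) that by (rule dominator_reachable)
  then have "avoids s E n w" if "w \<in> dominators s E v" for w
    using that by (simp add: avoids_n_iff assms(1))
  then show ?thesis
    using avoids_bounded[OF assms(1)] by (fastforce simp: dead_copies_def)
qed

text \<open>
  \<open>S\<close> are the copies in which \<open>v\<close> is already known to be dead; \<open>p\<close> is the parent of \<open>v\<close>, and \<open>r\<close>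
  tells whether \<open>v\<close> is in the tree.
\<close>

definition tree_entry :: "nat rel \<Rightarrow> nat set \<Rightarrow> nat \<Rightarrow> nat \<Rightarrow> nat \<Rightarrow> bool" where
  "tree_entry E S r p v \<longleftrightarrow> p < n \<and> (r \<noteq> 0 \<longleftrightarrow> n \<notin> S) \<and>
     (v \<noteq> s \<and> (s, v) \<in> E\<^sup>* \<longrightarrow> deepest_dominator s E S p v)"

definition tree_table :: "nat rel \<Rightarrow> (nat \<Rightarrow> nat set) \<Rightarrow> (nat \<Rightarrow> nat) \<Rightarrow> (nat \<Rightarrow> nat) \<Rightarrow> bool" where
  "tree_table E S in_tree parent \<longleftrightarrow> (\<forall>v<n. tree_entry E (S v) (in_tree v) (parent v) v)"

definition avoids_table :: "nat rel \<Rightarrow> (nat \<Rightarrow> nat) \<Rightarrow> bool" where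
  "avoids_table E c \<longleftrightarrow> (\<forall>w\<le>n. \<forall>y<n. 0 < c (w * n + y) \<longleftrightarrow> avoids s E w y)"

lemma avoids_table_entry:
  "avoids_table E c \<Longrightarrow> w \<le> n \<Longrightarrow> y < n \<Longrightarrow> 0 < c (w * n + y) \<longleftrightarrow> avoids s E w y"
  by (simp add: avoids_table_def)

lemma avoids_table_if_alive_counts:
  assumes "alive_counts F E c" "F \<subseteq> set as" "E \<subseteq> set as"
    and "alive_pairs F = alive_pairs E"
  shows "avoids_table E c"
proof -
  have "finite (copy_edges F (alive_pairs F))"
    using finite_alive_pairs[OF assms(2)] finite_subset[OF assms(2)]
    by (intro finite_copy_edges) simp_all
  then show ?thesis
    using assms count_table_pos_iff[of "copy_edges F (alive_pairs F)" c]
      supported_copy_edges_alive[of s "{..n}" F]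
    by (auto simp: avoids_table_def) (auto simp: alive_def)
qed

lemma tree_entry_subgraph:
  assumes "tree_entry E S r p v" "E' \<subseteq> E"
  shows "tree_entry E' S r p v"
  using assms rtrancl_mono[OF assms(2)]
  by (auto simp: tree_entry_def intro: deepest_dominator_subgraph)

lemma tree_entry_insert_self: "v < n \<Longrightarrow> tree_entry E S r p v \<Longrightarrow> tree_entry E (insert v S) r p v"
  by (auto simp: tree_entry_def deepest_dominator_def)

lemma wp_adopt:
  assumes entry: "tree_entry E S r (\<sigma> ''parent'' x) x" and table: "avoids_table E (\<sigma> ''count'')"
    and \<sigma>: "bounded_state W \<sigma>" "layout \<sigma>" "\<sigma> ''w'' 0 = w" "\<sigma> ''x'' 0 = x"
    and dead: "w < n" "x < n" "w \<noteq> x" "w \<in> dominators s E x"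
  shows "wp W adopt (\<lambda>t \<tau>. (\<exists>p. \<tau> = \<sigma>(''parent'' := (\<sigma> ''parent'')(x := p)) \<and>
    tree_entry E (insert w S) r p x) \<and> t \<le> 18) \<sigma>"
proof -
  define p where "p = \<sigma> ''parent'' x"
  define p' where "p' = (if \<sigma> ''count'' (p * n + w) = 0 then w else p)"
  have "p < n"
    using entry by (simp add: tree_entry_def p_def)
  have "p' = (if p \<in> dominators s E w then w else p)"
    using avoids_table_entry[OF table, of p w] \<open>p < n\<close> dead(1) by (auto simp: p'_def dominators_def)
  then have "deepest_dominator s E (insert w S) p' x" if "x \<noteq> s" "(s, x) \<in> E\<^sup>*"
    using that entry dead deepest_dominator_insert[of s E S p x w]
    by (simp add: tree_entry_def p_def)
  moreover have "p' < n"
    using \<open>p < n\<close> dead(1) by (simp add: p'_def)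
  ultimately have entry': "tree_entry E (insert w S) r p' x"
    using entry dead(1) by (simp add: tree_entry_def)
  have "\<sigma> = \<sigma>(''parent'' := (\<sigma> ''parent'')(x := p))"
    by (simp add: p_def)
  then show ?thesis
    using entry' \<sigma> \<open>p < n\<close> dead(1,2)
    by (cases "\<sigma> ''count'' (p * n + w) = 0")
      (auto simp: adopt_def wp_simps p'_def store_def simp flip: p_def)
qed

lemma wp_event_step:
  assumes tree: "tree_table E S (\<sigma> ''in_tree'') (\<sigma> ''parent'')"
    and table: "avoids_table E (\<sigma> ''count'')"
    and E: "E \<subseteq> set as" and \<sigma>: "bounded_state W \<sigma>" "layout \<sigma>"
    and event: "\<sigma> ''qw'' (\<sigma> ''i'' 0) = w" "\<sigma> ''qx'' (\<sigma> ''i'' 0) = x"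
    and dead: "w \<le> n" "x < n" "w \<noteq> x" "w \<in> dominators s E x"
  shows "wp W event_step (\<lambda>t \<tau>.
    tree_table E (S(x := insert w (S x))) (\<tau> ''in_tree'') (\<tau> ''parent'') \<and> t \<le> 40) \<sigma>"
proof (cases "w = n")
  case True
  then have "(s, x) \<notin> E\<^sup>*"
    using dead(4) by (simp add: dominators_def avoids_n_iff[OF E])
  then have "tree_table E (S(x := insert w (S x))) ((\<sigma> ''in_tree'')(x := 0)) (\<sigma> ''parent'')"
    using tree True by (auto simp: tree_table_def tree_entry_def)
  then show ?thesis
    using True \<sigma> event dead(2) by (simp add: event_step_def wp_simps)
next
  case False
  define \<sigma>1 where "\<sigma>1 = store (store \<sigma> ''w'' 0 w) ''x'' 0 x"
  have "wp W adopt (\<lambda>t \<tau>. (\<exists>p. \<tau> = \<sigma>1(''parent'' := (\<sigma>1 ''parent'')(x := p)) \<and>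
      tree_entry E (insert w (S x)) (\<sigma> ''in_tree'' x) p x) \<and> t \<le> 18) \<sigma>1"
    using tree table \<sigma> dead False by (intro wp_adopt) (simp_all add: \<sigma>1_def tree_table_def)
  then have "wp W adopt (\<lambda>t \<tau>.
      tree_table E (S(x := insert w (S x))) (\<tau> ''in_tree'') (\<tau> ''parent'') \<and> 16 + t \<le> 40) \<sigma>1"
    by (rule wp_mono) (use tree in \<open>auto simp: tree_table_def \<sigma>1_def\<close>)
  then show ?thesis
    using False \<sigma> event dead(1,2) by (simp add: event_step_def wp_simps \<sigma>1_def)
qed

lemma wp_process_events:
  assumes E: "E' \<subseteq> E" "E \<subseteq> set as"
    and tree: "tree_table E (dead_copies E) (\<sigma> ''in_tree'') (\<sigma> ''parent'')"
    and table: "avoids_table E' (\<sigma> ''count'')"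
    and queue: "set (queue \<sigma>) = alive_pairs E - alive_pairs E'"
    and \<sigma>: "bounded_state W \<sigma>" "layout \<sigma>"
  shows "wp W process_events (\<lambda>t \<tau>. tree_table E' (dead_copies E') (\<tau> ''in_tree'') (\<tau> ''parent'') \<and>
    t \<le> 52 * (\<sigma> ''qlen'' 0 + 1)) \<sigma>"
proof -
  define S where "S k v = dead_copies E v \<union> {w. (w, v) \<in> set (take k (queue \<sigma>))}" for k v
  define I where "I k \<tau> \<longleftrightarrow> tree_table E' (S k) (\<tau> ''in_tree'') (\<tau> ''parent'')" for k \<tau>
  show ?thesis
    unfolding process_events_def
  proof (rule wp_For_const[where I = I and N = "\<sigma> ''qlen'' 0" and B = 40])
    have "S 0 = dead_copies E"
      by (simp add: S_def fun_eq_iff)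
    then show "I 0 (store \<sigma> ''i'' 0 0)"
      using tree tree_entry_subgraph[OF _ E(1)] by (simp add: I_def tree_table_def)
  next
    fix k \<tau>
    assume k: "k < \<sigma> ''qlen'' 0" "\<tau> ''i'' 0 = k" and I: "I k \<tau>"
      and \<tau>: "bounded_state W \<tau>" "agree_off (insert ''i'' (writes event_step)) \<sigma> \<tau>"
    obtain w x where wx: "queue \<sigma> ! k = (w, x)"
      by force
    then have "(w, x) \<in> set (queue \<sigma>)"
      using k(1) by (metis length_queue nth_mem)
    then have dead: "w \<le> n" "x < n" "w \<noteq> x" "w \<in> dominators s E' x"
      using queue alive_pairs_bounded[OF E(2)] avoids_imp_neq[of s E w x]
      by (auto simp: alive_def dominators_def)
    have "S (Suc k) = (S k)(x := insert w (S k x))"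
      using k(1) wx by (auto simp: S_def take_Suc_conv_app_nth fun_eq_iff)
    moreover have "layout \<tau>"
      by (rule layout_agree_off[OF \<sigma>(2) \<tau>(2)]) (simp add: event_step_def)
    moreover have "\<tau> ''count'' = \<sigma> ''count''" "\<tau> ''qw'' k = w" "\<tau> ''qx'' k = x"
      using \<tau>(2) wx k(1) by (simp_all add: agree_off_def event_step_def nth_queue)
    ultimately show "wp W event_step (\<lambda>t \<tau>'. I (Suc k) (store \<tau>' ''i'' 0 (Suc k)) \<and> t \<le> 40) \<tau>"
      using wp_event_step[of E' "S k" \<tau> w x] I table \<tau>(1) E k(2) dead by (simp add: I_def)
  next
    fix t \<tau>
    assume "I (\<sigma> ''qlen'' 0) \<tau>" "t \<le> (40 + expr_cost (Var ''qlen'') + 10) * (\<sigma> ''qlen'' 0 + 1)"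
    moreover have "S (length (queue \<sigma>)) = dead_copies E'"
      using queue dominators_antimono[OF E(1), of s]
      by (auto simp: S_def fun_eq_iff dead_copies_def alive_def dominators_def)
    ultimately show "tree_table E' (dead_copies E') (\<tau> ''in_tree'') (\<tau> ''parent'') \<and>
        t \<le> 52 * (\<sigma> ''qlen'' 0 + 1)"
      by (simp add: I_def)
  qed (use \<sigma> in \<open>simp_all add: event_step_def\<close>)
qed

lemma stored_tree_eq_dominator_tree:
  assumes G: "flow_graph G s" "pverts G = {..<n}" and E: "parcs G \<subseteq> set as"
    and tree: "tree_table (parcs G) (dead_copies (parcs G)) (\<sigma> ''in_tree'') (\<sigma> ''parent'')"
  shows "stored_tree n s \<sigma> = dominator_tree G s"
proof -
  interpret flow_graph G s
    by (fact G(1))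
  have bounded: "v < n" if "(s, v) \<in> (parcs G)\<^sup>*" for v
    using that avoids_bounded[OF E] avoids_n_iff[OF E] by blast
  have in_tree: "v < n \<and> \<sigma> ''in_tree'' v \<noteq> 0 \<longleftrightarrow> (s, v) \<in> (parcs G)\<^sup>*" for v
    using tree bounded[of v] n_in_dead_copies_iff[OF E, of v]
    by (auto simp: tree_table_def tree_entry_def)
  have "immediate_dominator G s d v \<longleftrightarrow> d = \<sigma> ''parent'' v"
    if "(s, v) \<in> (parcs G)\<^sup>*" "v \<noteq> s" for d v
  proof -
    have "deepest_dominator s (parcs G) (dominators s (parcs G) v) (\<sigma> ''parent'' v) v"
      unfolding dead_copies_eq_dominators[OF E that(1), symmetric]
      using tree that bounded[OF that(1)] by (simp add: tree_table_def tree_entry_def)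
    then show ?thesis
      using that(1) by (simp add: immediate_dominator_iff immediate_dominator_unique)
  qed
  with in_tree have "{(\<sigma> ''parent'' v, v) |v. v < n \<and> \<sigma> ''in_tree'' v \<noteq> 0 \<and> v \<noteq> s} =
      {(d, v). (s, v) \<in> (parcs G)\<^sup>* \<and> v \<noteq> s \<and> immediate_dominator G s d v}"
    by blast
  then show ?thesis
    using in_tree by (simp add: stored_tree_def dominator_tree_def reachable_iff_rtrancl)
qed

end


section \<open>Deleting an edge\<close>

definition update :: com where
  "update =
     Seq (Set ''qlen'' (Const 0))
         (If (Equal (Cell ''fwd'' (index (Var ''del_tail'') (Var ''del_head''))) (Const 1))
           (Seq delete_from_counts process_events)
           Skip)"

context edge_list
begin

abbreviation forward :: "nat rel" where
  "forward \<equiv> forward_edges s (set as)"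

definition maintained :: "nat rel \<Rightarrow> state \<Rightarrow> bool" where
  "maintained E \<sigma> \<longleftrightarrow> bounded_state W \<sigma> \<and> layout \<sigma> \<and> edge_table (E \<inter> forward) (\<sigma> ''fwd'') \<and>
     alive_counts (E \<inter> forward) E (\<sigma> ''count'') \<and>
     tree_table E (dead_copies E) (\<sigma> ''in_tree'') (\<sigma> ''parent'')"

text \<open>The \<open>52\<close> pays for the pass over the dead pairs that repairs the tree.\<close>

definition potential :: "nat rel \<Rightarrow> nat" where
  "potential E = (\<Sum>p\<in>alive_pairs E. weight 90 p + 52)"

lemma potential_diff:
  assumes "E' \<subseteq> E" "E \<subseteq> set as"
  shows "potential E = potential E' + (\<Sum>p\<in>alive_pairs E - alive_pairs E'. weight 90 p) +
    52 * card (alive_pairs E - alive_pairs E')"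
proof -
  have "potential E = (\<Sum>p\<in>alive_pairs E - alive_pairs E'. weight 90 p + 52) + potential E'"
    unfolding potential_def
    by (rule sum.subset_diff[OF alive_mono[OF assms(1)] finite_alive_pairs[OF assms(2)]])
  then show ?thesis
    by (simp add: sum.distrib)
qed

lemma alive_pairs_forward: "E \<subseteq> set as \<Longrightarrow> alive_pairs (E \<inter> forward) = alive_pairs E"
  by (simp add: alive_def avoids_Int_forward_edges)

end

locale reducible_edge_list = edge_list +
  assumes acyclic_forward_edges: "acyclic (forward_edges s (set as))"
begin

lemma wp_delete_from_counts_maintained:
  assumes M: "maintained E \<sigma>" and E: "E \<subseteq> set as" "(u, v) \<in> E \<inter> forward"
    and vars: "\<sigma> ''qlen'' 0 = 0" "\<sigma> ''del_tail'' 0 = u" "\<sigma> ''del_head'' 0 = v"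
  defines "E' \<equiv> E - {(u, v)}"
  shows "wp W delete_from_counts (\<lambda>t \<tau>. edge_table (E' \<inter> forward) (\<tau> ''fwd'') \<and>
    alive_counts (E' \<inter> forward) E' (\<tau> ''count'') \<and>
    set (queue \<tau>) = alive_pairs E - alive_pairs E' \<and>
    t + 52 * (\<tau> ''qlen'' 0 + 1) + potential E' \<le> potential E + 104 * n + 283) \<sigma>"
proof -
  have E': "E' \<subseteq> E" "E' \<subseteq> set as" "E' \<inter> forward = E \<inter> forward - {(u, v)}"
    using E(1) by (auto simp: E'_def)
  note alive = alive_pairs_forward[OF E(1)] alive_pairs_forward[OF E'(2)]
  have "acyclic (E \<inter> forward)"
    using acyclic_forward_edges by (rule acyclic_subset) simp
  then have "wp W delete_from_counts (\<lambda>t \<tau>. edge_table (E' \<inter> forward) (\<tau> ''fwd'') \<and>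
      alive_counts (E' \<inter> forward) (E' \<inter> forward) (\<tau> ''count'') \<and>
      distinct (queue \<tau>) \<and>
      set (queue \<tau>) = alive_pairs (E \<inter> forward) - alive_pairs (E' \<inter> forward) \<and>
      t \<le> 104 * n + 231 +
        (\<Sum>p\<in>alive_pairs (E \<inter> forward) - alive_pairs (E' \<inter> forward). weight 90 p)) \<sigma>"
    unfolding E'(3) using M E vars
    by (intro wp_delete_from_counts) (auto simp: maintained_def alive_pairs_forward queue_empty_iff)
  then show ?thesis
    unfolding alive
  proof (rule wp_mono, elim conjE, intro conjI)
    fix t \<tau>
    assume "distinct (queue \<tau>)" "set (queue \<tau>) = alive_pairs E - alive_pairs E'"
      and time: "t \<le> 104 * n + 231 + (\<Sum>p\<in>alive_pairs E - alive_pairs E'. weight 90 p)"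
    then have "\<tau> ''qlen'' 0 = card (alive_pairs E - alive_pairs E')"
      by (metis distinct_card length_queue)
    with time show "t + 52 * (\<tau> ''qlen'' 0 + 1) + potential E' \<le> potential E + 104 * n + 283"
      using potential_diff[OF E'(1) E(1)] by simp
  qed
qed

lemma wp_delete_forward_edge:
  assumes M: "maintained E \<sigma>" and E: "E \<subseteq> set as" "(u, v) \<in> E \<inter> forward"
    and vars: "\<sigma> ''qlen'' 0 = 0" "\<sigma> ''del_tail'' 0 = u" "\<sigma> ''del_head'' 0 = v"
  defines "E' \<equiv> E - {(u, v)}"
  shows "wp W (Seq delete_from_counts process_events) (\<lambda>t \<tau>. maintained E' \<tau> \<and>
    t + potential E' \<le> potential E + 104 * n + 283) \<sigma>"
proof -
  have E': "E' \<subseteq> E" "E' \<subseteq> set as"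
    using E(1) by (auto simp: E'_def)
  have \<sigma>: "bounded_state W \<sigma>" "layout \<sigma>"
    using M by (simp_all add: maintained_def)
  obtain t1 \<sigma>1 where counts: "exec W delete_from_counts \<sigma> t1 \<sigma>1"
      "edge_table (E' \<inter> forward) (\<sigma>1 ''fwd'')" "alive_counts (E' \<inter> forward) E' (\<sigma>1 ''count'')"
      "set (queue \<sigma>1) = alive_pairs E - alive_pairs E'"
      "t1 + 52 * (\<sigma>1 ''qlen'' 0 + 1) + potential E' \<le> potential E + 104 * n + 283"
    and \<sigma>1: "bounded_state W \<sigma>1" "agree_off (writes delete_from_counts) \<sigma> \<sigma>1"
    using wp_obtain[OF wp_delete_from_counts_maintained[OF M E vars] \<sigma>(1)]
    unfolding E'_def by blast
  have "layout \<sigma>1"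
    by (rule layout_agree_off[OF \<sigma>(2) \<sigma>1(2)]) simp
  have "avoids_table E' (\<sigma>1 ''count'')"
    using avoids_table_if_alive_counts[OF counts(3)] E'(2) alive_pairs_forward[OF E'(2)] by blast
  moreover have "tree_table E (dead_copies E) (\<sigma>1 ''in_tree'') (\<sigma>1 ''parent'')"
    using M \<sigma>1(2) by (simp add: maintained_def agree_off_def)
  ultimately obtain t2 \<tau> where events: "exec W process_events \<sigma>1 t2 \<tau>"
      "tree_table E' (dead_copies E') (\<tau> ''in_tree'') (\<tau> ''parent'')"
      "t2 \<le> 52 * (\<sigma>1 ''qlen'' 0 + 1)"
    and \<tau>: "bounded_state W \<tau>" "agree_off (writes process_events) \<sigma>1 \<tau>"
    using wp_obtain[OF wp_process_events[OF E'(1) E(1) _ _ counts(4) \<sigma>1(1) \<open>layout \<sigma>1\<close>] \<sigma>1(1)]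
    by blast
  have "layout \<tau>"
    by (rule layout_agree_off[OF \<open>layout \<sigma>1\<close> \<tau>(2)]) simp
  then have "maintained E' \<tau>"
    using counts(2,3) events(2) \<tau> by (simp add: maintained_def agree_off_def)
  moreover have "(t1 + t2) + potential E' \<le> potential E + 104 * n + 283"
    using counts(5) events(3) by simp
  ultimately show ?thesis
    using exec.Seq[OF counts(1) events(1)] unfolding wp_def by blast
qed

lemma maintained_request:
  assumes "maintained E \<sigma>" "fst e < n" "snd e < n"
  shows "maintained E (store (request e \<sigma>) ''qlen'' 0 0)"
  using assms by (simp add: maintained_def request_def)

lemma maintained_delete_nonforward_edge:
  assumes "maintained E \<sigma>" "E \<subseteq> set as" "e \<notin> E \<inter> forward"
  shows "maintained (E - {e}) \<sigma>" "potential (E - {e}) = potential E"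
proof -
  have same: "(E - {e}) \<inter> forward = E \<inter> forward"
    using assms(3) by auto
  have "avoids s (E - {e}) w x \<longleftrightarrow> avoids s E w x" for w x
    using assms(2) avoids_Int_forward_edges[of "E - {e}" "set as" s w x]
      avoids_Int_forward_edges[OF assms(2), of s w x]
    by (auto simp: same)
  then have "dead_copies (E - {e}) = dead_copies E" "alive_pairs (E - {e}) = alive_pairs E"
    by (simp_all add: dead_copies_def dominators_def alive_def fun_eq_iff)
  then show "maintained (E - {e}) \<sigma>" "potential (E - {e}) = potential E"
    using assms(1) tree_entry_subgraph[of E _ _ _ _ "E - {e}"]
    by (auto simp: maintained_def same potential_def tree_table_def)
qed

lemma wp_update:
  assumes M: "maintained E \<sigma>" and E: "E \<subseteq> set as" and e: "fst e < n" "snd e < n"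
  shows "wp W update (\<lambda>t \<tau>. maintained (E - {e}) \<tau> \<and>
    t + potential (E - {e}) \<le> potential E + 400 * (n + 1)) (request e \<sigma>)"
proof -
  obtain u v where uv: "e = (u, v)"
    by force
  define \<sigma>1 where "\<sigma>1 = store (request e \<sigma>) ''qlen'' 0 0"
  have M1: "maintained E \<sigma>1"
    unfolding \<sigma>1_def using M e by (rule maintained_request)
  have "edge_table (E \<inter> forward) (\<sigma>1 ''fwd'')" "layout \<sigma>1"
    using M1 by (simp_all add: maintained_def)
  then have fwd: "\<sigma>1 ''fwd'' (u * n + v) = of_bool (e \<in> E \<inter> forward)" "\<sigma>1 ''n'' 0 = n"
    using e edge_table_entry[of "E \<inter> forward" "\<sigma>1 ''fwd''" u v] by (simp_all add: uv)
  show ?thesis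
  proof (cases "e \<in> E \<inter> forward")
    case True
    then have "wp W (Seq delete_from_counts process_events) (\<lambda>t \<tau>. maintained (E - {(u, v)}) \<tau> \<and>
        t + potential (E - {(u, v)}) \<le> potential E + 104 * n + 283) \<sigma>1"
      using M1 E by (intro wp_delete_forward_edge) (simp_all add: uv \<sigma>1_def request_def)
    then have "wp W (Seq delete_from_counts process_events) (\<lambda>t \<tau>. maintained (E - {e}) \<tau> \<and>
        (15 + t) + potential (E - {e}) \<le> potential E + 400 * (n + 1)) \<sigma>1"
      by (rule wp_mono) (simp add: uv)
    moreover have "\<sigma>1 ''fwd'' (u * n + v) = 1"
      using fwd True by simp
    ultimately show ?thesis
      using e fwd(2) by (simp add: update_def wp_simps \<sigma>1_def request_def uv)
  next
    case False
    then have "maintained (E - {e}) \<sigma>1" "potential (E - {e}) = potential E"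
        "\<sigma>1 ''fwd'' (u * n + v) = 0"
      using maintained_delete_nonforward_edge[OF M1 E] fwd by simp_all
    then show ?thesis
      using e fwd(2) by (simp add: update_def wp_simps \<sigma>1_def request_def uv)
  qed
qed

end


section \<open>Building the adjacency lists\<close>

definition adj_step :: com where
  "adj_step =
     Seq (Assign ''adj'' (Bin Plus (Bin Times (Cell ''tail'' (Var ''i'')) (Var ''m''))
                                   (Cell ''deg'' (Cell ''tail'' (Var ''i''))))
            (Cell ''head'' (Var ''i'')))
         (Assign ''deg'' (Cell ''tail'' (Var ''i''))
            (Bin Plus (Cell ''deg'' (Cell ''tail'' (Var ''i''))) (Const 1)))"

definition build_adj :: com where
  "build_adj = For ''i'' (Var ''m'') adj_step"

lemma writes_build_adj [simp]: "writes build_adj = {''i'', ''adj'', ''deg''}"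
  by (simp add: build_adj_def adj_step_def insert_commute)

context edge_list
begin

lemma nth_edge_bounded: "i < m \<Longrightarrow> as ! i = (u, v) \<Longrightarrow> u < n \<and> v < n"
  using edge_bounded[of u v] nth_mem[of i as] by (simp add: length_edges)

lemma set_take_Suc: "i < m \<Longrightarrow> as ! i = e \<Longrightarrow> set (take (Suc i) as) = insert e (set (take i as))"
  by (simp add: take_Suc_conv_app_nth length_edges)

lemma wp_adj_step:
  assumes table: "adj_table (take i as) (\<sigma> ''deg'') (\<sigma> ''adj'')"
    and "inputs \<sigma>" "\<sigma> ''i'' 0 = i" "i < m"
  shows "wp W adj_step (\<lambda>t \<tau>. adj_table (take (Suc i) as) (\<tau> ''deg'') (\<tau> ''adj'') \<and> t \<le> 25) \<sigma>"
proof -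
  obtain u v where uv: "as ! i = (u, v)"
    by force
  then have range: "u < n" "v < n"
    using nth_edge_bounded[OF \<open>i < m\<close>] by blast+
  have "(\<sigma> ''tail'' i, \<sigma> ''head'' i) = as ! i" "\<sigma> ''m'' 0 = m"
    using assms(2) \<open>i < m\<close> unfolding inputs_def by blast+
  then have input: "\<sigma> ''tail'' i = u" "\<sigma> ''head'' i = v" "\<sigma> ''m'' 0 = m"
    by (simp_all add: uv)
  have "\<sigma> ''deg'' u < m"
    using table range(1) length_successors_le[of "take i as" u] \<open>i < m\<close>
    by (simp add: adj_table_def length_edges)
  then have small: "\<sigma> ''deg'' u < W" "Suc (\<sigma> ''deg'' u) < W" "u * m + \<sigma> ''deg'' u < W"
    using range(1) by simp_all
  have "adj_table (take (Suc i) as) ((\<sigma> ''deg'')(u := Suc (\<sigma> ''deg'' u)))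
      ((\<sigma> ''adj'')(u * m + \<sigma> ''deg'' u := v))"
    using adj_table_snoc[OF table, of u v] \<open>i < m\<close> range(1)
    by (simp add: take_Suc_conv_app_nth length_edges uv)
  then show ?thesis
    using input assms(3) \<open>i < m\<close> range small by (simp add: adj_step_def wp_simps)
qed

lemma wp_build_adj:
  assumes \<sigma>: "bounded_state W \<sigma>" "inputs \<sigma>" and deg: "\<And>u. \<sigma> ''deg'' u = 0"
  shows "wp W build_adj (\<lambda>t \<tau>. layout \<tau> \<and> t \<le> 37 * (m + 1)) \<sigma>"
  unfolding build_adj_def
proof (rule wp_For_const[where N = m and B = 25 and
      I = "\<lambda>i \<tau>. adj_table (take i as) (\<tau> ''deg'') (\<tau> ''adj'')"])
  show "adj_table (take 0 as) (store \<sigma> ''i'' 0 0 ''deg'') (store \<sigma> ''i'' 0 0 ''adj'')"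
    using deg by (simp add: adj_table_def successors_def)
next
  fix i \<tau>
  assume "i < m" "adj_table (take i as) (\<tau> ''deg'') (\<tau> ''adj'')" "\<tau> ''i'' 0 = i"
    and agree: "agree_off (insert ''i'' (writes adj_step)) \<sigma> \<tau>"
  moreover have "inputs \<tau>"
    by (rule inputs_agree_off[OF \<sigma>(2) agree]) (simp add: adj_step_def)
  ultimately show "wp W adj_step (\<lambda>t \<tau>'.
      adj_table (take (Suc i) as) (store \<tau>' ''i'' 0 (Suc i) ''deg'')
        (store \<tau>' ''i'' 0 (Suc i) ''adj'') \<and> t \<le> 25) \<tau>"
    using wp_adj_step by simp
next
  fix t \<tau>
  assume "adj_table (take m as) (\<tau> ''deg'') (\<tau> ''adj'')"
    and "t \<le> (25 + expr_cost (Var ''m'') + 10) * (m + 1)"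
    and agree: "agree_off (insert ''i'' (writes adj_step)) \<sigma> \<tau>"
  moreover have "inputs \<tau>"
    by (rule inputs_agree_off[OF \<sigma>(2) agree]) (simp add: adj_step_def)
  ultimately show "layout \<tau> \<and> t \<le> 37 * (m + 1)"
    by (simp add: layout_def length_edges)
qed (use \<sigma> in \<open>simp_all add: inputs_def adj_step_def\<close>)

end


section \<open>Counting predecessors\<close>

definition start_step :: com where
  "start_step =
     If (Equal (Var ''w'') (Var ''s'')) Skip
       (Seq (Assign ''count'' (index (Var ''w'') (Var ''s'')) (Const 1)) push)"

definition start :: com where
  "start = For ''w'' (Bin Plus (Var ''n'') (Const 1)) start_step"

definition search_step :: com where
  "search_step =
     If (Equal (Var ''w'') (Var ''y'')) Skip
       (Seq (If (Equal (Cell ''count'' (index (Var ''w'') (Var ''y''))) (Const 0)) push Skip)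
            (Assign ''count'' (index (Var ''w'') (Var ''y''))
              (Bin Plus (Cell ''count'' (index (Var ''w'') (Var ''y''))) (Const 1))))"

definition search :: com where
  "search =
     Seq (Set ''y'' (Var ''s''))
    (Seq start
         (worklist search_step))"

definition classify_step :: com where
  "classify_step =
     Seq (Set ''del_tail'' (Cell ''tail'' (Var ''i'')))
    (Seq (Set ''y'' (Cell ''head'' (Var ''i'')))
         (If (Equal (Cell ''count'' (index (Var ''y'') (Var ''del_tail''))) (Const 0))
           seed
           (Assign ''fwd'' (index (Var ''del_tail'') (Var ''y'')) (Const 1))))"

definition classify :: com where
  "classify = Seq (Set ''qlen'' (Const 0)) (For ''i'' (Var ''m'') classify_step)"

definition build_counts :: com where
  "build_counts = Seq search classify"

lemma writes_search_step [simp]: "writes search_step = {''count'', ''qw'', ''qx'', ''qlen''}"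
  by (simp add: search_step_def insert_commute)

lemma writes_search [simp]:
  "writes search = {''y'', ''w'', ''count'', ''qw'', ''qx'', ''qlen'', ''qpos'', ''x'', ''j''}"
  by (auto simp: search_def start_def start_step_def)

lemma writes_classify [simp]:
  "writes classify =
     {''i'', ''del_tail'', ''y'', ''fwd'', ''w'', ''count'', ''qw'', ''qx'', ''qlen''}"
  by (auto simp: classify_def classify_step_def)

lemma writes_build_counts [simp]:
  "writes build_counts = {''y'', ''w'', ''count'', ''qw'', ''qx'', ''qlen'', ''qpos'', ''x'', ''j'',
     ''i'', ''del_tail'', ''fwd''}"
  by (auto simp: build_counts_def)

context edge_list
begin

text \<open>\<open>D\<close> are the edges of the copies that have been scanned.\<close>

definition search_inv ::
  "(nat \<times> nat \<times> nat) set \<Rightarrow> (nat \<Rightarrow> nat) \<Rightarrow> (nat \<times> nat) list \<Rightarrow> bool" where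
  "search_inv D c q \<longleftrightarrow> count_table D c \<and> D \<subseteq> {..n} \<times> set as \<and>
     supported_pairs D \<subseteq> alive_pairs (set as) \<and> distinct q \<and> set q = supported_pairs D"

lemma pred_count_le:
  assumes "D \<subseteq> {..n} \<times> set as"
  shows "pred_count s D w y \<le> n + 1"
proof -
  have "card {x. (w, x, y) \<in> D} \<le> card {..<n}"
    using assms edge_bounded by (intro card_mono) auto
  then show ?thesis
    by (auto simp: pred_count_def)
qed

lemma search_inv_insert_self:
  assumes "search_inv D c q" "w \<le> n" "(x, w) \<in> set as"
  shows "search_inv (insert (w, x, w) D) c q"
proof -
  have "supported_pairs (insert (w, x, w) D) = supported_pairs D"
    by (auto simp: supported_def)
  then show ?thesis
    using assms by (simp add: search_inv_def count_table_def pred_count_insert_self)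
qed

lemma search_inv_insert:
  assumes inv: "search_inv D c q"
    and edge: "(w, x) \<in> set q" "(x, y) \<in> set as" "(w, x, y) \<notin> D" "w \<noteq> y"
  defines "k \<equiv> c (w * n + y)"
  shows "k \<le> n + 1"
    and "search_inv (insert (w, x, y) D) (c(w * n + y := Suc k))
      (if k = 0 then q @ [(w, y)] else q)"
proof -
  have wx: "w \<le> n" "avoids s (set as) w x"
    using inv edge(1) by (auto simp: search_inv_def alive_def)
  have "y < n"
    using edge_bounded[OF edge(2)] by simp
  have D: "count_table D c" "finite D" "D \<subseteq> {..n} \<times> set as"
    using inv finite_subset[of D "{..n} \<times> set as"] by (auto simp: search_inv_def)
  have k: "k = pred_count s D w y"
    using D(1) wx(1) \<open>y < n\<close> by (simp add: k_def count_table_def row_majorD)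
  then show "k \<le> n + 1"
    using pred_count_le[OF D(3)] by simp
  have "pred_count s (insert (w, x, y) D) = (pred_count s D)(w := (pred_count s D w)(y := Suc k))"
    using D(2) edge(3,4) by (simp add: k pred_count_insert)
  then have "count_table (insert (w, x, y) D) (c(w * n + y := Suc k))"
    using row_major_update[of "n + 1" n "pred_count s D" c y w "Suc k"] D(1) \<open>y < n\<close>
    by (simp add: count_table_def)
  moreover have "supported_pairs (insert (w, x, y) D) = insert (w, y) (supported_pairs D)"
    using wx(1) edge(4) by (auto simp: supported_def)
  moreover have "(w, y) \<in> alive_pairs (set as)"
    using wx edge(2,4) by (auto simp: alive_def intro: avoids_step)
  moreover have "k = 0 \<longleftrightarrow> (w, y) \<notin> supported_pairs D"
    using pred_count_pos_iff[of D w "{..n}" s y] D(2) wx(1) by (auto simp: k)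
  ultimately show "search_inv (insert (w, x, y) D) (c(w * n + y := Suc k))
      (if k = 0 then q @ [(w, y)] else q)"
    using inv wx(1) edge(2) by (auto simp: search_inv_def)
qed

lemma search_inv_push_fits: "search_inv D c (queue \<sigma>) \<Longrightarrow> \<sigma> ''qlen'' 0 + 1 < W"
  using alive_pairs_bounded[of "set as"]
  by (intro queue_push_fits) (auto simp: search_inv_def)

lemma wp_search_step:
  assumes inv: "search_inv D (\<sigma> ''count'') (queue \<sigma>)"
    and \<sigma>: "bounded_state W \<sigma>" "layout \<sigma>" "\<sigma> ''w'' 0 = w" "\<sigma> ''y'' 0 = y"
    and edge: "(w, x) \<in> set (queue \<sigma>)" "(x, y) \<in> set as" "(w, x, y) \<notin> D"
  shows "wp W search_step (\<lambda>t \<tau>. search_inv (insert (w, x, y) D) (\<tau> ''count'') (queue \<tau>) \<and>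
    prefix (queue \<sigma>) (queue \<tau>) \<and> t \<le> 60) \<sigma>"
proof -
  define k where "k = \<sigma> ''count'' (w * n + y)"
  have wy: "w \<le> n" "y < n"
    using inv edge(1) edge_bounded[OF edge(2)] by (auto simp: search_inv_def alive_def)
  consider (removed) "w = y" | (found) "w \<noteq> y" "k = 0" | (counted) "w \<noteq> y" "k > 0"
    by blast
  then show ?thesis
  proof cases
    case removed
    then show ?thesis
      using search_inv_insert_self[OF inv wy(1)] edge(2) \<sigma> wy
      by (simp add: search_step_def wp_simps)
  next
    case found
    have inv': "search_inv (insert (w, x, y) D) ((\<sigma> ''count'')(w * n + y := 1))
        (queue \<sigma> @ [(w, y)])"
      using search_inv_insert(2)[OF inv edge found(1)] found(2) by (simp add: k_def)
    have "wp W push (\<lambda>t \<tau>. t \<le> 16 \<and> queue \<tau> = queue \<sigma> @ [(\<sigma> ''w'' 0, \<sigma> ''y'' 0)] \<and>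
        agree_off {''qw'', ''qx'', ''qlen''} \<sigma> \<tau>) \<sigma>"
      using \<sigma>(1) search_inv_push_fits[OF inv] by (rule wp_push)
    then have "wp W push (\<lambda>t. wp W (Assign ''count'' (index (Var ''w'') (Var ''y''))
          (Bin Plus (Cell ''count'' (index (Var ''w'') (Var ''y''))) (Const 1)))
        (\<lambda>t' \<tau>. search_inv (insert (w, x, y) D) (\<tau> ''count'') (queue \<tau>) \<and>
          prefix (queue \<sigma>) (queue \<tau>) \<and> 18 + (t + t') \<le> 60)) \<sigma>"
      by (rule wp_mono)
        (use inv' found \<sigma> wy in \<open>simp add: wp_Assign agree_off_def k_def eval_nat_numeral\<close>)
    then show ?thesis
      using found \<sigma> wy by (simp add: search_step_def wp_simps k_def)
  next
    case counted
    have "Suc k < W"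
      using search_inv_insert(1)[OF inv edge counted(1)] word_size_expanded by (simp add: k_def)
    moreover have "search_inv (insert (w, x, y) D) ((\<sigma> ''count'')(w * n + y := Suc k)) (queue \<sigma>)"
      using search_inv_insert(2)[OF inv edge counted(1)] counted(2) by (simp add: k_def)
    ultimately show ?thesis
      using counted \<sigma> wy by (simp add: search_step_def wp_simps flip: k_def)
  qed
qed

lemma worklist_body_search_step:
  "worklist_body n m s W as search_step (\<lambda>D \<sigma>. search_inv D (\<sigma> ''count'') (queue \<sigma>))
     (alive_pairs (set as)) 60"
proof unfold_locales
  fix D \<sigma> \<tau>
  assume "search_inv D (\<sigma> ''count'') (queue \<sigma>)"
    and agree: "agree_off {''qpos'', ''j'', ''w'', ''x'', ''y''} \<sigma> \<tau>"
  then show "search_inv D (\<tau> ''count'') (queue \<tau>)"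
    using queue_agree_off[OF agree] by (simp add: agree_off_def)
next
  fix D \<sigma> w x y
  assume "search_inv D (\<sigma> ''count'') (queue \<sigma>)" "bounded_state W \<sigma>" "layout \<sigma>"
    "\<sigma> ''w'' 0 = w" "\<sigma> ''y'' 0 = y"
    "(w, x) \<in> set (queue \<sigma>)" "(x, y) \<in> set as" "(w, x, y) \<notin> D"
  then show "wp W search_step (\<lambda>t \<tau>. search_inv (insert (w, x, y) D) (\<tau> ''count'') (queue \<tau>) \<and>
      prefix (queue \<sigma>) (queue \<tau>) \<and> t \<le> 60) \<sigma>"
    by (intro wp_search_step)
qed (use alive_pairs_bounded[of "set as"] in \<open>auto simp: search_inv_def\<close>)

definition start_pairs :: "nat \<Rightarrow> (nat \<times> nat) set" where
  "start_pairs k = ({..<k} - {s}) \<times> {s}"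

definition start_inv :: "nat \<Rightarrow> state \<Rightarrow> bool" where
  "start_inv k \<sigma> \<longleftrightarrow>
     row_major (n + 1) n (\<lambda>w y. of_bool ((w, y) \<in> start_pairs k)) (\<sigma> ''count'') \<and>
     distinct (queue \<sigma>) \<and> set (queue \<sigma>) = start_pairs k"

lemma start_inv_store [simp]:
  "x \<notin> {''count'', ''qw'', ''qx'', ''qlen''} \<Longrightarrow> start_inv k (store \<sigma> x i j) \<longleftrightarrow> start_inv k \<sigma>"
  by (auto simp: start_inv_def)

lemma wp_start_step:
  assumes inv: "start_inv w \<sigma>" and "w \<le> n"
    and \<sigma>: "bounded_state W \<sigma>" "layout \<sigma>" "\<sigma> ''w'' 0 = w" "\<sigma> ''y'' 0 = s"
  shows "wp W start_step (\<lambda>t \<tau>. start_inv (Suc w) \<tau> \<and> t \<le> 40) \<sigma>"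
proof (cases "w = s")
  case True
  then have "start_pairs (Suc w) = start_pairs w"
    by (auto simp: start_pairs_def)
  with True show ?thesis
    using inv \<sigma> start_less by (simp add: start_step_def wp_simps start_inv_def)
next
  case False
  define \<sigma>1 where "\<sigma>1 = store \<sigma> ''count'' (w * n + s) 1"
  define f where "f k w y = (of_bool ((w, y) \<in> start_pairs k) :: nat)" for k w y
  have new: "start_pairs (Suc w) = insert (w, s) (start_pairs w)" "(w, s) \<notin> start_pairs w"
    using False by (auto simp: start_pairs_def)
  then have "f (Suc w) = (f w)(w := (f w w)(s := 1))"
    by (auto simp: f_def fun_eq_iff)
  then have count: "row_major (n + 1) n (f (Suc w)) (\<sigma>1 ''count'')"
    using row_major_update[of "n + 1" n "f w" "\<sigma> ''count''" s w 1] inv start_less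
    by (simp add: start_inv_def f_def[abs_def] \<sigma>1_def)
  have "start_pairs w \<subseteq> {..n} \<times> {..<n}"
    using \<open>w \<le> n\<close> start_less by (auto simp: start_pairs_def)
  then have "\<sigma> ''qlen'' 0 + 1 < W"
    using inv by (intro queue_push_fits) (simp_all add: start_inv_def)
  then have "wp W push (\<lambda>t \<tau>. t \<le> 16 \<and> queue \<tau> = queue \<sigma>1 @ [(\<sigma>1 ''w'' 0, \<sigma>1 ''y'' 0)] \<and>
      agree_off {''qw'', ''qx'', ''qlen''} \<sigma>1 \<tau>) \<sigma>1"
    using \<sigma>(1) by (intro wp_push) (simp_all add: \<sigma>1_def)
  then have "wp W push (\<lambda>t \<tau>. start_inv (Suc w) \<tau> \<and> 16 + t \<le> 40) \<sigma>1"
    by (rule wp_mono)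
      (use inv count new \<sigma> in \<open>simp add: start_inv_def agree_off_def f_def[abs_def] \<sigma>1_def\<close>)
  then show ?thesis
    using False \<sigma> \<open>w \<le> n\<close> start_less by (simp add: start_step_def wp_simps \<sigma>1_def)
qed

lemma search_inv_start:
  assumes "start_inv (n + 1) \<sigma>"
  shows "search_inv {} (\<sigma> ''count'') (queue \<sigma>)"
proof -
  have "row_major (n + 1) n (\<lambda>w y. of_bool ((w, y) \<in> start_pairs (n + 1))) (\<sigma> ''count'') \<longleftrightarrow>
      count_table {} (\<sigma> ''count'')"
    unfolding count_table_def by (rule row_major_cong) (auto simp: start_pairs_def pred_count_def)
  moreover have "supported_pairs {} = start_pairs (n + 1)"
    by (auto simp: supported_def start_pairs_def)
  moreover have "supported_pairs {} \<subseteq> alive_pairs (set as)"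
    by (auto simp: supported_def alive_def)
  ultimately show ?thesis
    using assms by (simp add: start_inv_def search_inv_def)
qed

lemma wp_start:
  assumes \<sigma>: "bounded_state W \<sigma>" "layout \<sigma>" "\<sigma> ''y'' 0 = s"
    and zero: "\<And>i. \<sigma> ''count'' i = 0" "queue \<sigma> = []"
  shows "wp W start (\<lambda>t \<tau>. search_inv {} (\<tau> ''count'') (queue \<tau>) \<and> t \<le> 54 * (n + 2)) \<sigma>"
  unfolding start_def
proof (rule wp_For_const[where I = start_inv and N = "n + 1" and B = 40])
  show "start_inv 0 (store \<sigma> ''w'' 0 0)"
    using zero by (simp add: start_inv_def start_pairs_def row_major_def)
next
  fix k \<tau>
  assume k: "k < n + 1" "\<tau> ''w'' 0 = k" and inv: "start_inv k \<tau>"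
    and \<tau>: "bounded_state W \<tau>" "agree_off (insert ''w'' (writes start_step)) \<sigma> \<tau>"
  have "layout \<tau>"
    by (rule layout_agree_off[OF \<sigma>(2) \<tau>(2)]) (simp add: start_step_def)
  moreover have "\<tau> ''y'' 0 = s"
    using \<tau>(2) \<sigma>(3) by (simp add: agree_off_def start_step_def)
  ultimately show "wp W start_step (\<lambda>t \<tau>'. start_inv (Suc k) (store \<tau>' ''w'' 0 (Suc k)) \<and> t \<le> 40) \<tau>"
    using wp_start_step[OF inv] k \<tau>(1) by simp
next
  fix t \<tau>
  assume "start_inv (n + 1) \<tau>"
    and "t \<le> (40 + expr_cost (Bin Plus (Var ''n'') (Const 1)) + 10) * (n + 1 + 1)"
  then show "search_inv {} (\<tau> ''count'') (queue \<tau>) \<and> t \<le> 54 * (n + 2)"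
    using search_inv_start[of \<tau>] by simp
qed (use \<sigma> in \<open>simp_all add: start_step_def\<close>)

lemma wp_worklist_search_step:
  assumes "search_inv {} (\<sigma> ''count'') (queue \<sigma>)" "bounded_state W \<sigma>" "layout \<sigma>"
  shows "wp W (worklist search_step) (\<lambda>t \<tau>.
    alive_counts (set as) (set as) (\<tau> ''count'') \<and>
    t \<le> 9 + (\<Sum>p\<in>alive_pairs (set as). weight 60 p)) \<sigma>"
proof -
  interpret worklist_body n m s W as search_step "\<lambda>D \<sigma>. search_inv D (\<sigma> ''count'') (queue \<sigma>)"
      "alive_pairs (set as)" 60
    by (rule worklist_body_search_step)
  show ?thesis
  proof (rule wp_mono[OF wp_worklist[OF assms]])
    fix t \<tau>
    define D where "D = copy_edges (set as) (set (queue \<tau>))"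
    assume final: "search_inv (copy_edges (set as) (set (queue \<tau>))) (\<tau> ''count'') (queue \<tau>) \<and>
      t \<le> 9 + (\<Sum>p\<in>set (queue \<tau>). weight 60 p)"
    then have inv: "search_inv D (\<tau> ''count'') (queue \<tau>)"
      by (simp add: D_def)
    then have "alive_pairs (set as) \<subseteq> supported_pairs D"
      by (intro alive_subset_supported) (simp add: D_def search_inv_def)
    with inv have "set (queue \<tau>) = alive_pairs (set as)"
      by (auto simp: search_inv_def)
    with final show "alive_counts (set as) (set as) (\<tau> ''count'') \<and>
        t \<le> 9 + (\<Sum>p\<in>alive_pairs (set as). weight 60 p)"
      by (simp add: search_inv_def)
  qed
qed

lemma wp_search:
  assumes \<sigma>: "bounded_state W \<sigma>" "layout \<sigma>" and zero: "\<And>i. \<sigma> ''count'' i = 0" "queue \<sigma> = []"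
  shows "wp W search (\<lambda>t \<tau>. alive_counts (set as) (set as) (\<tau> ''count'') \<and>
    t \<le> 54 * n + 121 + (\<Sum>p\<in>alive_pairs (set as). weight 60 p)) \<sigma>"
proof -
  define \<sigma>1 where "\<sigma>1 = store \<sigma> ''y'' 0 s"
  have \<sigma>1: "bounded_state W \<sigma>1" "layout \<sigma>1" "\<sigma>1 ''y'' 0 = s"
    using \<sigma> start_less by (simp_all add: \<sigma>1_def)
  have zero1: "\<sigma>1 ''count'' i = 0" "queue \<sigma>1 = []" for i
    using zero by (simp_all add: \<sigma>1_def)
  have "wp W start (\<lambda>t1. wp W (worklist search_step) (\<lambda>t2 \<tau>.
      alive_counts (set as) (set as) (\<tau> ''count'') \<and>
      4 + (t1 + t2) \<le> 54 * n + 121 + (\<Sum>p\<in>alive_pairs (set as). weight 60 p))) \<sigma>1"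
  proof (rule wp_frame[OF wp_start[OF \<sigma>1 zero1] \<sigma>1(1)])
    fix t1 \<sigma>2
    assume started: "search_inv {} (\<sigma>2 ''count'') (queue \<sigma>2) \<and> t1 \<le> 54 * (n + 2)"
      and \<sigma>2: "bounded_state W \<sigma>2" "agree_off (writes start) \<sigma>1 \<sigma>2"
    have "layout \<sigma>2"
      by (rule layout_agree_off[OF \<sigma>1(2) \<sigma>2(2)]) (simp add: start_def start_step_def)
    then show "wp W (worklist search_step) (\<lambda>t2 \<tau>.
        alive_counts (set as) (set as) (\<tau> ''count'') \<and>
        4 + (t1 + t2) \<le> 54 * n + 121 + (\<Sum>p\<in>alive_pairs (set as). weight 60 p)) \<sigma>2"
      using wp_mono[OF wp_worklist_search_step] started \<sigma>2(1) by simp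
  qed
  then show ?thesis
    using \<sigma>(2) start_less by (simp add: search_def wp_Seq wp_Assign \<sigma>1_def)
qed

lemma alive_pairs_between_forward:
  "forward \<subseteq> F \<Longrightarrow> F \<subseteq> set as \<Longrightarrow> alive_pairs F = alive_pairs (set as)"
  by (simp add: alive_def avoids_between_forward_edges)

lemma wp_seed_nonforward_edge:
  assumes F: "forward \<subseteq> F" "F \<subseteq> set as" "(u, v) \<in> F - forward"
    and count: "alive_counts F (set as) (\<sigma> ''count'')" and queue: "queue \<sigma> = []"
    and \<sigma>: "bounded_state W \<sigma>" "layout \<sigma>" "\<sigma> ''del_tail'' 0 = u" "\<sigma> ''y'' 0 = v"
  shows "wp W seed (\<lambda>t \<tau>. alive_counts (F - {(u, v)}) (set as) (\<tau> ''count'') \<and>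
    queue \<tau> = [] \<and> t \<le> 104 * (n + 2)) \<sigma>"
proof -
  define A where "A = alive_pairs (set as)"
  have A: "alive_pairs F = A" "alive_pairs (F - {(u, v)}) = A"
    unfolding A_def using F by (auto intro!: alive_pairs_between_forward)
  then have "cascade_inv A (copy_edges F A) (\<sigma> ''count'') []"
    using cascade_inv_start[of F "\<sigma> ''count''"] F(2) count by (simp add: A_def)
  then have "wp W seed (\<lambda>t \<tau>. cascade_inv A (copy_edges (F - {(u, v)}) A) (\<tau> ''count'') (queue \<tau>) \<and>
      t \<le> 104 * (n + 2)) \<sigma>"
    using queue \<sigma> F(2,3) by (intro wp_seed) auto
  moreover have "supported_pairs (copy_edges (F - {(u, v)}) A) = A"
    using supported_copy_edges_alive A(2) by metis
  ultimately show ?thesis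
    by (elim wp_mono) (simp add: cascade_inv_def A_def)
qed

lemma wp_classify_step:
  assumes F: "forward \<subseteq> F" "F \<subseteq> set as" "(u, v) \<in> F"
    and count: "alive_counts F (set as) (\<sigma> ''count'')"
    and fwd: "edge_table B (\<sigma> ''fwd'')" and queue: "queue \<sigma> = []"
    and \<sigma>: "bounded_state W \<sigma>" "layout \<sigma>" and i: "\<sigma> ''i'' 0 = i" "i < m" "as ! i = (u, v)"
  shows "wp W classify_step (\<lambda>t \<tau>.
    alive_counts (F - ({(u, v)} - forward)) (set as) (\<tau> ''count'') \<and>
    edge_table (B \<union> {(u, v)} \<inter> forward) (\<tau> ''fwd'') \<and> queue \<tau> = [] \<and> t \<le> 104 * n + 230) \<sigma>"
proof -
  define \<sigma>1 where "\<sigma>1 = store (store \<sigma> ''del_tail'' 0 u) ''y'' 0 v"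
  have uv: "u < n" "v < n"
    using nth_edge_bounded[OF i(2,3)] by simp_all
  have input: "\<sigma> ''tail'' i = u" "\<sigma> ''head'' i = v"
    using layout_edge[OF \<sigma>(2) i(2,3)] by simp_all
  have "avoids_table (set as) (\<sigma> ''count'')"
    using avoids_table_if_alive_counts[OF count F(2)] alive_pairs_between_forward[OF F(1,2)] by simp
  then have forward_iff: "0 < \<sigma> ''count'' (v * n + u) \<longleftrightarrow> (u, v) \<in> forward"
    using avoids_table_entry[of "set as" "\<sigma> ''count''" v u] uv F by (auto simp: forward_edges_def)
  show ?thesis
  proof (cases "(u, v) \<in> forward")
    case True
    then have "F - ({(u, v)} - forward) = F" "B \<union> {(u, v)} \<inter> forward = insert (u, v) B"
      by auto
    then show ?thesis
      using True forward_iff count edge_table_insert[OF fwd uv(2)] queue input i(1,2) uv \<sigma>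
      by (simp add: classify_step_def wp_simps)
  next
    case False
    then have sets: "F - ({(u, v)} - forward) = F - {(u, v)}" "B \<union> {(u, v)} \<inter> forward = B"
      by auto
    have \<sigma>1: "bounded_state W \<sigma>1" "layout \<sigma>1"
      using \<sigma> uv by (simp_all add: \<sigma>1_def)
    have "wp W seed (\<lambda>t \<tau>. alive_counts (F - {(u, v)}) (set as) (\<tau> ''count'') \<and>
        queue \<tau> = [] \<and> t \<le> 104 * (n + 2)) \<sigma>1"
      using F False count queue \<sigma>1 by (intro wp_seed_nonforward_edge) (simp_all add: \<sigma>1_def)
    then have "wp W seed (\<lambda>t \<tau>. alive_counts (F - {(u, v)}) (set as) (\<tau> ''count'') \<and>
        edge_table B (\<tau> ''fwd'') \<and> queue \<tau> = [] \<and> 22 + t \<le> 104 * n + 230) \<sigma>1"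
      by (rule wp_frame[OF _ \<sigma>1(1)]) (use fwd in \<open>simp add: agree_off_def \<sigma>1_def\<close>)
    then show ?thesis
      unfolding sets using False forward_iff input i(1,2) uv \<sigma>
      by (simp add: classify_step_def wp_simps \<sigma>1_def)
  qed
qed

definition classify_inv :: "nat \<Rightarrow> state \<Rightarrow> bool" where
  "classify_inv k \<sigma> \<longleftrightarrow>
     alive_counts (set as - (set (take k as) - forward)) (set as) (\<sigma> ''count'') \<and>
     edge_table (set (take k as) \<inter> forward) (\<sigma> ''fwd'') \<and> queue \<sigma> = []"

lemma classify_inv_store [simp]:
  "x \<notin> {''count'', ''fwd'', ''qw'', ''qx'', ''qlen''} \<Longrightarrow>
     classify_inv k (store \<sigma> x i j) \<longleftrightarrow> classify_inv k \<sigma>"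
  by (auto simp: classify_inv_def)

lemma wp_classify_round:
  assumes inv: "classify_inv k \<sigma>" and k: "k < m" "\<sigma> ''i'' 0 = k"
    and \<sigma>: "bounded_state W \<sigma>" "layout \<sigma>"
  shows "wp W classify_step (\<lambda>t \<tau>. classify_inv (Suc k) \<tau> \<and> t \<le> 104 * n + 230) \<sigma>"
proof -
  define F where "F = set as - (set (take k as) - forward)"
  obtain u v where uv: "as ! k = (u, v)"
    by force
  have "(u, v) \<in> set as" "(u, v) \<notin> set (take k as)"
    using k(1) uv nth_mem[of k as] nth_notin_set_take[OF distinct_edges, of k]
    by (simp_all add: length_edges)
  then have F: "forward \<subseteq> F" "F \<subseteq> set as" "(u, v) \<in> F"
    using forward_edges_subset[of s "set as"] by (auto simp: F_def)
  have "wp W classify_step (\<lambda>t \<tau>.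
      alive_counts (F - ({(u, v)} - forward)) (set as) (\<tau> ''count'') \<and>
      edge_table (set (take k as) \<inter> forward \<union> {(u, v)} \<inter> forward) (\<tau> ''fwd'') \<and>
      queue \<tau> = [] \<and> t \<le> 104 * n + 230) \<sigma>"
    using inv k uv \<sigma> F by (intro wp_classify_step) (simp_all add: classify_inv_def F_def)
  moreover have "F - ({(u, v)} - forward) = set as - (set (take (Suc k) as) - forward)"
      "set (take k as) \<inter> forward \<union> {(u, v)} \<inter> forward = set (take (Suc k) as) \<inter> forward"
    by (auto simp: F_def set_take_Suc[OF k(1) uv])
  ultimately show ?thesis
    by (elim wp_mono) (simp add: classify_inv_def)
qed

lemma wp_classify:
  assumes \<sigma>: "bounded_state W \<sigma>" "layout \<sigma>" and fwd: "\<And>i. \<sigma> ''fwd'' i = 0"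
    and count: "alive_counts (set as) (set as) (\<sigma> ''count'')"
  shows "wp W classify (\<lambda>t \<tau>. edge_table forward (\<tau> ''fwd'') \<and>
    alive_counts forward (set as) (\<tau> ''count'') \<and> t \<le> 250 * ((n + 1) * (m + 1))) \<sigma>"
proof -
  define \<sigma>1 where "\<sigma>1 = store \<sigma> ''qlen'' 0 0"
  have \<sigma>1: "bounded_state W \<sigma>1" "layout \<sigma>1"
    using \<sigma> by (simp_all add: \<sigma>1_def)
  have "wp W (For ''i'' (Var ''m'') classify_step) (\<lambda>t \<tau>. edge_table forward (\<tau> ''fwd'') \<and>
      alive_counts forward (set as) (\<tau> ''count'') \<and> 3 + t \<le> 250 * ((n + 1) * (m + 1))) \<sigma>1"
  proof (rule wp_For_const[where I = classify_inv and N = m and B = "104 * n + 230"])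
    show "classify_inv 0 (store \<sigma>1 ''i'' 0 0)"
      using fwd count
      by (simp add: classify_inv_def \<sigma>1_def queue_empty_iff edge_table_def row_major_def)
  next
    fix k \<tau>
    assume k: "k < m" "\<tau> ''i'' 0 = k" and inv: "classify_inv k \<tau>"
      and \<tau>: "bounded_state W \<tau>" "agree_off (insert ''i'' (writes classify_step)) \<sigma>1 \<tau>"
    have "layout \<tau>"
      by (rule layout_agree_off[OF \<sigma>1(2) \<tau>(2)]) (simp add: classify_step_def)
    then show "wp W classify_step
        (\<lambda>t \<tau>'. classify_inv (Suc k) (store \<tau>' ''i'' 0 (Suc k)) \<and> t \<le> 104 * n + 230) \<tau>"
      using wp_classify_round[OF inv k \<tau>(1)] by simp
  next
    fix t \<tau>
    assume "classify_inv m \<tau>" "t \<le> (104 * n + 230 + expr_cost (Var ''m'') + 10) * (m + 1)"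
    moreover have "set (take m as) = set as" "set as \<inter> forward = forward"
      using forward_edges_subset[of s "set as"] by (auto simp: length_edges[symmetric])
    ultimately show "edge_table forward (\<tau> ''fwd'') \<and>
        alive_counts forward (set as) (\<tau> ''count'') \<and> 3 + t \<le> 250 * ((n + 1) * (m + 1))"
      by (simp add: classify_inv_def double_diff Diff_Diff_Int algebra_simps)
  qed (use \<sigma>1 in \<open>simp_all add: classify_step_def\<close>)
  then show ?thesis
    by (simp add: classify_def wp_Seq wp_Assign \<sigma>1_def eval_nat_numeral)
qed

lemma wp_build_counts:
  assumes \<sigma>: "bounded_state W \<sigma>" "layout \<sigma>"
    and zero: "\<And>i. \<sigma> ''count'' i = 0" "queue \<sigma> = []" "\<And>i. \<sigma> ''fwd'' i = 0"
  shows "wp W build_counts (\<lambda>t \<tau>. edge_table forward (\<tau> ''fwd'') \<and>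
    alive_counts forward (set as) (\<tau> ''count'') \<and>
    t \<le> 425 * ((n + 1) * (m + 1)) + (\<Sum>p\<in>alive_pairs (set as). weight 60 p)) \<sigma>"
  unfolding build_counts_def wp_Seq
proof (rule wp_frame[OF wp_search[OF \<sigma> zero(1,2)] \<sigma>(1)])
  fix t1 \<sigma>1
  assume searched: "alive_counts (set as) (set as) (\<sigma>1 ''count'') \<and>
      t1 \<le> 54 * n + 121 + (\<Sum>p\<in>alive_pairs (set as). weight 60 p)"
    and \<sigma>1: "bounded_state W \<sigma>1" "agree_off (writes search) \<sigma> \<sigma>1"
  have "layout \<sigma>1" "\<sigma>1 ''fwd'' i = 0" for i
    using layout_agree_off[OF \<sigma>(2) \<sigma>1(2)] \<sigma>1(2) zero(3) by (simp_all add: agree_off_def)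
  then show "wp W classify (\<lambda>t2 \<tau>. edge_table forward (\<tau> ''fwd'') \<and>
      alive_counts forward (set as) (\<tau> ''count'') \<and>
      t1 + t2 \<le> 425 * ((n + 1) * (m + 1)) + (\<Sum>p\<in>alive_pairs (set as). weight 60 p)) \<sigma>1"
    using wp_mono[OF wp_classify[OF \<sigma>1(1)]] searched by (simp add: algebra_simps)
qed

end


section \<open>Building the tree\<close>

definition ancestor_step :: com where
  "ancestor_step =
     If (Conj (Neg (Equal (Var ''w'') (Var ''x'')))
              (Equal (Cell ''count'' (index (Var ''w'') (Var ''x''))) (Const 0)))
       adopt Skip"

definition find_parent :: com where
  "find_parent =
     Seq (Assign ''parent'' (Var ''x'') (Var ''s'')) (For ''w'' (Var ''n'') ancestor_step)"

definition tree_step :: com where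
  "tree_step =
     Seq (Assign ''in_tree'' (Var ''x'') (Cell ''count'' (index (Var ''n'') (Var ''x''))))
         (If (Equal (Cell ''in_tree'' (Var ''x'')) (Const 0)) Skip find_parent)"

definition build_tree :: com where
  "build_tree = For ''x'' (Var ''n'') tree_step"

lemma writes_tree_step [simp]: "writes tree_step = {''in_tree'', ''parent'', ''w''}"
  by (simp add: tree_step_def find_parent_def ancestor_step_def insert_commute)

lemma writes_build_tree [simp]: "writes build_tree = {''x'', ''in_tree'', ''parent'', ''w''}"
  by (simp add: build_tree_def)

context edge_list
begin

lemma wp_ancestor_step:
  assumes entry: "tree_entry (set as) (dead_copies (set as) x \<inter> {..<w}) r (\<sigma> ''parent'' x) x"
    and table: "avoids_table (set as) (\<sigma> ''count'')"
    and \<sigma>: "bounded_state W \<sigma>" "layout \<sigma>" "\<sigma> ''w'' 0 = w" "\<sigma> ''x'' 0 = x" and wx: "w < n" "x < n"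
  shows "wp W ancestor_step (\<lambda>t \<tau>. (\<exists>p. \<tau> = \<sigma>(''parent'' := (\<sigma> ''parent'')(x := p)) \<and>
    tree_entry (set as) (dead_copies (set as) x \<inter> {..<Suc w}) r p x) \<and> t \<le> 40) \<sigma>"
proof -
  define D where "D = dead_copies (set as) x"
  have dead: "\<sigma> ''count'' (w * n + x) = 0 \<longleftrightarrow> w \<in> D"
    using avoids_table_entry[OF table, of w x] wx
    by (auto simp: D_def dead_copies_def dominators_def)
  show ?thesis
  proof (cases "w \<noteq> x \<and> w \<in> D")
    case True
    then have "D \<inter> {..<Suc w} = insert w (D \<inter> {..<w})"
      by auto
    moreover have "wp W adopt (\<lambda>t \<tau>. (\<exists>p. \<tau> = \<sigma>(''parent'' := (\<sigma> ''parent'')(x := p)) \<and>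
        tree_entry (set as) (insert w (D \<inter> {..<w})) r p x) \<and> t \<le> 18) \<sigma>"
      using entry table \<sigma> wx True by (intro wp_adopt) (simp_all add: D_def dead_copies_def)
    ultimately have "wp W adopt (\<lambda>t \<tau>. (\<exists>p. \<tau> = \<sigma>(''parent'' := (\<sigma> ''parent'')(x := p)) \<and>
        tree_entry (set as) (D \<inter> {..<Suc w}) r p x) \<and> 19 + t \<le> 40) \<sigma>"
      by (elim wp_mono) simp
    then show ?thesis
      using True \<sigma> wx dead by (simp add: ancestor_step_def wp_simps D_def)
  next
    case False
    then consider "w = x" "D \<inter> {..<Suc w} = insert x (D \<inter> {..<w})" | "D \<inter> {..<Suc w} = D \<inter> {..<w}"
      by (cases "w \<in> D") (auto simp: lessThan_Suc)
    then have "tree_entry (set as) (D \<inter> {..<Suc w}) r (\<sigma> ''parent'' x) x"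
      by cases (use entry tree_entry_insert_self[OF wx(2)] in \<open>simp_all add: D_def\<close>)
    moreover have "\<sigma> = \<sigma>(''parent'' := (\<sigma> ''parent'')(x := \<sigma> ''parent'' x))"
      by simp
    ultimately have "\<exists>p. \<sigma> = \<sigma>(''parent'' := (\<sigma> ''parent'')(x := p)) \<and>
        tree_entry (set as) (D \<inter> {..<Suc w}) r p x"
      by blast
    then show ?thesis
      using False \<sigma> wx dead by (cases "w = x") (simp_all add: ancestor_step_def wp_simps D_def)
  qed
qed

lemma wp_find_parent:
  assumes table: "avoids_table (set as) (\<sigma> ''count'')"
    and \<sigma>: "bounded_state W \<sigma>" "layout \<sigma>" "\<sigma> ''x'' 0 = x"
    and x: "(s, x) \<in> (set as)\<^sup>*" "x < n" "r \<noteq> 0"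
  shows "wp W find_parent (\<lambda>t \<tau>. (\<exists>p. \<tau> ''parent'' = (\<sigma> ''parent'')(x := p) \<and>
    tree_entry (set as) (dead_copies (set as) x) r p x) \<and> t \<le> 52 * (n + 1) + 5) \<sigma>"
proof -
  define D where "D = dead_copies (set as) x"
  define \<sigma>1 where "\<sigma>1 = store \<sigma> ''parent'' x s"
  define I where "I w \<tau> \<longleftrightarrow> (\<exists>p. \<tau> ''parent'' = (\<sigma> ''parent'')(x := p) \<and>
    tree_entry (set as) (D \<inter> {..<w}) r p x)" for w \<tau>
  have \<sigma>1: "bounded_state W \<sigma>1" "layout \<sigma>1"
    using \<sigma> start_less by (simp_all add: \<sigma>1_def)
  have "n \<notin> D"
    using n_in_dead_copies_iff[of "set as" x] x(1) by (simp add: D_def)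
  then have "D \<inter> {..<n} = D"
    by (auto simp: D_def dead_copies_def le_less)
  have "wp W (For ''w'' (Var ''n'') ancestor_step) (\<lambda>t \<tau>.
      (\<exists>p. \<tau> ''parent'' = (\<sigma> ''parent'')(x := p) \<and> tree_entry (set as) D r p x) \<and>
      5 + t \<le> 52 * (n + 1) + 5) \<sigma>1"
  proof (rule wp_For_const[where I = I and N = n and B = 40])
    have "tree_entry (set as) {} r s x"
      using start_less x(3) by (auto simp: tree_entry_def intro: deepest_dominator_start)
    then show "I 0 (store \<sigma>1 ''w'' 0 0)"
      by (auto simp: I_def \<sigma>1_def)
  next
    fix w \<tau>
    assume w: "w < n" "\<tau> ''w'' 0 = w" and I: "I w \<tau>"
      and \<tau>: "bounded_state W \<tau>" "agree_off (insert ''w'' (writes ancestor_step)) \<sigma>1 \<tau>"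
    have "layout \<tau>"
      by (rule layout_agree_off[OF \<sigma>1(2) \<tau>(2)]) (simp add: ancestor_step_def)
    moreover have "\<tau> ''count'' = \<sigma> ''count''" "\<tau> ''x'' 0 = x"
      using \<tau>(2) \<sigma>(3) by (simp_all add: agree_off_def ancestor_step_def \<sigma>1_def)
    moreover have "tree_entry (set as) (D \<inter> {..<w}) r (\<tau> ''parent'' x) x"
      using I by (auto simp: I_def)
    ultimately have "wp W ancestor_step (\<lambda>t \<tau>'. (\<exists>p. \<tau>' = \<tau>(''parent'' := (\<tau> ''parent'')(x := p)) \<and>
        tree_entry (set as) (D \<inter> {..<Suc w}) r p x) \<and> t \<le> 40) \<tau>"
      unfolding D_def using table \<tau>(1) w x(2) by (intro wp_ancestor_step) simp_all
    then show "wp W ancestor_step (\<lambda>t \<tau>'. I (Suc w) (store \<tau>' ''w'' 0 (Suc w)) \<and> t \<le> 40) \<tau>"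
      by (rule wp_mono) (use I in \<open>auto simp: I_def\<close>)
  qed (use \<sigma>1 \<open>D \<inter> {..<n} = D\<close> in \<open>simp_all add: ancestor_step_def I_def\<close>)
  then show ?thesis
    using \<sigma> x(2) start_less by (simp add: find_parent_def wp_Seq wp_Assign \<sigma>1_def D_def)
qed

lemma wp_tree_step:
  assumes table: "avoids_table (set as) (\<sigma> ''count'')"
    and \<sigma>: "bounded_state W \<sigma>" "layout \<sigma>" "\<sigma> ''x'' 0 = x" and x: "x < n" "\<sigma> ''parent'' x < n"
  shows "wp W tree_step (\<lambda>t \<tau>. (\<exists>r p. \<tau> ''in_tree'' = (\<sigma> ''in_tree'')(x := r) \<and>
    \<tau> ''parent'' = (\<sigma> ''parent'')(x := p) \<and>
    tree_entry (set as) (dead_copies (set as) x) r p x) \<and>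
    t \<le> 24 + 52 * (n + 1) * of_bool (avoids s (set as) n x)) \<sigma>"
proof -
  define r where "r = \<sigma> ''count'' (n * n + x)"
  define \<sigma>1 where "\<sigma>1 = store \<sigma> ''in_tree'' x r"
  have r: "r \<noteq> 0 \<longleftrightarrow> avoids s (set as) n x"
    using avoids_table_entry[OF table, of n x] x(1) by (simp add: r_def)
  have "r < W"
    using \<sigma>(1) by (simp add: r_def)
  show ?thesis
  proof (cases "r = 0")
    case True
    then have "tree_entry (set as) (dead_copies (set as) x) 0 (\<sigma> ''parent'' x) x"
      using r x(2) by (simp add: tree_entry_def n_in_dead_copies_iff avoids_n_iff)
    moreover have "\<sigma> ''parent'' = (\<sigma> ''parent'')(x := \<sigma> ''parent'' x)"
      by simp
    ultimately have "\<exists>r p. (\<sigma> ''in_tree'')(x := 0) = (\<sigma> ''in_tree'')(x := r) \<and>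
        \<sigma> ''parent'' = (\<sigma> ''parent'')(x := p) \<and>
        tree_entry (set as) (dead_copies (set as) x) r p x"
      by blast
    then show ?thesis
      using True r \<sigma> x(1) by (simp add: tree_step_def wp_simps flip: r_def)
  next
    case False
    have \<sigma>1: "bounded_state W \<sigma>1" "layout \<sigma>1"
      using \<sigma> \<open>r < W\<close> by (simp_all add: \<sigma>1_def)
    have "wp W find_parent (\<lambda>t \<tau>. (\<exists>p. \<tau> ''parent'' = (\<sigma>1 ''parent'')(x := p) \<and>
        tree_entry (set as) (dead_copies (set as) x) r p x) \<and> t \<le> 52 * (n + 1) + 5) \<sigma>1"
      using False r table \<sigma>(3) x(1) by (intro wp_find_parent \<sigma>1) (simp_all add: \<sigma>1_def avoids_n_iff)
    then have "wp W find_parent (\<lambda>t \<tau>. (\<exists>r p. \<tau> ''in_tree'' = (\<sigma> ''in_tree'')(x := r) \<and>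
        \<tau> ''parent'' = (\<sigma> ''parent'')(x := p) \<and>
        tree_entry (set as) (dead_copies (set as) x) r p x) \<and> 18 + t \<le> 24 + 52 * (n + 1)) \<sigma>1"
      by (rule wp_frame[OF _ \<sigma>1(1)])
        (auto simp: agree_off_def find_parent_def ancestor_step_def \<sigma>1_def)
    then show ?thesis
      using False r \<sigma> x(1) \<open>r < W\<close> by (simp add: tree_step_def wp_simps \<sigma>1_def flip: r_def)
  qed
qed

lemma sum_of_bool_avoids_le: "(\<Sum>x<n. of_bool (avoids s (set as) w x)) \<le> m + 1"
proof -
  have "(\<Sum>x<n. of_bool (avoids s (set as) w x) :: nat) = card ({..<n} \<inter> {x. avoids s (set as) w x})"
    by simp
  also have "{..<n} \<inter> {x. avoids s (set as) w x} = {x. avoids s (set as) w x}"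
    using avoids_bounded[of "set as"] by auto
  also have "card {x. avoids s (set as) w x} \<le> m + 1"
    using card_avoids_le[of "set as" s w] by (simp add: card_edges)
  finally show ?thesis .
qed

lemma wp_build_tree:
  assumes \<sigma>: "bounded_state W \<sigma>" "layout \<sigma>" and table: "avoids_table (set as) (\<sigma> ''count'')"
    and parent: "\<And>v. \<sigma> ''parent'' v = 0"
  shows "wp W build_tree (\<lambda>t \<tau>.
    tree_table (set as) (dead_copies (set as)) (\<tau> ''in_tree'') (\<tau> ''parent'') \<and>
    t \<le> 106 * ((n + 1) * (m + 1))) \<sigma>"
proof -
  define I where "I k \<tau> \<longleftrightarrow> (\<forall>v<n. \<tau> ''parent'' v < n) \<and>
    (\<forall>v<k. tree_entry (set as) (dead_copies (set as) v) (\<tau> ''in_tree'' v) (\<tau> ''parent'' v) v)"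
    for k and \<tau> :: state
  define B where "B x = 24 + 52 * (n + 1) * of_bool (avoids s (set as) n x)" for x
  show ?thesis
    unfolding build_tree_def
  proof (rule wp_For[where I = I and N = n and B = B])
    show "I 0 (store \<sigma> ''x'' 0 0)"
      using parent start_less by (simp add: I_def)
  next
    fix x \<tau>
    assume x: "x < n" "\<tau> ''x'' 0 = x" and I: "I x \<tau>"
      and \<tau>: "bounded_state W \<tau>" "agree_off (insert ''x'' (writes tree_step)) \<sigma> \<tau>"
    have "avoids_table (set as) (\<tau> ''count'')"
      using table \<tau>(2) by (simp add: agree_off_def)
    moreover have "layout \<tau>"
      by (rule layout_agree_off[OF \<sigma>(2) \<tau>(2)]) simp
    moreover have "\<tau> ''parent'' x < n"
      using x(1) I by (simp add: I_def)
    ultimately have "wp W tree_step (\<lambda>t \<tau>'. (\<exists>r p. \<tau>' ''in_tree'' = (\<tau> ''in_tree'')(x := r) \<and>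
        \<tau>' ''parent'' = (\<tau> ''parent'')(x := p) \<and>
        tree_entry (set as) (dead_copies (set as) x) r p x) \<and> t \<le> B x) \<tau>"
      unfolding B_def using \<tau>(1) x by (intro wp_tree_step)
    then show "wp W tree_step (\<lambda>t \<tau>'. I (Suc x) (store \<tau>' ''x'' 0 (Suc x)) \<and> t \<le> B x) \<tau>"
      by (rule wp_mono) (use I in \<open>auto simp: I_def less_Suc_eq tree_entry_def\<close>)
  next
    fix t \<tau>
    assume I: "I n \<tau>"
      and time: "t \<le> (\<Sum>x<n. B x + (expr_cost (Var ''n'') + 10)) + (expr_cost (Var ''n'') + 10)"
    have "52 * (n + 1) * (\<Sum>x<n. of_bool (avoids s (set as) n x)) \<le> 52 * (n + 1) * (m + 1)"
      using sum_of_bool_avoids_le by (rule mult_le_mono2)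
    moreover have "(\<Sum>x<n. B x + 12) =
        36 * n + 52 * (n + 1) * (\<Sum>x<n. of_bool (avoids s (set as) n x))"
      by (simp only: B_def sum.distrib sum_distrib_left[symmetric]) simp
    ultimately show "tree_table (set as) (dead_copies (set as)) (\<tau> ''in_tree'') (\<tau> ''parent'') \<and>
        t \<le> 106 * ((n + 1) * (m + 1))"
      using I time by (simp add: I_def tree_table_def algebra_simps)
  qed (use \<sigma> in simp_all)
qed

end


section \<open>The total running time\<close>

definition initialise :: com where
  "initialise = Seq build_adj (Seq build_counts build_tree)"

context edge_list
begin

lemma sum_weight_le:
  assumes "E \<subseteq> set as"
  shows "(\<Sum>p\<in>alive_pairs E. weight B p + c) \<le> (2 * B + 100 + c) * ((n + 1) * (m + 1))"
proof -
  have row: "(\<Sum>x | avoids s E w x. weight B (w, x) + c) \<le> (2 * B + 100 + c) * (m + 1)" for w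
  proof -
    define X where "X = {x. avoids s E w x}"
    have "(\<Sum>x\<in>X. weight B (w, x) + c) =
        (B + 50) * (\<Sum>x\<in>X. card (set as `` {x})) + (B + 50 + c) * card X"
      by (simp add: weight_def sum.distrib sum_distrib_left algebra_simps)
    also have "(\<Sum>x\<in>X. card (set as `` {x})) \<le> m"
      using sum_card_Image_le[of "set as" X] by (simp add: card_edges)
    also have "card X \<le> m + 1"
      using card_avoids_le[of E s w] card_mono[OF _ assms] finite_subset[OF assms]
      by (simp add: X_def card_edges)
    finally have "(\<Sum>x\<in>X. weight B (w, x) + c) \<le> (B + 50) * m + (B + 50 + c) * (m + 1)"
      by simp
    also have "\<dots> \<le> (2 * B + 100 + c) * (m + 1)"
      by (simp add: algebra_simps)
    finally show ?thesis
      by (simp add: X_def)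
  qed
  have "alive_pairs E = (SIGMA w:{..n}. {x. avoids s E w x})"
    by (auto simp: alive_def)
  moreover have "finite {x. avoids s E w x}" for w
    using avoids_bounded[OF assms] by (auto intro: finite_subset[of _ "{..<n}"])
  ultimately have "(\<Sum>p\<in>alive_pairs E. weight B p + c) =
      (\<Sum>w\<le>n. \<Sum>x | avoids s E w x. weight B (w, x) + c)"
    by (simp add: sum.Sigma)
  also have "\<dots> \<le> (\<Sum>w\<le>n. (2 * B + 100 + c) * (m + 1))"
    by (rule sum_mono) (rule row)
  finally show ?thesis
    by (simp add: algebra_simps)
qed

lemma bounded_input_state: "bounded_state W (input_state n s as)"
proof -
  have "fst (as ! i) < W" "snd (as ! i) < W" if "i < length as" for i
    using that nth_edge_bounded[of i "fst (as ! i)" "snd (as ! i)"] by (simp_all add: length_edges)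
  then show ?thesis
    using start_less by (simp add: bounded_state_def input_state_def length_edges)
qed

lemma inputs_input_state: "inputs (input_state n s as)"
  by (simp add: inputs_def input_state_def length_edges)

lemma wp_initialise:
  "wp W initialise (\<lambda>t \<tau>. maintained (set as) \<tau> \<and> t \<le> 1000 * ((n + 1) * (m + 1)))
     (input_state n s as)"
proof -
  define \<sigma>0 where "\<sigma>0 = input_state n s as"
  have zero: "\<sigma>0 x = (\<lambda>_. 0)" if "x \<notin> {''n'', ''m'', ''s'', ''tail'', ''head''}" for x
    using that by (simp add: \<sigma>0_def input_state_def)
  have \<sigma>0: "bounded_state W \<sigma>0" "inputs \<sigma>0" "\<sigma>0 ''deg'' u = 0" for u
    using zero by (simp_all add: \<sigma>0_def bounded_input_state inputs_input_state)
  obtain t1 \<sigma>1 where adj: "exec W build_adj \<sigma>0 t1 \<sigma>1" "layout \<sigma>1" "t1 \<le> 37 * (m + 1)"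
    and \<sigma>1: "bounded_state W \<sigma>1" "agree_off (writes build_adj) \<sigma>0 \<sigma>1"
    by (rule wp_obtain[OF wp_build_adj[OF \<sigma>0] \<sigma>0(1)]) blast
  have "\<sigma>1 ''count'' i = 0" "queue \<sigma>1 = []" "\<sigma>1 ''fwd'' i = 0" for i
    using \<sigma>1(2) zero by (simp_all add: agree_off_def queue_empty_iff)
  then obtain t2 \<sigma>2 where counts: "exec W build_counts \<sigma>1 t2 \<sigma>2"
      "edge_table forward (\<sigma>2 ''fwd'')" "alive_counts forward (set as) (\<sigma>2 ''count'')"
      "t2 \<le> 425 * ((n + 1) * (m + 1)) + (\<Sum>p\<in>alive_pairs (set as). weight 60 p)"
    and \<sigma>2: "bounded_state W \<sigma>2" "agree_off (writes build_counts) \<sigma>1 \<sigma>2"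
    using wp_obtain[OF wp_build_counts[OF \<sigma>1(1) adj(2)] \<sigma>1(1)] by blast
  have forward: "alive_pairs forward = alive_pairs (set as)" "set as \<inter> forward = forward"
    using alive_pairs_between_forward forward_edges_subset[of s "set as"] by blast+
  have "layout \<sigma>2" "\<sigma>2 ''parent'' v = 0" for v
    using layout_agree_off[OF adj(2) \<sigma>2(2)] \<sigma>1(2) \<sigma>2(2) zero by (simp_all add: agree_off_def)
  moreover have "avoids_table (set as) (\<sigma>2 ''count'')"
    using avoids_table_if_alive_counts[OF counts(3) forward_edges_subset] forward(1) by simp
  ultimately obtain t3 \<tau> where tree: "exec W build_tree \<sigma>2 t3 \<tau>"
      "tree_table (set as) (dead_copies (set as)) (\<tau> ''in_tree'') (\<tau> ''parent'')"
      "t3 \<le> 106 * ((n + 1) * (m + 1))"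
    and \<tau>: "bounded_state W \<tau>" "agree_off (writes build_tree) \<sigma>2 \<tau>"
    using wp_obtain[OF wp_build_tree[OF \<sigma>2(1)] \<sigma>2(1)] by blast
  have "maintained (set as) \<tau>"
    using layout_agree_off[OF \<open>layout \<sigma>2\<close> \<tau>(2)] counts(2,3) tree(2) \<tau> forward
    by (simp add: maintained_def agree_off_def)
  moreover have "t1 + (t2 + t3) \<le> 1000 * ((n + 1) * (m + 1))"
    using adj(3) counts(4) tree(3) sum_weight_le[of "set as" 60 0] by (simp add: algebra_simps)
  moreover have "exec W initialise \<sigma>0 (t1 + (t2 + t3)) \<tau>"
    unfolding initialise_def by (rule exec.Seq[OF adj(1) exec.Seq[OF counts(1) tree(1)]])
  ultimately show ?thesis
    unfolding wp_def \<sigma>0_def by blast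
qed

end

context reducible_edge_list
begin

lemma maintains_update:
  assumes "maintained (parcs G) \<sigma>" "parcs G \<subseteq> set as" "set es \<subseteq> {..<n} \<times> {..<n}"
    "flow_graph G s" "pverts G = {..<n}"
  shows "\<exists>t. maintains W update n G s \<sigma> es t \<and>
    t \<le> potential (parcs G) + length es * (400 * (n + 1))"
  using assms
proof (induction es arbitrary: G \<sigma>)
  case Nil
  then show ?case
    by (simp add: maintained_def stored_tree_eq_dominator_tree)
next
  case (Cons e es)
  define G' where "G' = delete_edge G e"
  have G': "parcs G' = parcs G - {e}" "pverts G' = {..<n}" "flow_graph G' s"
    using Cons.prems flow_graph.flow_graph_delete_edge[of G s e]
    by (simp_all add: G'_def delete_edge_def)
  have "wp W update (\<lambda>t \<tau>. maintained (parcs G') \<tau> \<and>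
      t + potential (parcs G') \<le> potential (parcs G) + 400 * (n + 1)) (request e \<sigma>)"
    unfolding G' using Cons.prems by (intro wp_update) auto
  then obtain t1 \<tau> where deleted: "exec W update (request e \<sigma>) t1 \<tau>" "maintained (parcs G') \<tau>"
      "t1 + potential (parcs G') \<le> potential (parcs G) + 400 * (n + 1)"
    unfolding wp_def by blast
  obtain t2 where rest: "maintains W update n G' s \<tau> es t2"
      "t2 \<le> potential (parcs G') + length es * (400 * (n + 1))"
    using Cons.IH[OF deleted(2)] Cons.prems G' by auto
  have "stored_tree n s \<sigma> = dominator_tree G s"
    using Cons.prems by (simp add: maintained_def stored_tree_eq_dominator_tree)
  then have "maintains W update n G s \<sigma> (e # es) (t1 + t2)"
    using deleted(1) rest(1) by (auto simp: G'_def)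
  moreover have "t1 + t2 \<le> potential (parcs G) + length (e # es) * (400 * (n + 1))"
    using deleted(3) rest(2) by simp
  ultimately show ?case
    by blast
qed

lemma maintains_total:
  assumes G: "flow_graph G s" "pverts G = {..<n}" "parcs G = set as"
    and es: "distinct es" "set es \<subseteq> set as"
  shows "\<exists>t0 \<sigma> t. exec W initialise (input_state n s as) t0 \<sigma> \<and> maintains W update n G s \<sigma> es t \<and>
    t0 + t \<le> 2000 * ((n + 1) * (m + 1))"
proof -
  define X where "X = (n + 1) * (m + 1)"
  obtain t0 \<sigma> where init: "exec W initialise (input_state n s as) t0 \<sigma>" "maintained (set as) \<sigma>"
      "t0 \<le> 1000 * X"
    using wp_initialise unfolding wp_def X_def by blast
  have "set es \<subseteq> {..<n} \<times> {..<n}"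
    using es(2) edges_bounded by blast
  then obtain t where upd: "maintains W update n G s \<sigma> es t"
      "t \<le> potential (set as) + length es * (400 * (n + 1))"
    using maintains_update[of G \<sigma> es] init(2) G by auto
  have "length es \<le> m + 1"
    using card_mono[OF _ es(2)] distinct_card[OF es(1)] by (simp add: card_edges)
  then have "length es * (400 * (n + 1)) \<le> (m + 1) * (400 * (n + 1))"
    by (rule mult_le_mono1)
  also have "\<dots> = 400 * X"
    by (simp only: X_def mult_ac)
  finally have "length es * (400 * (n + 1)) \<le> 400 * X" .
  moreover have "potential (set as) \<le> 332 * X"
    using sum_weight_le[of "set as" 90 52] by (simp add: potential_def X_def)
  ultimately have "t0 + t \<le> 2000 * X"
    using init(3) upd(2) by linarith
  then show ?thesis
    using init(1) upd(1) unfolding X_def by blast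
qed

end

lemma word_size_power5:
  fixes n m :: nat
  assumes "0 < n"
  shows "(n + 2) * (n + m + 2) < (n + m + 1) ^ 5"
proof -
  define Y where "Y = n + m + 1"
  have Y: "2 \<le> Y" "n + 2 \<le> 2 * Y" "n + m + 2 \<le> 2 * Y"
    using assms by (simp_all add: Y_def)
  have "(n + 2) * (n + m + 2) \<le> (2 * Y) * (2 * Y)"
    using Y(2,3) by (rule mult_le_mono)
  also have "\<dots> \<le> (Y * Y) * (Y * Y)"
    using Y(1) by (intro mult_le_mono) simp_all
  also have "\<dots> = Y ^ 4"
    by (simp add: power4_eq_xxxx)
  also have "\<dots> < Y ^ 5"
    using Y(1) by (intro power_strict_increasing) simp_all
  finally show ?thesis
    by (simp add: Y_def)
qed

lemma reducible_edge_list_of_flow_graph: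
  assumes "flow_graph G s" "reducible G s" "pverts G = {..<n}" "distinct as" "set as = parcs G"
  shows "reducible_edge_list n (card (parcs G)) s ((n + card (parcs G) + 1) ^ 5) as"
proof -
  interpret flow_graph G s
    by fact
  have "s < n"
    using start_in_verts assms(3) by simp
  then show ?thesis
    using assms acyclic_forward_edges word_size_power5 distinct_card[of as] in_arcsD1 in_arcsD2
    by unfold_locales auto
qed

theorem theorem4:
  shows "\<exists>(init :: com) (upd :: com) (C :: nat) (c :: nat).
    \<forall>(G :: nat pair_pre_digraph) (s :: nat) (n :: nat) (m :: nat)
      (as :: (nat \<times> nat) list) (es :: (nat \<times> nat) list).
      flow_graph G s \<and> reducible G s \<and>
      pverts G = {..<n} \<and> card (parcs G) = m \<and>
      distinct as \<and> set as = parcs G \<and>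
      distinct es \<and> set es \<subseteq> parcs G \<longrightarrow>
      (\<exists>t0 \<sigma> t. exec ((n + m + 1) ^ c) init (input_state n s as) t0 \<sigma> \<and>
        maintains ((n + m + 1) ^ c) upd n G s \<sigma> es t \<and>
        (m \<ge> 1 \<longrightarrow> t0 + t \<le> C * (m * n)))"
proof (rule exI[of _ initialise], rule exI[of _ update], rule exI[of _ 8000], rule exI[of _ 5],
    intro allI impI, elim conjE)
  fix G :: "nat pair_pre_digraph" and s n m :: nat and as es :: "(nat \<times> nat) list"
  assume G: "flow_graph G s" "reducible G s" "pverts G = {..<n}" "card (parcs G) = m"
    and as: "distinct as" "set as = parcs G" and es: "distinct es" "set es \<subseteq> parcs G"
  interpret reducible_edge_list n m s "(n + m + 1) ^ 5" as
    using reducible_edge_list_of_flow_graph[OF G(1-3) as] G(4) by simp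
  obtain t0 \<sigma> t where total: "exec ((n + m + 1) ^ 5) initialise (input_state n s as) t0 \<sigma>"
      "maintains ((n + m + 1) ^ 5) update n G s \<sigma> es t" "t0 + t \<le> 2000 * ((n + 1) * (m + 1))"
    using maintains_total[of G es] G as es by auto
  moreover have "t0 + t \<le> 8000 * (m * n)" if "m \<ge> 1"
  proof -
    have "(n + 1) * (m + 1) \<le> (2 * n) * (2 * m)"
      using start_less that by (intro mult_le_mono) simp_all
    then show ?thesis
      using total(3) by (simp add: algebra_simps)
  qed
  ultimately show "\<exists>t0 \<sigma> t. exec ((n + m + 1) ^ 5) initialise (input_state n s as) t0 \<sigma> \<and>
      maintains ((n + m + 1) ^ 5) update n G s \<sigma> es t \<and> (m \<ge> 1 \<longrightarrow> t0 + t \<le> 8000 * (m * n))"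
    by blast
qed

end
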